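(* Let $H=\ell^2(\mathbb H)$ and let $N\in\mathcal B(H)$ be normal. Let $m\in\mathbb S$ and let $K$ be a compact subset of $\mathbb C^{+}_m$ which is contained in a curve of finite length. Assume that $\sigma_S(N)=\Omega_K$. Then for every $\epsilon>0$ there exist a diagonal operator $D$ on $H$ and a Hilbert–Schmidt operator $K'$ on $H$ with Hilbert–Schmidt norm less than $\epsilon$ such that $N=D+K'$.
   Context: $\mathbb H$ denotes the real quaternions and $\ell^2(\mathbb H)$ the quaternionic Hilbert space of square-summable quaternion sequences (right $\mathbb H$-module, inner product $\langle x,y\rangle=\sum_n\overline{x_n}y_n$). $\mathbb S=\{q\in\mathbb H:\bar q=-q,|q|=1\}$; $\mathbb C_m=\{\alpha+m\beta:\alpha,\beta\in\mathbb R\}$; $\mathbb C_m^{+}=\{\alpha+m\beta:\alpha\ge0,\ \beta\in\mathbb R\}$. $\mathcal B(H)$ is the set of bounded right linear operators; $N$ normal means $NN^*=N^*N$. For a right linear $T$ and $q\in\mathbb H$, $\Delta_q(T)=T^2-T(q+\bar q)+I|q|^2$ on $D(T^2)$; the spherical resolvent $\rho_S(T)$ is the set of $q$ such that $\Delta_q(T)$ is injective, has dense range, and has bounded inverse on its range; the spherical spectrum is $\sigma_S(T)=\mathbb H\setminus\rho_S(T)$. For $K\subseteq\mathbb C_m$, the circularization is $\Omega_K=\{\alpha+j\beta:\alpha,\beta\in\mathbb R,\ \alpha+m\beta\in K,\ j\in\mathbb S\}$. With $\{\phi_r\}$ an orthonormal basis of $H$: $T$ is Hilbert–Schmidt if $\|T\|_2:=\sum_r\|T\phi_r\|^2<\infty$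 (basis independent); $D$ is diagonal if there is an orthonormal basis $\{\phi_r\}$ and $q_r\in\mathbb H$ with $D\phi_r=\phi_rq_r$. *)

theory Defs
  imports "HOL-Analysis.Analysis"
begin

text \<open>Quaternions via the Cayley--Dickson construction: the pair (a,b) of complex
numbers stands for a + b j.  The product type carries the Euclidean norm,
topology and series of the real normed vector space of dimension 4.\<close>

type_synonym quat = "complex \<times> complex"

definition qmul :: "quat \<Rightarrow> quat \<Rightarrow> quat" where
  "qmul p q = (fst p * fst q - snd p * cnj (snd q), fst p * snd q + snd p * cnj (fst q))"

definition qcnj :: "quat \<Rightarrow> quat" where
  "qcnj q = (cnj (fst q), - snd q)"

definition qreal :: "real \<Rightarrow> quat" where
  "qreal r = (complex_of_real r, 0)"

definition Sph :: "quat set" where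
  "Sph = {q. qcnj q = - q \<and> norm q = 1}"

definition Cm :: "quat \<Rightarrow> quat set" where
  "Cm m = {qreal \<alpha> + \<beta> *\<^sub>R m | \<alpha> \<beta>. True}"

definition Cm_plus :: "quat \<Rightarrow> quat set" where
  "Cm_plus m = {qreal \<alpha> + \<beta> *\<^sub>R m | \<alpha> \<beta>. \<alpha> \<ge> 0}"

definition Omega :: "quat \<Rightarrow> quat set \<Rightarrow> quat set" where
  "Omega m K = {qreal \<alpha> + \<beta> *\<^sub>R j | \<alpha> \<beta> j. qreal \<alpha> + \<beta> *\<^sub>R m \<in> K \<and> j \<in> Sph}"

definition finite_length_curve :: "(real \<Rightarrow> quat) \<Rightarrow> bool" where
  "finite_length_curve \<gamma> \<longleftrightarrow> path \<gamma> \<and>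
     (\<exists>L. \<forall>(n::nat) (t::nat \<Rightarrow> real). t 0 = 0 \<and> t n = 1 \<and> (\<forall>i<n. t i \<le> t (Suc i)) \<longrightarrow>
        (\<Sum>i<n. dist (\<gamma> (t i)) (\<gamma> (t (Suc i)))) \<le> L)"

definition l2 :: "(nat \<Rightarrow> quat) set" where
  "l2 = {x. summable (\<lambda>n. (norm (x n))\<^sup>2)}"

definition linner :: "(nat \<Rightarrow> quat) \<Rightarrow> (nat \<Rightarrow> quat) \<Rightarrow> quat" where
  "linner x y = (\<Sum>n. qmul (qcnj (x n)) (y n))"

definition lnorm :: "(nat \<Rightarrow> quat) \<Rightarrow> real" where
  "lnorm x = sqrt (\<Sum>n. (norm (x n))\<^sup>2)"

definition vadd :: "(nat \<Rightarrow> quat) \<Rightarrow> (nat \<Rightarrow> quat) \<Rightarrow> (nat \<Rightarrow> quat)" where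
  "vadd x y = (\<lambda>n. x n + y n)"

definition vsub :: "(nat \<Rightarrow> quat) \<Rightarrow> (nat \<Rightarrow> quat) \<Rightarrow> (nat \<Rightarrow> quat)" where
  "vsub x y = (\<lambda>n. x n - y n)"

definition vmul :: "(nat \<Rightarrow> quat) \<Rightarrow> quat \<Rightarrow> (nat \<Rightarrow> quat)" where
  "vmul x q = (\<lambda>n. qmul (x n) q)"

type_synonym qop = "(nat \<Rightarrow> quat) \<Rightarrow> (nat \<Rightarrow> quat)"

definition right_linear :: "qop \<Rightarrow> bool" where
  "right_linear T \<longleftrightarrow> (\<forall>x\<in>l2. T x \<in> l2) \<and>
     (\<forall>x\<in>l2. \<forall>y\<in>l2. T (vadd x y) = vadd (T x) (T y)) \<and>
     (\<forall>x\<in>l2. \<forall>q. T (vmul x q) = vmul (T x) q)"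

definition bounded_op :: "qop \<Rightarrow> bool" where
  "bounded_op T \<longleftrightarrow> right_linear T \<and> (\<exists>C. \<forall>x\<in>l2. lnorm (T x) \<le> C * lnorm x)"

definition is_adjoint :: "qop \<Rightarrow> qop \<Rightarrow> bool" where
  "is_adjoint T S \<longleftrightarrow> bounded_op S \<and> (\<forall>x\<in>l2. \<forall>y\<in>l2. linner (T x) y = linner x (S y))"

definition normal_op :: "qop \<Rightarrow> bool" where
  "normal_op N \<longleftrightarrow> bounded_op N \<and> (\<exists>S. is_adjoint N S \<and> (\<forall>x\<in>l2. N (S x) = S (N x)))"

text \<open>Delta_q(T) = T^2 - T(q + q bar) + I |q|^2 (on D(T^2) = H for bounded T).\<close>
definition Delta :: "qop \<Rightarrow> quat \<Rightarrow> qop" where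
  "Delta T q x = (\<lambda>n. T (T x) n - qmul (T x n) (q + qcnj q) + qmul (x n) (qreal ((norm q)\<^sup>2)))"

definition rho_S :: "qop \<Rightarrow> quat set" where
  "rho_S T = {q. inj_on (Delta T q) l2 \<and>
      (\<forall>y\<in>l2. \<forall>e>0. \<exists>x\<in>l2. lnorm (vsub (Delta T q x) y) < e) \<and>
      (\<exists>C. \<forall>x\<in>l2. lnorm x \<le> C * lnorm (Delta T q x))}"

definition sigma_S :: "qop \<Rightarrow> quat set" where
  "sigma_S T = UNIV - rho_S T"

definition orthonormal_basis :: "(nat \<Rightarrow> (nat \<Rightarrow> quat)) \<Rightarrow> bool" where
  "orthonormal_basis \<phi> \<longleftrightarrow> (\<forall>r. \<phi> r \<in> l2) \<and>
     (\<forall>r s. linner (\<phi> r) (\<phi> s) = (if r = s then qreal 1 else 0)) \<and>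
     (\<forall>x\<in>l2. (\<forall>r. linner (\<phi> r) x = 0) \<longrightarrow> x = (\<lambda>n. 0))"

definition diagonal_op :: "qop \<Rightarrow> bool" where
  "diagonal_op D \<longleftrightarrow> (\<exists>\<phi> q. orthonormal_basis \<phi> \<and> (\<forall>r. D (\<phi> r) = vmul (\<phi> r) (q r)))"

text \<open>Standard orthonormal basis e_r; the HS quantity is basis independent.\<close>
definition std_basis :: "nat \<Rightarrow> (nat \<Rightarrow> quat)" where
  "std_basis r = (\<lambda>n. if n = r then qreal 1 else 0)"

definition hilbert_schmidt :: "qop \<Rightarrow> bool" where
  "hilbert_schmidt T \<longleftrightarrow> summable (\<lambda>r. (lnorm (T (std_basis r)))\<^sup>2)"

definition hs_norm :: "qop \<Rightarrow> real" where
  "hs_norm T = (\<Sum>r. (lnorm (T (std_basis r)))\<^sup>2)"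

end

theory Submission
  imports Defs
begin

text \<open>
  Write \<open>N = A + S\<close> with \<open>A\<close> selfadjoint and \<open>S\<close> skew, and \<open>B = |S|\<close>. The selfadjoint operators \<open>A\<close>, \<open>B\<close>
  commute with each other and with right multiplication by quaternions, hence so do their joint spectral
  projections over dyadic squares, which real Hilbert space theory provides. A vector \<open>x\<close> with \<open>S x = \<plusminus> B x m\<close> generates a cyclic subspace on which \<open>N\<close> is a complex
  multiplication operator, and a Haar basis of that subspace adapted to the dyadic squares consists of
  approximate eigenvectors: a Haar vector living in a square of side \<open>2\<^sup>-\<^sup>k\<close> has error \<open>O(2\<^sup>-\<^sup>k)\<close>. Only squares
  meeting the spectrum carry Haar vectors, and a curve of finite length meets \<open>O(2\<^sup>k)\<close> squares of side \<open>2\<^sup>-\<^sup>k\<close>,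
  so starting the Haar basis at level \<open>k\<^sub>0\<close> gives a total squared error of order
  \<open>\<Sum>k\<ge>k\<^sub>0. 2\<^sup>k 4\<^sup>-\<^sup>k\<close>, which is as small as desired. The space is a countable
  orthogonal sum of such cyclic subspaces, with errors \<open>\<epsilon> / 2\<^sup>n\<close>.
\<close>

section \<open>Square roots and projections in a real Hilbert space\<close>

text \<open>Quaternionic scalars do not commute: multiplying an eigenvector on the right by a scalar
  conjugates its eigenvalue. Spectral theory is therefore done over the reals, and
  \<open>cyc x\<close> is only a real span. On it \<open>hinner\<close> takes real values, so a Haar
  basis found by real orthogonalisation is already orthonormal over the quaternions. The spherical
  spectrum enters only through counting. A square with nonzero projection contains a joint
  approximate eigenvalue \<open>(a, b)\<close> of \<open>A\<close> and \<open>B\<close>, and there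
  \<open>Delta\<close> at \<open>a + b m\<close> is not bounded below. Membership in
  \<open>Omega m K\<close> determines only \<open>a\<close> and \<open>\<bar>b\<bar>\<close>, so the
  curve and its mirror image both count. The length hypothesis makes the error series converge: a
  set of positive area meets on the order of \<open>4^k\<close> squares of side \<open>2^-k\<close>,
  which would cancel the squared errors \<open>4^-k\<close>. Errors are measured by their squares
  because \<open>hs_norm\<close> is a sum of squares with no root.\<close>

definition adj :: "('a::real_inner \<Rightarrow>\<^sub>L 'a) \<Rightarrow> ('a \<Rightarrow>\<^sub>L 'a) \<Rightarrow> bool" where
  "adj S T \<longleftrightarrow> (\<forall>x y. inner (S x) y = inner x (T y))"

abbreviation selfadj :: "('a::real_inner \<Rightarrow>\<^sub>L 'a) \<Rightarrow> bool" where
  "selfadj T \<equiv> adj T T"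

definition commutes :: "('a::real_normed_vector \<Rightarrow>\<^sub>L 'a) \<Rightarrow> ('a \<Rightarrow>\<^sub>L 'a) \<Rightarrow> bool" where
  "commutes S T \<longleftrightarrow> (\<forall>x. S (T x) = T (S x))"

lemma adjD: "adj S T \<Longrightarrow> inner (blinfun_apply S x) y = inner x (blinfun_apply T y)"
  by (simp add: adj_def)

lemma commutesD: "commutes S T \<Longrightarrow> blinfun_apply S (blinfun_apply T x) = blinfun_apply T (blinfun_apply S x)"
  by (simp add: commutes_def)

lemma commutes_sym: "commutes S T \<Longrightarrow> commutes T S"
  by (simp add: commutes_def)

text \<open>Adjointness is a relation because every adjoint that occurs is given explicitly, such as
  \<open>rmul (qcnj q)\<close> for \<open>rmul q\<close>. Taking adjoints of
  \<open>S T = T S\<close> reverses both products, which is commutation again.\<close>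

lemma commutes_adj:
  assumes "commutes S T" "adj S S'" "adj T T'"
  shows "commutes S' T'"
  unfolding commutes_def
proof
  fix x
  have "inner y (S' (T' x)) = inner y (T' (S' x))" for y
    using assms(1) by (simp add: commutes_def flip: adjD[OF assms(2)] adjD[OF assms(3)])
  then show "S' (T' x) = T' (S' x)"
    using vector_eq_ldot by blast
qed

text \<open>Classical iteration for the square root of \<open>1 - C\<close>: a fixed point
  \<open>L\<close> satisfies \<open>L^2 - 2 L + C = 0\<close>, that is
  \<open>(1 - L)^2 = 1 - C\<close>.\<close>

fun sqrt_iter :: "('a::real_normed_vector \<Rightarrow>\<^sub>L 'a) \<Rightarrow> nat \<Rightarrow> ('a \<Rightarrow>\<^sub>L 'a)" where
  "sqrt_iter C 0 = 0"
| "sqrt_iter C (Suc n) = (1/2) *\<^sub>R ((sqrt_iter C n o\<^sub>L sqrt_iter C n) + C)"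

text \<open>The same iteration for the scalar \<open>C = 1\<close>; it majorises the operator
  iteration whenever \<open>norm C \<le> 1\<close>.\<close>

fun sqrt_iter_bound :: "nat \<Rightarrow> real" where
  "sqrt_iter_bound 0 = 0"
| "sqrt_iter_bound (Suc n) = ((sqrt_iter_bound n)\<^sup>2 + 1) / 2"

lemma sqrt_iter_bound_range: "0 \<le> sqrt_iter_bound n \<and> sqrt_iter_bound n \<le> 1"
proof (induction n)
  case (Suc n)
  then have "(sqrt_iter_bound n)\<^sup>2 \<le> 1"
    by (simp add: abs_square_le_1)
  then show ?case by simp
qed simp

lemma sqrt_iter_bound_mono: "sqrt_iter_bound n \<le> sqrt_iter_bound (Suc n)"
proof -
  have "0 \<le> (sqrt_iter_bound n - 1)\<^sup>2" by simp
  then show ?thesis by (simp add: power2_eq_square algebra_simps)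
qed

lemma convergent_sqrt_iter_bound: "convergent sqrt_iter_bound"
proof -
  have "incseq sqrt_iter_bound"
    by (rule incseq_SucI) (rule sqrt_iter_bound_mono)
  moreover have "\<forall>n. sqrt_iter_bound n \<le> 1"
    using sqrt_iter_bound_range by blast
  ultimately obtain l where "sqrt_iter_bound \<longlonglongrightarrow> l"
    by (rule incseq_convergent)
  then show ?thesis
    by (rule convergentI)
qed

lemma sqrt_iter_commutes: "commutes T C \<Longrightarrow> commutes T (sqrt_iter C n)"
  by (induction n) (auto simp: commutes_def blinfun.bilinear_simps)

lemma sqrt_iter_commutes_self: "commutes (sqrt_iter C m) (sqrt_iter C n)"
  by (intro sqrt_iter_commutes commutes_sym[OF sqrt_iter_commutes]) (simp add: commutes_def)

lemma norm_sqrt_iter: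
  assumes "norm C \<le> 1"
  shows "norm (sqrt_iter C n) \<le> sqrt_iter_bound n"
proof (induction n)
  case (Suc n)
  have "norm (sqrt_iter C n o\<^sub>L sqrt_iter C n) \<le> (sqrt_iter_bound n)\<^sup>2"
    using norm_blinfun_compose[of "sqrt_iter C n" "sqrt_iter C n"] Suc
      mult_mono[OF Suc Suc] sqrt_iter_bound_range[of n]
    by (simp add: power2_eq_square)
  then show ?case
    using assms norm_triangle_ineq[of "sqrt_iter C n o\<^sub>L sqrt_iter C n" C] by simp
qed simp

text \<open>The iterates commute, so a difference of squares factors as
  \<open>(A - B) (A + B)\<close>, with norm at most \<open>(a - b) (a + b)\<close>, the same
  difference for the scalar majorants. Telescoping of the scalars then gives norm
  convergence.\<close>

lemma norm_sqrt_iter_diff: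
  assumes "norm C \<le> 1"
  shows "norm (sqrt_iter C (Suc n) - sqrt_iter C n) \<le> sqrt_iter_bound (Suc n) - sqrt_iter_bound n"
proof (induction n)
  case 0
  then show ?case using assms by simp
next
  case (Suc n)
  define A where "A = sqrt_iter C (Suc n)"
  define B where "B = sqrt_iter C n"
  define a where "a = sqrt_iter_bound (Suc n)"
  define b where "b = sqrt_iter_bound n"
  have nA: "norm A \<le> a" and nB: "norm B \<le> b" and nAB: "norm (A - B) \<le> a - b"
    using norm_sqrt_iter[OF assms] Suc by (simp_all only: A_def B_def a_def b_def)
  have A2: "sqrt_iter C (Suc (Suc n)) = (1/2) *\<^sub>R ((A o\<^sub>L A) + C)"
    by (simp only: sqrt_iter.simps(2)[of C "Suc n"] A_def)
  have C: "C = 2 *\<^sub>R A - (B o\<^sub>L B)"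
    by (simp add: A_def B_def)
  have A3: "sqrt_iter C (Suc (Suc n)) = (1/2) *\<^sub>R ((A o\<^sub>L A) + (2 *\<^sub>R A - (B o\<^sub>L B)))"
    unfolding C[symmetric] by (rule A2)
  have AB: "A (B x) = B (A x)" for x
    unfolding A_def B_def using sqrt_iter_commutes_self commutesD by blast
  have "sqrt_iter C (Suc (Suc n)) - A = (1/2) *\<^sub>R ((A - B) o\<^sub>L (A + B))"
    by (rule blinfun_eqI) (simp add: A3 blinfun.bilinear_simps AB algebra_simps del: sqrt_iter.simps)
  then have "norm (sqrt_iter C (Suc (Suc n)) - A) \<le> 1/2 * (norm (A - B) * norm (A + B))"
    using norm_blinfun_compose[of "A - B" "A + B"] by simp
  also have "\<dots> \<le> 1/2 * ((a - b) * (a + b))"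
    using nA nB nAB norm_triangle_ineq[of A B] order_trans[OF norm_ge_zero nAB] by (intro mult_left_mono mult_mono) auto
  also have "\<dots> = (a\<^sup>2 + 1) / 2 - (b\<^sup>2 + 1) / 2"
    by (simp add: power2_eq_square field_simps)
  also have "\<dots> = sqrt_iter_bound (Suc (Suc n)) - a"
    by (simp only: sqrt_iter_bound.simps(2) a_def b_def)
  finally show ?case by (simp only: A_def a_def)
qed

lemma selfadj_sqrt_iter: "selfadj C \<Longrightarrow> selfadj (sqrt_iter C n)"
  by (induction n) (auto simp: adj_def blinfun.bilinear_simps inner_add_left inner_add_right)

text \<open>The root is \<open>1 - L\<close> for the limit \<open>L\<close>; it is positive because
  \<open>norm L \<le> 1\<close>, and it inherits its commutation properties from the
  iterates.\<close>

lemma selfadj_sqrt: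
  fixes C :: "'a::{real_inner,banach} \<Rightarrow>\<^sub>L 'a"
  assumes "selfadj C" "norm C \<le> 1"
  obtains R where "selfadj R" "\<And>x. inner (blinfun_apply R x) x \<ge> 0" "\<And>x. blinfun_apply R (R x) = x - C x"
    "\<And>T. commutes T C \<Longrightarrow> commutes T R"
proof -
  let ?Y = "sqrt_iter C"
  have "summable (\<lambda>n. ?Y (Suc n) - ?Y n)"
  proof (rule summable_comparison_test')
    show "summable (\<lambda>n. sqrt_iter_bound (Suc n) - sqrt_iter_bound n)"
      using convergent_sqrt_iter_bound telescope_summable unfolding convergent_def by blast
  qed (rule norm_sqrt_iter_diff[OF assms(2)])
  then have "convergent (\<lambda>n. \<Sum>k<n. ?Y (Suc k) - ?Y k)"
    by (simp add: summable_iff_convergent)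
  moreover have "(\<lambda>n. \<Sum>k<n. ?Y (Suc k) - ?Y k) = ?Y"
    by (subst sum_lessThan_telescope) auto
  ultimately obtain L where L: "?Y \<longlonglongrightarrow> L"
    by (auto simp: convergent_def)
  have Lx: "(\<lambda>n. ?Y n x) \<longlonglongrightarrow> L x" for x
    by (intro tendsto_intros L)
  have "(\<lambda>n. ?Y (Suc n)) \<longlonglongrightarrow> (1/2) *\<^sub>R ((L o\<^sub>L L) + C)"
    by (auto intro!: tendsto_intros L bounded_bilinear.tendsto[OF bounded_bilinear_blinfun_compose])
  moreover have "(\<lambda>n. ?Y (Suc n)) \<longlonglongrightarrow> L"
    using L LIMSEQ_Suc by blast
  ultimately have Leq: "L = (1/2) *\<^sub>R ((L o\<^sub>L L) + C)"
    using LIMSEQ_unique by blast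
  have fixx: "L (L x) = 2 *\<^sub>R L x - C x" for x
  proof -
    have "L x = (1/2) *\<^sub>R (L (L x) + C x)"
      by (subst Leq) (simp add: blinfun.bilinear_simps)
    then have "2 *\<^sub>R L x = 2 *\<^sub>R (1/2) *\<^sub>R (L (L x) + C x)"
      by (rule arg_cong)
    then have "2 *\<^sub>R L x = L (L x) + C x"
      by simp
    then show ?thesis by (simp only: eq_diff_eq)
  qed
  have "selfadj L"
    unfolding adj_def
  proof (intro allI)
    fix x y
    have "(\<lambda>n. inner (?Y n x) y) \<longlonglongrightarrow> inner (L x) y"
      by (intro tendsto_intros Lx)
    moreover have "(\<lambda>n. inner (?Y n x) y) \<longlonglongrightarrow> inner x (L y)"
      unfolding adjD[OF selfadj_sqrt_iter[OF assms(1)]] by (intro tendsto_intros Lx)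
    ultimately show "inner (L x) y = inner x (L y)"
      by (rule LIMSEQ_unique)
  qed
  have "norm L \<le> 1"
  proof (rule LIMSEQ_le_const2[OF tendsto_norm[OF L]])
    show "\<exists>N. \<forall>n\<ge>N. norm (?Y n) \<le> 1"
      using norm_sqrt_iter[OF assms(2)] sqrt_iter_bound_range order_trans by blast
  qed
  have pos: "inner (L x) x \<le> inner x x" for x
  proof -
    have "inner (L x) x \<le> norm (L x) * norm x"
      by (rule norm_cauchy_schwarz)
    also have "\<dots> \<le> norm x * norm x"
      using norm_blinfun[of L x] mult_right_mono[OF \<open>norm L \<le> 1\<close>, of "norm x"]
      by (intro mult_right_mono) auto
    finally show ?thesis by (simp add: power2_eq_square flip: power2_norm_eq_inner)
  qed
  show thesis
  proof (rule that[of "id_blinfun - L"])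
    show "selfadj (id_blinfun - L)"
      using \<open>selfadj L\<close> by (simp add: adj_def blinfun.bilinear_simps inner_diff_left inner_diff_right)
    show "0 \<le> inner (blinfun_apply (id_blinfun - L) x) x" for x
      using pos by (simp add: blinfun.bilinear_simps inner_diff_left)
    show "blinfun_apply (id_blinfun - L) (blinfun_apply (id_blinfun - L) x) = x - C x" for x
      by (simp add: blinfun.bilinear_simps fixx algebra_simps scaleR_2)
    show "commutes T (id_blinfun - L)" if "commutes T C" for T
    proof -
      have "T (L x) = L (T x)" for x
      proof -
        have "(\<lambda>n. T (?Y n x)) \<longlonglongrightarrow> T (L x)"
          by (intro tendsto_intros Lx)
        moreover have "(\<lambda>n. T (?Y n x)) \<longlonglongrightarrow> L (T x)"
          unfolding commutesD[OF sqrt_iter_commutes[OF that]] by (rule Lx)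
        ultimately show ?thesis by (rule LIMSEQ_unique)
      qed
      then show ?thesis by (simp add: commutes_def blinfun.bilinear_simps)
    qed
  qed
qed

lemma closed_subspace_nearest_point:
  fixes V :: "'a::{real_inner,banach} set"
  assumes V: "subspace V" "closed V"
  obtains y where "y \<in> V" "\<And>v. v \<in> V \<Longrightarrow> inner (x - y) v = 0"
proof -
  define d where "d = infdist x V"
  have ne: "V \<noteq> {}" using V subspace_0 by blast
  have dle: "d \<le> norm (x - v)" if "v \<in> V" for v
    unfolding d_def using infdist_le[OF that] by (simp add: dist_norm)
  have d0: "0 \<le> d" by (simp add: d_def infdist_nonneg)
  have "\<exists>v\<in>V. norm (x - v) < sqrt (d\<^sup>2 + 1 / Suc n)" for n
  proof -
    have "d < sqrt (d\<^sup>2 + 1 / Suc n)" using d0 by (simp add: real_less_rsqrt)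
    then show ?thesis unfolding d_def
      using infdist_notempty[OF ne, of x] cINF_less_iff[OF ne, of "\<lambda>a. dist x a"] bdd_belowI2[of V 0 "\<lambda>a. dist x a"]
      by (auto simp: dist_norm)
  qed
  then have "\<exists>w. \<forall>n. w n \<in> V \<and> norm (x - w n) < sqrt (d\<^sup>2 + 1 / Suc n)"
    by (intro choice) blast
  then obtain w where w: "\<And>n. w n \<in> V" "\<And>n. norm (x - w n) < sqrt (d\<^sup>2 + 1 / Suc n)"
    by blast
  have w2: "(norm (x - w n))\<^sup>2 \<le> d\<^sup>2 + 1 / Suc n" for n
  proof -
    have "(norm (x - w n))\<^sup>2 \<le> (sqrt (d\<^sup>2 + 1 / Suc n))\<^sup>2"
      using w(2)[of n] by (intro power_mono) auto
    then show ?thesis by (simp add: add_nonneg_nonneg)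
  qed
  have cau: "(norm (w k - w n))\<^sup>2 \<le> 2 / Suc k + 2 / Suc n" for k n
  proof -
    have "(1/2) *\<^sub>R (w k + w n) \<in> V"
      using V(1) w(1) by (simp add: subspace_add subspace_scale)
    then have "d\<^sup>2 \<le> (norm (x - (1/2) *\<^sub>R (w k + w n)))\<^sup>2"
      using dle d0 by (simp add: power_mono)
    \<comment> \<open>Parallelogram law: the midpoint lies in \<open>V\<close>, hence at distance at
      least \<open>d\<close> from \<open>x\<close>, and this makes the minimising sequence
      Cauchy.\<close>
    moreover have "(norm (w k - w n))\<^sup>2 = 2 * (norm (x - w k))\<^sup>2 + 2 * (norm (x - w n))\<^sup>2
        - 4 * (norm (x - (1/2) *\<^sub>R (w k + w n)))\<^sup>2"
      by (simp add: power2_norm_eq_inner algebra_simps inner_commute)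
    ultimately show ?thesis using w2[of k] w2[of n] by simp
  qed
  have "Cauchy w"
  proof (rule metric_CauchyI)
    fix e :: real assume "e > 0"
    obtain M :: nat where "4 / e\<^sup>2 < M" using reals_Archimedean2 by blast
    then have M: "4 / e\<^sup>2 < Suc M" by simp
    show "\<exists>M. \<forall>m\<ge>M. \<forall>n\<ge>M. dist (w m) (w n) < e"
    proof (intro exI allI impI)
      fix k n assume "M \<le> k" "M \<le> n"
      then have "2 / real (Suc k) \<le> 2 / Suc M" "2 / real (Suc n) \<le> 2 / Suc M"
        by (auto intro!: divide_left_mono)
      moreover have "4 / real (Suc M) < e\<^sup>2"
        using M \<open>e > 0\<close> by (simp add: field_simps)
      ultimately have "(norm (w k - w n))\<^sup>2 < e\<^sup>2" using cau[of k n] by simp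
      then show "dist (w k) (w n) < e"
        using \<open>e > 0\<close> by (simp add: dist_norm power2_less_imp_less)
    qed
  qed
  then obtain y where y: "w \<longlonglongrightarrow> y"
    using Cauchy_convergent unfolding convergent_def by blast
  have yV: "y \<in> V"
    using closed_sequentially[OF V(2) _ y] w(1) by blast
  have "(\<lambda>n. (norm (x - w n))\<^sup>2) \<longlonglongrightarrow> (norm (x - y))\<^sup>2"
    by (intro tendsto_intros y)
  moreover have "(\<lambda>n. d\<^sup>2 + 1 / Suc n) \<longlonglongrightarrow> d\<^sup>2 + 0"
    by (rule tendsto_add[OF tendsto_const LIMSEQ_Suc[OF lim_1_over_n]])
  ultimately have "(norm (x - y))\<^sup>2 \<le> d\<^sup>2 + 0"
    by (rule LIMSEQ_le) (use w2 in blast)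
  then have yd: "(norm (x - y))\<^sup>2 \<le> d\<^sup>2" by simp
  have "inner (x - y) v = 0" if "v \<in> V" for v
  proof (cases "v = 0")
    case False
    \<comment> \<open>This \<open>t\<close> minimises \<open>norm (x - y - t *\<^sub>R v)\<close>; a
      nonzero inner product would push the distance below \<open>d\<close>.\<close>
    define t where "t = inner (x - y) v / inner v v"
    have "y + t *\<^sub>R v \<in> V" using yV that V(1) by (simp add: subspace_add subspace_scale)
    then have "d\<^sup>2 \<le> (norm (x - y - t *\<^sub>R v))\<^sup>2"
      using dle[of "y + t *\<^sub>R v"] d0 by (simp add: power_mono diff_diff_eq)
    also have "\<dots> = (norm (x - y))\<^sup>2 - 2 * t * inner (x - y) v + t\<^sup>2 * inner v v"
      unfolding power2_norm_eq_inner
      by (simp add: inner_diff_left inner_diff_right inner_commute power2_eq_square algebra_simps)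
    also have "\<dots> = (norm (x - y))\<^sup>2 - (inner (x - y) v)\<^sup>2 / inner v v"
      using False by (simp add: t_def field_simps power2_eq_square)
    finally have "(inner (x - y) v)\<^sup>2 / inner v v \<le> 0" using yd by simp
    moreover have "inner v v > 0" using False by simp
    ultimately show ?thesis by (simp add: divide_le_0_iff)
  qed simp
  then show thesis using that yV by blast
qed

lemma closed_subspace_projection:
  fixes V :: "'a::{real_inner,banach} set"
  assumes V: "subspace V" "closed V"
  obtains P :: "'a \<Rightarrow>\<^sub>L 'a" where "selfadj P" "\<And>x. P x \<in> V" "\<And>x. x \<in> V \<Longrightarrow> P x = x"
proof -
  have "\<exists>y. y \<in> V \<and> (\<forall>v\<in>V. inner (x - y) v = 0)" for x
    using closed_subspace_nearest_point[OF V, of x] by metis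
  then obtain p where p: "\<And>x. p x \<in> V" "\<And>x v. v \<in> V \<Longrightarrow> inner (x - p x) v = 0"
    by metis
  have uniq: "p x = y" if "y \<in> V" "\<And>v. v \<in> V \<Longrightarrow> inner (x - y) v = 0" for x y
  proof -
    have "p x - y \<in> V" using p that V by (simp add: subspace_diff)
    then have "inner (x - y) (p x - y) = 0" "inner (x - p x) (p x - y) = 0"
      using that p by blast+
    then have "inner (p x - y) (p x - y) = 0" by (simp add: inner_diff_left)
    then show ?thesis by simp
  qed
  have add: "p (x + y) = p x + p y" for x y
  proof (rule uniq)
    show "inner (x + y - (p x + p y)) v = 0" if "v \<in> V" for v
      using p(2)[OF that, of x] p(2)[OF that, of y] by (simp add: inner_diff_left inner_add_left)
  qed (use p V in \<open>auto simp: subspace_add\<close>)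
  have scale: "p (r *\<^sub>R x) = r *\<^sub>R p x" for r x
  proof (rule uniq)
    show "inner (r *\<^sub>R x - r *\<^sub>R p x) v = 0" if "v \<in> V" for v
      using p(2)[OF that, of x] by (simp flip: scaleR_diff_right)
  qed (use p V in \<open>auto simp: subspace_scale\<close>)
  have "norm (p x) \<le> norm x" for x
  proof -
    have "(norm x)\<^sup>2 = (norm (p x))\<^sup>2 + (norm (x - p x))\<^sup>2"
      using p(2)[OF p(1), of x x] by (simp add: power2_norm_eq_inner algebra_simps inner_commute)
    then show ?thesis by (intro power2_le_imp_le[OF _ norm_ge_zero]) simp
  qed
  then have "bounded_linear p"
    by (intro bounded_linear_intro[where K=1]) (auto simp: add scale)
  then have ap: "blinfun_apply (Blinfun p) = p" by (simp add: bounded_linear_Blinfun_apply)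
  show thesis
  proof (rule that[of "Blinfun p"])
    show "selfadj (Blinfun p)" unfolding adj_def ap
    proof (intro allI)
      fix x y
      have "inner (x - p x) (p y) = 0" "inner (y - p y) (p x) = 0"
        using p by blast+
      then have "inner x (p y) = inner (p x) (p y)" "inner y (p x) = inner (p y) (p x)"
        by (simp_all add: inner_diff_left)
      then show "inner (p x) y = inner x (p y)" by (simp only: inner_commute)
    qed
    show "blinfun_apply (Blinfun p) x \<in> V" for x unfolding ap by (rule p)
    show "blinfun_apply (Blinfun p) x = x" if "x \<in> V" for x
      unfolding ap by (rule uniq) (use that in auto)
  qed
qed

text \<open>With \<open>R = |T|\<close> the projection onto the kernel of the positive part \<open>(R + T) / 2\<close> separates the
  nonpositive from the nonnegative spectrum of \<open>T\<close>.\<close>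

lemma spectral_projection_sign:
  fixes T :: "'a::{real_inner,banach} \<Rightarrow>\<^sub>L 'a"
  assumes T: "selfadj T"
  obtains P where "selfadj P" "\<And>x. blinfun_apply P (P x) = P x"
    "\<And>R R'. adj R R' \<Longrightarrow> commutes R T \<Longrightarrow> commutes R P"
    "\<And>x. P x = x \<Longrightarrow> inner (T x) x \<le> 0" "\<And>x. P x = 0 \<Longrightarrow> inner (T x) x \<ge> 0"
proof -
  \<comment> \<open>Scaling into the unit ball, as \<open>selfadj_sqrt\<close> requires; the summand
    \<open>1\<close> covers \<open>T = 0\<close>.\<close>
  define c where "c = inverse (norm T + 1)"
  have c0: "c > 0" unfolding c_def by (simp add: add_nonneg_pos)
  define t where "t = c *\<^sub>R T"
  have nt: "norm t \<le> 1" unfolding t_def c_def by (simp add: field_simps add_pos_nonneg)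
  have at: "selfadj t" using T by (simp add: t_def adj_def blinfun.bilinear_simps)
  \<comment> \<open>With this \<open>C\<close> the root of \<open>1 - C\<close> is the modulus of
    \<open>t\<close>.\<close>
  define C where "C = id_blinfun - (t o\<^sub>L t)"
  have aC: "selfadj C"
    using at by (simp add: C_def adj_def blinfun.bilinear_simps inner_diff_left inner_diff_right)
  have nC: "norm C \<le> 1"
  proof (rule norm_blinfun_bound)
    fix x
    have le: "norm (t y) \<le> norm y" for y
      using norm_blinfun[of t y] mult_right_mono[OF nt, of "norm y"] by simp
    have "(norm (C x))\<^sup>2 = (norm x)\<^sup>2 - 2 * (norm (t x))\<^sup>2 + (norm (t (t x)))\<^sup>2"
    proof -
      have "C x = x - t (t x)" by (simp add: C_def blinfun.bilinear_simps)
      moreover have "inner x (t (t x)) = (norm (t x))\<^sup>2"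
        unfolding power2_norm_eq_inner adjD[OF at] ..
      ultimately show ?thesis
        by (simp add: power2_norm_eq_inner inner_diff_left inner_diff_right inner_commute)
    qed
    also have "\<dots> \<le> (norm x)\<^sup>2"
      using power_mono[OF le[of "t x"] norm_ge_zero, of 2] zero_le_power2[of "norm (t x)"] by linarith
    finally have "norm (C x) \<le> norm x" by (rule power2_le_imp_le) simp
    then show "norm (C x) \<le> 1 * norm x" by simp
  qed simp
  obtain R where R: "selfadj R" "\<And>x. inner (R x) x \<ge> 0" "\<And>x. R (R x) = x - C x"
    "\<And>T. commutes T C \<Longrightarrow> commutes T R"
    using selfadj_sqrt[OF aC nC] by metis
  have RR: "R (R x) = t (t x)" for x by (simp add: R(3) C_def blinfun.bilinear_simps)
  have comC: "commutes Q C" if "commutes Q t" for Q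
    using that by (simp add: commutes_def C_def blinfun.bilinear_simps)
  have Rt: "R (t x) = t (R x)" for x
    using R(4)[OF comC, of t] by (simp add: commutes_def)
  define U where "U = R + t"
  define V where "V = {x. U x = 0}"
  have "subspace V" unfolding V_def
    by (auto simp: subspace_def blinfun.bilinear_simps)
  moreover have "closed V" unfolding V_def
    by (intro closed_Collect_eq continuous_intros)
  ultimately obtain P where P: "selfadj P" "\<And>x. P x \<in> V" "\<And>x. x \<in> V \<Longrightarrow> P x = x"
    using closed_subspace_projection by blast
  show thesis
  proof (rule that[of P])
    show "selfadj P" by fact
    show "P (P x) = P x" for x using P by blast
    show "commutes Q P" if "adj Q Q'" "commutes Q T" for Q Q'
    proof -
      \<comment> \<open>The kernel of \<open>U\<close> is invariant under whatever commutes with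
        \<open>t\<close>, hence under \<open>Q\<close> and \<open>Q'\<close>. Invariance under
        \<open>Q'\<close> gives \<open>P Q = P Q P\<close> by taking adjoints, and invariance under
        \<open>Q\<close> gives \<open>P Q P = Q P\<close>.\<close>
      have inv: "P (W (P x)) = W (P x)" if "commutes W t" for W x
      proof -
        have "commutes W U"
          using R(4)[OF comC, OF that] that by (simp add: U_def commutes_def blinfun.bilinear_simps)
        then have "U (W (P x)) = W (U (P x))" by (simp add: commutes_def)
        also have "\<dots> = 0" using P(2)[of x] by (simp add: V_def)
        finally show ?thesis using P(3) by (simp add: V_def)
      qed
      have Qt: "commutes Q t" using that(2) by (simp add: t_def commutes_def blinfun.bilinear_simps)
      have Q't: "commutes Q' t" using commutes_adj[OF Qt that(1) at] .
      have "P (Q x) = Q (P x)" for x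
      proof -
        have "inner (P (Q x)) y = inner (Q (P x)) y" for y
        proof -
          have "inner (P (Q x)) y = inner x (Q' (P y))"
            unfolding adjD[OF P(1)] adjD[OF that(1)] ..
          also have "\<dots> = inner x (P (Q' (P y)))"
            by (simp only: inv[OF Q't])
          also have "\<dots> = inner (P (Q (P x))) y"
            unfolding adjD[OF P(1)] adjD[OF that(1)] ..
          also have "\<dots> = inner (Q (P x)) y"
            by (simp only: inv[OF Qt])
          finally show ?thesis .
        qed
        then show ?thesis
          by (metis vector_eq_rdot)
      qed
      then show ?thesis by (simp add: commutes_def)
    qed
    show "inner (T x) x \<le> 0" if "P x = x" for x
    proof -
      have "U x = 0" using P(2)[of x] that by (simp add: V_def)
      then have "t x = - R x" by (simp add: U_def blinfun.bilinear_simps add_eq_0_iff)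
      then have "inner (t x) x \<le> 0" using R(2)[of x] by simp
      then show ?thesis using c0 by (simp add: t_def blinfun.bilinear_simps mult_le_0_iff)
    qed
    show "inner (T x) x \<ge> 0" if "P x = 0" for x
    proof -
      \<comment> \<open>Since \<open>(R + t) (R - t) = R^2 - t^2 = 0\<close>, the range of
        \<open>R - t\<close> lies in \<open>V\<close>. A vector orthogonal to \<open>V\<close> is
        therefore killed by \<open>R - t\<close>, so \<open>t\<close> acts on it as the positive
        \<open>R\<close>.\<close>
      have "U ((R - t) y) = 0" for y
        by (simp add: U_def blinfun.bilinear_simps RR Rt)
      then have "P ((R - t) y) = (R - t) y" for y using P(3) by (simp add: V_def)
      then have "inner x ((R - t) y) = 0" for y
        using adjD[OF P(1), of x "(R - t) y" for y] that by simp
      then have "inner ((R - t) x) y = 0" for y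
        using R(1) at by (simp add: adj_def blinfun.bilinear_simps inner_diff_left inner_diff_right)
      then have "(R - t) x = 0" using inner_eq_zero_iff by blast
      then have "inner (t x) x \<ge> 0" using R(2)[of x] by (simp add: blinfun.bilinear_simps)
      then show ?thesis using c0 by (simp add: t_def blinfun.bilinear_simps zero_le_mult_iff)
    qed
  qed
qed

section \<open>Spectral resolution over dyadic squares\<close>

text \<open>\<open>F t\<close> is the sign projection of \<open>A - t\<close>, belonging to the part
  of the spectrum up to and including \<open>t\<close>. It commutes with \<open>A\<close>, and
  therefore with every other \<open>F s\<close>.\<close>

lemma spectral_family:
  fixes A :: "'a::{real_inner,banach} \<Rightarrow>\<^sub>L 'a"
  assumes A: "selfadj A"
  obtains F :: "real \<Rightarrow> 'a \<Rightarrow>\<^sub>L 'a" where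
    "\<And>t. selfadj (F t)"
    "\<And>s t x. F s (F t x) = F (min s t) x"
    "\<And>t R R'. adj R R' \<Longrightarrow> commutes R A \<Longrightarrow> commutes R (F t)"
    "\<And>t x. norm A < t \<Longrightarrow> F t x = x"
    "\<And>t x. t < - norm A \<Longrightarrow> F t x = 0"
    "\<And>s t x. s < t \<Longrightarrow> F t x = x \<Longrightarrow> F s x = 0 \<Longrightarrow> norm (A x - s *\<^sub>R x) \<le> (t - s) * norm x"
proof -
  define Q where "Q t P \<longleftrightarrow> selfadj P \<and> (\<forall>x. blinfun_apply P (P x) = P x) \<and>
    (\<forall>R R'. adj R R' \<longrightarrow> commutes R A \<longrightarrow> commutes R P) \<and>
    (\<forall>x. P x = x \<longrightarrow> inner (A x) x \<le> t * inner x x) \<and> (\<forall>x. P x = 0 \<longrightarrow> inner (A x) x \<ge> t * inner x x)"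
    for t and P :: "'a \<Rightarrow>\<^sub>L 'a"
  have "\<exists>P. Q t P" for t
  proof -
    define T where "T = A - t *\<^sub>R id_blinfun"
    have T: "selfadj T"
      using A by (simp add: T_def adj_def blinfun.bilinear_simps inner_diff_left inner_diff_right)
    obtain P where P: "selfadj P" "\<And>x. blinfun_apply P (P x) = P x"
      "\<And>R R'. adj R R' \<Longrightarrow> commutes R T \<Longrightarrow> commutes R P"
      "\<And>x. P x = x \<Longrightarrow> inner (T x) x \<le> 0" "\<And>x. P x = 0 \<Longrightarrow> inner (T x) x \<ge> 0"
      by (erule spectral_projection_sign[OF T])
    have Tx: "inner (T x) x = inner (A x) x - t * inner x x" for x
      by (simp add: T_def blinfun.bilinear_simps inner_diff_left)
    have "commutes R T" if "commutes R A" for R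
      using that by (simp add: T_def commutes_def blinfun.bilinear_simps)
    then have "commutes R P" if "adj R R'" "commutes R A" for R R'
      using P(3) that by blast
    moreover have "inner (A x) x \<le> t * inner x x" if "P x = x" for x
      using P(4)[OF that] Tx[of x] by simp
    moreover have "inner (A x) x \<ge> t * inner x x" if "P x = 0" for x
      using P(5)[OF that] Tx[of x] by simp
    ultimately have "Q t P"
      unfolding Q_def using P(1,2) by blast
    then show ?thesis ..
  qed
  then obtain F where "\<And>t. Q t (F t)"
    by metis
  then have F: "\<And>t. selfadj (F t)" "\<And>t x. blinfun_apply (F t) (F t x) = F t x"
    "\<And>t R R'. adj R R' \<Longrightarrow> commutes R A \<Longrightarrow> commutes R (F t)"
    "\<And>t x. F t x = x \<Longrightarrow> inner (A x) x \<le> t * inner x x" "\<And>t x. F t x = 0 \<Longrightarrow> inner (A x) x \<ge> t * inner x x"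
    unfolding Q_def by blast+
  have FA: "commutes (F t) A" for t
    using F(3)[OF A, of t] by (simp add: commutes_def)
  have FF: "F s (F t x) = F t (F s x)" for s t x
    using F(3)[OF F(1) FA] by (simp add: commutes_def)
  \<comment> \<open>A vector \<open>y\<close> fixed by \<open>F s\<close> and killed by
    \<open>F t\<close> has \<open>inner (A y) y\<close> at most \<open>s\<close> and at least
    \<open>t\<close> times \<open>inner y y\<close>, so it vanishes.\<close>
  have less: "F t (F s x) = F s x" if "s < t" for s t x
  proof -
    define y where "y = F s x - F t (F s x)"
    have "F s y = y" by (simp add: y_def blinfun.bilinear_simps F(2) FF[of s t])
    then have "inner (A y) y \<le> s * inner y y" by (rule F(4))
    moreover have "F t y = 0" by (simp add: y_def blinfun.bilinear_simps F(2))
    then have "inner (A y) y \<ge> t * inner y y" by (rule F(5))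
    ultimately have "(t - s) * inner y y \<le> 0" by (simp add: algebra_simps)
    then have "inner y y \<le> 0" using that by (simp add: mult_le_0_iff)
    then have "y = 0" using inner_gt_zero_iff[of y] by linarith
    then show ?thesis by (simp add: y_def)
  qed
  have bnd: "\<bar>inner (A x) x\<bar> \<le> norm A * inner x x" for x
  proof -
    have "\<bar>inner (A x) x\<bar> \<le> norm (A x) * norm x" by (rule Cauchy_Schwarz_ineq2)
    also have "\<dots> \<le> norm A * norm x * norm x" by (intro mult_right_mono norm_blinfun norm_ge_zero)
    finally show ?thesis by (simp only: power2_norm_eq_inner[symmetric] power2_eq_square mult.assoc)
  qed
  show thesis
  proof (rule that[of F])
    show "F s (F t x) = F (min s t) x" for s t x
      using less[of s t x] less[of t s x] F(2)[of s x] FF[of s t x] by (cases s t rule: linorder_cases) (auto simp: min_def)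
    show "F t x = x" if "norm A < t" for t x
    proof -
      define y where "y = x - F t x"
      have "F t y = 0" by (simp add: y_def blinfun.bilinear_simps F(2))
      then have "t * inner y y \<le> norm A * inner y y" using F(5)[of t y] bnd[of y] by linarith
      then have "(t - norm A) * inner y y \<le> 0" by (simp add: algebra_simps)
      then have "inner y y \<le> 0" using that by (simp add: mult_le_0_iff)
      then have "y = 0" using inner_gt_zero_iff[of y] by linarith
      then show ?thesis by (simp add: y_def)
    qed
    show "F t x = 0" if "t < - norm A" for t x
    proof -
      define y where "y = F t x"
      have "F t y = y" by (simp add: y_def F(2))
      then have "- (norm A * inner y y) \<le> t * inner y y" using F(4)[of t y] bnd[of y] by linarith
      then have "(- norm A - t) * inner y y \<le> 0" by (simp add: algebra_simps)
      then have "inner y y \<le> 0" using that by (simp add: mult_le_0_iff)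
      then have "y = 0" using inner_gt_zero_iff[of y] by linarith
      then show ?thesis by (simp add: y_def)
    qed
    \<comment> \<open>On the invariant space \<open>M\<close> the form of \<open>C = A - s\<close>
      lies between \<open>0\<close> and \<open>c = t - s\<close>. Evaluating it at
      \<open>x - C x / c\<close> turns this into \<open>C^2 \<le> c C\<close> on \<open>M\<close>,
      which bounds the norm.\<close>
    show "norm (A x - s *\<^sub>R x) \<le> (t - s) * norm x" if "s < t" "F t x = x" "F s x = 0" for s t x
    proof -
      define c where "c = t - s"
      define C where "C = A - s *\<^sub>R id_blinfun"
      have c: "c > 0" using that by (simp add: c_def)
      have C: "C y = A y - s *\<^sub>R y" for y by (simp add: C_def blinfun.bilinear_simps)
      have aC: "inner (C y) z = inner y (C z)" for y z
        by (simp add: C inner_diff_left inner_diff_right adjD[OF A])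
      define M where "M = {y. F t y = y \<and> F s y = 0}"
      have x: "x \<in> M" using that by (simp add: M_def)
      have CM: "C y \<in> M" if "y \<in> M" for y
      proof -
        have "F t (A y) = A (F t y)" "F s (A y) = A (F s y)" using FA by (simp_all add: commutes_def)
        then show ?thesis using that by (simp add: M_def C blinfun.bilinear_simps)
      qed
      have dM: "y - r *\<^sub>R z \<in> M" if "y \<in> M" "z \<in> M" for y z r
        using that by (simp add: M_def blinfun.bilinear_simps)
      have pos: "0 \<le> inner (C y) y" "inner (C y) y \<le> c * inner y y" if "y \<in> M" for y
        using that F(4)[of t y] F(5)[of s y] by (simp_all add: M_def C inner_diff_left c_def algebra_simps)
      have expand: "inner (C (x - r *\<^sub>R C x)) (x - r *\<^sub>R C x)
          = inner (C x) x - 2 * r * inner (C x) (C x) + r * (r * inner (C (C x)) (C x))" for r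
        by (simp add: blinfun.bilinear_simps inner_diff_left inner_diff_right aC[of "C x" x] right_diff_distrib)
      have "0 \<le> inner (C (x - (1/c) *\<^sub>R C x)) (x - (1/c) *\<^sub>R C x)"
        by (intro pos(1) dM CM x)
      then have *: "0 \<le> inner (C x) x - 2 * (1/c) * inner (C x) (C x) + (1/c) * ((1/c) * inner (C (C x)) (C x))"
        unfolding expand .
      have "(1/c) * ((1/c) * inner (C (C x)) (C x)) \<le> (1/c) * ((1/c) * (c * inner (C x) (C x)))"
        by (intro mult_left_mono pos(2) CM x) (use c in auto)
      then have "(1/c) * ((1/c) * inner (C (C x)) (C x)) \<le> (1/c) * inner (C x) (C x)"
        using c by simp
      then have "(1/c) * inner (C x) (C x) \<le> inner (C x) x" using * by linarith
      then have "inner (C x) (C x) \<le> c * inner (C x) x" using c by (simp add: field_simps)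
      also have "\<dots> \<le> c * (c * inner x x)" using c pos(2)[OF x] by (intro mult_left_mono) auto
      finally have "(norm (C x))\<^sup>2 \<le> (c * norm x)\<^sup>2"
        unfolding power_mult_distrib power2_norm_eq_inner power2_eq_square[of c] mult.assoc .
      then have "norm (C x) \<le> c * norm x"
        by (rule power2_le_imp_le) (use c in simp)
      then show ?thesis by (simp add: C c_def)
    qed
  qed (use F in blast)+
qed

lemma sum_int_telescope:
  fixes f :: "int \<Rightarrow> 'a::ab_group_add"
  assumes "a \<le> b"
  shows "(\<Sum>i\<in>{a..<b}. f (i + 1) - f i) = f b - f a"
  using assms
proof (induction b rule: int_ge_induct)
  case (step i)
  then have "{a..<i+1} = insert i {a..<i}" by auto
  then show ?case using step by simp
qed simp

text \<open>\<open>e k i\<close> belongs to the half-open interval from \<open>i / 2^k\<close>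
  (excluded) to \<open>(i + 1) / 2^k\<close> (included). Being differences of consecutive
  \<open>F\<close>, these projections telescope, which gives refinement and completeness.\<close>

lemma spectral_dyadic:
  fixes A :: "'a::{real_inner,banach} \<Rightarrow>\<^sub>L 'a"
  assumes A: "selfadj A"
  obtains e :: "nat \<Rightarrow> int \<Rightarrow> 'a \<Rightarrow>\<^sub>L 'a" where
    "\<And>k i. selfadj (e k i)"
    "\<And>k i j x. e k i (e k j x) = (if i = j then e k i x else 0)"
    "\<And>k i x. e k i x = e (Suc k) (2 * i) x + e (Suc k) (2 * i + 1) x"
    "\<And>k i R R'. adj R R' \<Longrightarrow> commutes R A \<Longrightarrow> commutes R (e k i)"
    "\<And>k i x. e k i x = x \<Longrightarrow> norm (A x - (real_of_int i / 2 ^ k) *\<^sub>R x) \<le> norm x / 2 ^ k"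
    "\<And>k. \<exists>I. finite I \<and> (\<forall>x. (\<Sum>i\<in>I. e k i x) = x)"
proof -
  obtain F :: "real \<Rightarrow> 'a \<Rightarrow>\<^sub>L 'a" where F:
    "\<And>t. selfadj (F t)"
    "\<And>s t x. F s (F t x) = F (min s t) x"
    "\<And>t R R'. adj R R' \<Longrightarrow> commutes R A \<Longrightarrow> commutes R (F t)"
    "\<And>t x. norm A < t \<Longrightarrow> F t x = x"
    "\<And>t x. t < - norm A \<Longrightarrow> F t x = 0"
    "\<And>s t x. s < t \<Longrightarrow> F t x = x \<Longrightarrow> F s x = 0 \<Longrightarrow> norm (A x - s *\<^sub>R x) \<le> (t - s) * norm x"
    by (erule spectral_family[OF A])
  define d :: "nat \<Rightarrow> int \<Rightarrow> real" where "d k i = real_of_int i / 2 ^ k" for k i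
  have dmin: "min (d k i) (d k j) = d k (min i j)" for k i j
    by (simp add: d_def min_def divide_le_cancel)
  define e where "e k i = F (d k (i + 1)) - F (d k i)" for k i
  have ex: "e k i x = F (d k (i + 1)) x - F (d k i) x" for k i x
    by (simp add: e_def blinfun.bilinear_simps)
  show thesis
  proof (rule that[of e])
    show "selfadj (e k i)" for k i
      using F(1) by (simp add: adj_def ex inner_diff_left inner_diff_right)
    show ee: "e k i (e k j x) = (if i = j then e k i x else 0)" for k i j x
    proof (cases i j rule: linorder_cases)
      case less
      then have "min i j = i" "min (i+1) j = i+1" "min i (j+1) = i" "min (i+1) (j+1) = i+1" by auto
      then show ?thesis using less by (simp add: ex blinfun.bilinear_simps F(2) dmin)
    next
      case greater
      then have "min i j = j" "min (i+1) j = j" "min i (j+1) = j+1" "min (i+1) (j+1) = j+1" by auto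
      then show ?thesis using greater by (simp add: ex blinfun.bilinear_simps F(2) dmin)
    qed (simp add: ex blinfun.bilinear_simps F(2) dmin)
    have "d (Suc k) (2 * i) = d k i" for k i by (simp add: d_def)
    from this[of _ "i + 1" for i] this
    show "e k i x = e (Suc k) (2 * i) x + e (Suc k) (2 * i + 1) x" for k i x
      by (simp add: ex algebra_simps)
    show "commutes R (e k i)" if "adj R R'" "commutes R A" for k i R R'
      using F(3)[OF that] by (simp add: commutes_def ex blinfun.bilinear_simps)
    show "norm (A x - (real_of_int i / 2 ^ k) *\<^sub>R x) \<le> norm x / 2 ^ k" if "e k i x = x" for k i x
    proof -
      have lt: "d k i < d k (i + 1)" by (simp add: d_def divide_strict_right_mono)
      have x: "x = F (d k (i + 1)) x - F (d k i) x" using that by (simp add: ex)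
      have "F (d k (i + 1)) x = x"
        by (subst (1 2) x) (use lt in \<open>simp add: blinfun.bilinear_simps F(2) min_def\<close>)
      moreover have "F (d k i) x = 0"
        by (subst x) (use lt in \<open>simp add: blinfun.bilinear_simps F(2) min_def\<close>)
      ultimately have "norm (A x - d k i *\<^sub>R x) \<le> (d k (i + 1) - d k i) * norm x"
        using F(6)[OF lt] by blast
      moreover have "d k (i + 1) - d k i = 1 / 2 ^ k" by (simp add: d_def field_simps)
      ultimately show ?thesis by (simp add: d_def)
    qed
    show "\<exists>I. finite I \<and> (\<forall>x. (\<Sum>i\<in>I. e k i x) = x)" for k
    proof -
      \<comment> \<open>The \<open>+ 1\<close> makes \<open>norm A < b / 2^k\<close> strict, as
        needed for \<open>F\<close> to be the identity at the top and zero at the bottom.\<close>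
      define b where "b = \<lfloor>norm A * 2 ^ k\<rfloor> + 1"
      have b: "norm A * 2 ^ k < b" by (simp add: b_def)
      moreover have "0 \<le> norm A * 2 ^ k" by simp
      ultimately have "0 \<le> b" by linarith
      have "norm A < d k b" "d k (- b) < - norm A" using b by (simp_all add: d_def field_simps)
      then have "(\<Sum>i\<in>{-b..<b}. e k i x) = x" for x
        unfolding ex using sum_int_telescope[of "-b" b "\<lambda>i. F (d k i) x"] \<open>0 \<le> b\<close> F(4,5) by simp
      then show ?thesis by blast
    qed
  qed
qed

section \<open>The tree of dyadic squares and resolutions of the identity over it\<close>

definition parent :: "int \<times> int \<Rightarrow> int \<times> int" where
  "parent p = (fst p div 2, snd p div 2)"

definition children :: "int \<times> int \<Rightarrow> (int \<times> int) set" where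
  "children p = {2 * fst p, 2 * fst p + 1} \<times> {2 * snd p, 2 * snd p + 1}"

lemma mem_children_iff: "q \<in> children p \<longleftrightarrow> parent q = p"
  by (cases p; cases q) (auto simp: children_def parent_def)

lemma finite_children: "finite (children p)"
  by (simp add: children_def)

lemma card_children: "card (children p) = 4"
  by (simp add: children_def card_cartesian_product card_insert_if)

text \<open>Only the combinatorics of the projections is recorded; the operators they resolve enter
  separately, through norm estimates.\<close>

locale dyadic_family =
  fixes E :: "nat \<Rightarrow> int \<times> int \<Rightarrow> 'a::{real_inner,banach} \<Rightarrow>\<^sub>L 'a"
  assumes selfadj_E: "selfadj (E k p)"
    and E_E: "E k p (E k q x) = (if p = q then E k p x else 0)"
    and E_children: "E k p x = (\<Sum>q\<in>children p. E (Suc k) q x)"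
    and E_total: "\<exists>I. finite I \<and> (\<forall>x. (\<Sum>p\<in>I. E k p x) = x)"

text \<open>Product of two commuting resolutions: \<open>B\<close> is selfadjoint and commutes with
  \<open>A\<close>, hence with each \<open>e k i\<close>, and then \<open>e k i\<close> commutes
  with each \<open>f l j\<close>.\<close>

lemma joint_spectral_dyadic:
  fixes A B :: "'a::{real_inner,banach} \<Rightarrow>\<^sub>L 'a"
  assumes A: "selfadj A" and B: "selfadj B" and AB: "commutes A B"
  obtains E where "dyadic_family E"
    "\<And>k p R R'. adj R R' \<Longrightarrow> commutes R A \<Longrightarrow> commutes R B \<Longrightarrow> commutes R (E k p)"
    "\<And>k p x. E k p x = x \<Longrightarrow> norm (A x - (real_of_int (fst p) / 2 ^ k) *\<^sub>R x) \<le> norm x / 2 ^ k"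
    "\<And>k p x. E k p x = x \<Longrightarrow> norm (B x - (real_of_int (snd p) / 2 ^ k) *\<^sub>R x) \<le> norm x / 2 ^ k"
proof -
  obtain e :: "nat \<Rightarrow> int \<Rightarrow> 'a \<Rightarrow>\<^sub>L 'a" where e:
    "\<And>k i. selfadj (e k i)"
    "\<And>k i j x. e k i (e k j x) = (if i = j then e k i x else 0)"
    "\<And>k i x. e k i x = e (Suc k) (2 * i) x + e (Suc k) (2 * i + 1) x"
    "\<And>k i R R'. adj R R' \<Longrightarrow> commutes R A \<Longrightarrow> commutes R (e k i)"
    "\<And>k i x. e k i x = x \<Longrightarrow> norm (A x - (real_of_int i / 2 ^ k) *\<^sub>R x) \<le> norm x / 2 ^ k"
    "\<And>k. \<exists>I. finite I \<and> (\<forall>x. (\<Sum>i\<in>I. e k i x) = x)"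
    by (erule spectral_dyadic[OF A])
  obtain f :: "nat \<Rightarrow> int \<Rightarrow> 'a \<Rightarrow>\<^sub>L 'a" where f:
    "\<And>k i. selfadj (f k i)"
    "\<And>k i j x. f k i (f k j x) = (if i = j then f k i x else 0)"
    "\<And>k i x. f k i x = f (Suc k) (2 * i) x + f (Suc k) (2 * i + 1) x"
    "\<And>k i R R'. adj R R' \<Longrightarrow> commutes R B \<Longrightarrow> commutes R (f k i)"
    "\<And>k i x. f k i x = x \<Longrightarrow> norm (B x - (real_of_int i / 2 ^ k) *\<^sub>R x) \<le> norm x / 2 ^ k"
    "\<And>k. \<exists>I. finite I \<and> (\<forall>x. (\<Sum>i\<in>I. f k i x) = x)"
    by (erule spectral_dyadic[OF B])
  have "commutes B (e k i)" for k i
    using e(4)[OF B commutes_sym[OF AB]] .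
  then have "commutes (e k i) (f l j)" for k i l j
    using f(4)[OF e(1)] commutes_sym by blast
  then have fe: "f l j (e k i x) = e k i (f l j x)" for k i l j x
    by (simp add: commutes_def)
  define E where "E k p = e k (fst p) o\<^sub>L f k (snd p)" for k p
  have Ex: "E k p x = e k (fst p) (f k (snd p) x)" for k p x by (simp add: E_def)
  show thesis
  proof (rule that[of E])
    show "dyadic_family E"
    proof
      show "selfadj (E k p)" for k p
        unfolding adj_def Ex adjD[OF e(1)] adjD[OF f(1)] fe by simp
      show "E k p (E k q x) = (if p = q then E k p x else 0)" for k p q x
        by (auto simp: Ex fe e(2) f(2) blinfun.bilinear_simps prod_eq_iff)
      show "E k p x = (\<Sum>q\<in>children p. E (Suc k) q x)" for k p x
        unfolding Ex children_def sum.cartesian_product[symmetric] split_def e(3)[of k] f(3)[of k]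
        by (simp add: Ex sum.cartesian_product'[symmetric] blinfun.bilinear_simps algebra_simps)
      show "\<exists>I. finite I \<and> (\<forall>x. (\<Sum>p\<in>I. E k p x) = x)" for k
      proof -
        obtain I J where I: "finite I" "\<And>x. (\<Sum>i\<in>I. e k i x) = x" and J: "finite J" "\<And>x. (\<Sum>i\<in>J. f k i x) = x"
          using e(6)[of k] f(6)[of k] by metis
        have "(\<Sum>p\<in>I \<times> J. E k p x) = x" for x
        proof -
          have "(\<Sum>p\<in>I \<times> J. E k p x) = (\<Sum>i\<in>I. \<Sum>j\<in>J. e k i (f k j x))"
            by (simp add: Ex sum.cartesian_product split_def)
          also have "\<dots> = (\<Sum>i\<in>I. e k i x)"
            by (simp add: blinfun.sum_right[symmetric] J)
          finally show ?thesis by (simp add: I)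
        qed
        then show ?thesis using I J by (intro exI[of _ "I \<times> J"]) auto
      qed
    qed
    show "commutes R (E k p)" if "adj R R'" "commutes R A" "commutes R B" for k p R R'
      using e(4)[OF that(1,2)] f(4)[OF that(1,3)] by (simp add: commutes_def Ex)
    show "norm (A x - (real_of_int (fst p) / 2 ^ k) *\<^sub>R x) \<le> norm x / 2 ^ k" if "E k p x = x" for k p x
    proof (rule e(5))
      have "e k (fst p) x = e k (fst p) (E k p x)" by (simp only: that)
      then show "e k (fst p) x = x" using that by (simp add: Ex e(2))
    qed
    show "norm (B x - (real_of_int (snd p) / 2 ^ k) *\<^sub>R x) \<le> norm x / 2 ^ k" if "E k p x = x" for k p x
    proof (rule f(5))
      have "f k (snd p) x = f k (snd p) (E k p x)" by (simp only: that)
      then show "f k (snd p) x = x" using that by (simp add: Ex fe f(2))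
    qed
  qed
qed

section \<open>Haar systems of cyclic subspaces\<close>

text \<open>Gram-Schmidt, then removal of zero and normalisation. The cardinality bound is what
  limits a box to four Haar vectors.\<close>

lemma orthonormal_basis_of_span:
  fixes B :: "'a::real_inner set"
  assumes "finite B"
  obtains C where "finite C" "card C \<le> card B" "span C = span B" "pairwise orthogonal C" "\<And>v. v \<in> C \<Longrightarrow> norm v = 1"
proof -
  obtain D where D: "finite D" "card D \<le> card B" "span D = span B" "pairwise orthogonal D"
    using basis_orthogonal[OF assms] by blast
  define C where "C = (\<lambda>v. v /\<^sub>R norm v) ` (D - {0})"
  show thesis
  proof (rule that[of C])
    show "finite C" using D(1) by (simp add: C_def)
    have "card C \<le> card (D - {0})" unfolding C_def using D(1) by (intro card_image_le) auto
    also have "\<dots> \<le> card D" using D(1) by (intro card_mono) auto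
    also have "\<dots> \<le> card B" by (rule D(2))
    finally show "card C \<le> card B" .
    have "span C = span (D - {0})"
    proof (rule span_eq[THEN iffD2], intro conjI subsetI)
      fix v assume "v \<in> C"
      then obtain w where "v = w /\<^sub>R norm w" "w \<in> D - {0}" unfolding C_def by blast
      then show "v \<in> span (D - {0})" by (simp add: span_base span_scale)
    next
      fix v assume "v \<in> D - {0}"
      then have "v /\<^sub>R norm v \<in> C" by (auto simp: C_def)
      then have "norm v *\<^sub>R (v /\<^sub>R norm v) \<in> span C" by (intro span_scale span_base)
      then show "v \<in> span C" using \<open>v \<in> D - {0}\<close> by simp
    qed
    then show "span C = span B" using D(3) by (simp only: span_delete_0)
    show "pairwise orthogonal C"
    proof (rule pairwiseI)
      fix v w assume "v \<in> C" "w \<in> C" "v \<noteq> w"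
      then obtain a b where "a \<in> D" "b \<in> D" "v = a /\<^sub>R norm a" "w = b /\<^sub>R norm b" "a \<noteq> b"
        unfolding C_def by blast
      then show "orthogonal v w" using D(4) by (simp add: pairwise_def orthogonal_def)
    qed
    show "norm v = 1" if v: "v \<in> C" for v
    proof -
      obtain w where "v = w /\<^sub>R norm w" "w \<noteq> 0" using v unfolding C_def by blast
      then show ?thesis by simp
    qed
  qed
qed

lemma span_orthogonal_zero:
  assumes "v \<in> span S" "\<And>s. s \<in> S \<Longrightarrow> inner s w = 0"
  shows "inner v w = 0"
proof -
  have "subspace {v. inner v w = 0}"
    by (auto simp: subspace_def inner_add_left)
  then have "span S \<subseteq> {v. inner v w = 0}"
    using assms(2) by (intro span_minimal) auto
  then show ?thesis using assms(1) by blast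
qed

context dyadic_family
begin

lemma E_Suc_E: "E (Suc k) q (E k p x) = (if parent q = p then E (Suc k) q x else 0)"
proof -
  have "E (Suc k) q (E k p x) = (\<Sum>r\<in>children p. E (Suc k) q (E (Suc k) r x))"
    by (simp only: E_children[of k p] blinfun.sum_right)
  also have "\<dots> = (\<Sum>r\<in>children p. if q = r then E (Suc k) q x else 0)"
    by (simp only: E_E)
  also have "\<dots> = (if parent q = p then E (Suc k) q x else 0)"
    by (simp add: finite_children mem_children_iff)
  finally show ?thesis .
qed

text \<open>A box of level \<open>k + l\<close> has exactly one ancestor at level \<open>k\<close>;
  projecting first onto any other box of that level leaves nothing.\<close>

lemma E_add_E: "E (k + l) q (E k p x) = (if (parent ^^ l) q = p then E (k + l) q x else 0)"
proof (induction l arbitrary: q)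
  case 0
  show ?case by (simp add: E_E)
next
  case (Suc l)
  have E: "E (Suc (k + l)) q y = E (Suc (k + l)) q (E (k + l) (parent q) y)" for y
    by (simp add: E_Suc_E)
  have "E (k + Suc l) q (E k p x) = E (Suc (k + l)) q (E (k + l) (parent q) (E k p x))"
    unfolding add_Suc_right by (rule E)
  also have "\<dots> = (if (parent ^^ l) (parent q) = p then E (Suc (k + l)) q (E (k + l) (parent q) x) else 0)"
    by (simp only: Suc.IH) (simp add: blinfun.zero_right)
  also have "\<dots> = (if (parent ^^ Suc l) q = p then E (k + Suc l) q x else 0)"
    unfolding add_Suc_right by (simp only: E[symmetric] funpow_Suc_right o_apply)
  finally show ?case .
qed

lemma E_E_refine: "k \<le> l \<Longrightarrow> E l q (E k p x) = E l q x \<or> E l q (E k p x) = 0"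
  using E_add_E[of k "l - k" q p x] by (simp split: if_splits)

text \<open>Defined from the projections alone, independently of any vector, so that one count
  serves every cyclic subspace.\<close>

definition active :: "nat \<Rightarrow> (int \<times> int) set" where
  "active k = {p. \<exists>x. E k p x \<noteq> 0}"

lemma finite_active: "finite (active k)" and sum_active: "(\<Sum>p\<in>active k. E k p x) = x"
proof -
  obtain I where I: "finite I" "\<And>x. (\<Sum>p\<in>I. E k p x) = x" using E_total[of k] by blast
  have "active k \<subseteq> I"
  proof
    fix p assume "p \<in> active k"
    then obtain x where x: "E k p x \<noteq> 0" by (auto simp: active_def)
    show "p \<in> I"
    proof (rule ccontr)
      assume "p \<notin> I"
      have "E k p x = (\<Sum>q\<in>I. E k q (E k p x))" by (simp only: I(2))
      also have "\<dots> = 0" using \<open>p \<notin> I\<close> by (intro sum.neutral) (auto simp: E_E)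
      finally show False using x by simp
    qed
  qed
  then show "finite (active k)" using I(1) finite_subset by blast
  have "(\<Sum>p\<in>active k. E k p x) = (\<Sum>p\<in>I. E k p x)"
    by (intro sum.mono_neutral_left I(1) \<open>active k \<subseteq> I\<close>) (auto simp: active_def)
  then show "(\<Sum>p\<in>active k. E k p x) = x" by (simp only: I(2))
qed

text \<open>These spectral pieces of \<open>x\<close> replace the polynomials in \<open>A\<close>
  and \<open>B\<close> applied to \<open>x\<close> as generators of its cyclic subspace.\<close>

definition boxes :: "'a \<Rightarrow> nat \<Rightarrow> 'a set" where
  "boxes x k = range (\<lambda>p. E k p x)"

lemma boxes_coarse: "k \<le> l \<Longrightarrow> boxes x k \<subseteq> span (boxes x l)"
proof (induction l rule: dec_induct)
  case base
  show ?case by (rule span_superset)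
next
  case (step l)
  have "boxes x l \<subseteq> span (boxes x (Suc l))"
  proof
    fix v assume "v \<in> boxes x l"
    then obtain p where "v = E l p x"
      unfolding boxes_def by blast
    then have "v = (\<Sum>q\<in>children p. E (Suc l) q x)"
      using E_children[of l p x] by (rule trans)
    moreover have "\<dots> \<in> span (boxes x (Suc l))"
      by (intro span_sum span_base) (auto simp: boxes_def)
    ultimately show "v \<in> span (boxes x (Suc l))" by (simp only:)
  qed
  then have "span (boxes x l) \<subseteq> span (boxes x (Suc l))"
    by (intro span_minimal subspace_span)
  then show ?case using step.IH by blast
qed

text \<open>A Haar system for the cyclic subspace of \<open>x\<close>: inside each box take an orthonormal basis of the
  orthocomplement of \<open>E k p x\<close> in the span of the vectors belonging to the children of the box.\<close>

definition detail :: "'a \<Rightarrow> nat \<Rightarrow> int \<times> int \<Rightarrow> 'a set" where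
  "detail x k p = (SOME C. finite C \<and> card C \<le> 4 \<and> pairwise orthogonal C \<and> (\<forall>v\<in>C. norm v = 1) \<and>
     span C = span ((\<lambda>q. E (Suc k) q x - (inner (E (Suc k) q x) (E k p x) / inner (E k p x) (E k p x)) *\<^sub>R E k p x) ` children p))"

text \<open>If \<open>E k p x = 0\<close>, the quotient is \<open>0\<close> by convention and the
  vectors of all children vanish too, so the set is empty. The bound four is the number of
  children.\<close>

lemma detail:
  "finite (detail x k p)" "card (detail x k p) \<le> 4" "pairwise orthogonal (detail x k p)"
  "v \<in> detail x k p \<Longrightarrow> norm v = 1"
  "span (detail x k p) = span ((\<lambda>q. E (Suc k) q x - (inner (E (Suc k) q x) (E k p x) / inner (E k p x) (E k p x)) *\<^sub>R E k p x) ` children p)"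
proof -
  let ?B = "(\<lambda>q. E (Suc k) q x - (inner (E (Suc k) q x) (E k p x) / inner (E k p x) (E k p x)) *\<^sub>R E k p x) ` children p"
  have fB: "finite ?B" by (simp add: finite_children)
  have "card ?B \<le> 4" using card_image_le[OF finite_children] card_children by metis
  moreover obtain C where "finite C" "card C \<le> card ?B" "span C = span ?B" "pairwise orthogonal C"
      "\<And>v. v \<in> C \<Longrightarrow> norm v = 1"
    by (erule orthonormal_basis_of_span[OF fB])
  ultimately have "\<exists>C. finite C \<and> card C \<le> 4 \<and> pairwise orthogonal C \<and> (\<forall>v\<in>C. norm v = 1) \<and> span C = span ?B"
    by (intro exI[of _ C] conjI ballI) simp_all
  from someI_ex[OF this]
  show "finite (detail x k p)" "card (detail x k p) \<le> 4" "pairwise orthogonal (detail x k p)"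
    "v \<in> detail x k p \<Longrightarrow> norm v = 1"
    "span (detail x k p) = span ?B"
    unfolding detail_def by blast+
qed

lemma E_detail:
  assumes "v \<in> detail x k p"
  shows "E k p v = v"
proof -
  have "E k p (E (Suc k) q x) = E (Suc k) q x" if "q \<in> children p" for q
  proof -
    have "E k p (E (Suc k) q x) = (\<Sum>r\<in>children p. if r = q then E (Suc k) r x else 0)"
      by (subst E_children) (simp only: E_E)
    then show ?thesis using that by (simp add: finite_children)
  qed
  then have "(\<lambda>q. E (Suc k) q x - (inner (E (Suc k) q x) (E k p x) / inner (E k p x) (E k p x)) *\<^sub>R E k p x) ` children p
      \<subseteq> {w. E k p w = w}"
    by (auto simp: blinfun.bilinear_simps E_E)
  moreover have "subspace {w. E k p w = w}"
    by (auto simp: subspace_def blinfun.bilinear_simps)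
  ultimately have "span (detail x k p) \<subseteq> {w. E k p w = w}"
    unfolding detail(5) by (rule span_minimal)
  then show ?thesis using assms span_base by blast
qed

lemma detail_span:
  assumes "v \<in> detail x k p"
  shows "v \<in> span (boxes x (Suc k))"
proof -
  have "E (Suc k) q x \<in> span (boxes x (Suc k))" "E k p x \<in> span (boxes x (Suc k))" for q
    using boxes_coarse[of k "Suc k" x] by (auto simp: boxes_def intro: span_base)
  then have "span (detail x k p) \<subseteq> span (boxes x (Suc k))"
    unfolding detail(5) by (intro span_minimal) (auto intro!: span_diff span_scale)
  then show ?thesis using assms span_base by blast
qed

text \<open>\<open>E k p\<close> fixes \<open>v\<close> and sends a coarser vector
  \<open>E l r x\<close> to \<open>E k p x\<close> or \<open>0\<close>, so orthogonality to all
  coarser levels reduces to orthogonality to \<open>E k p x\<close>.\<close>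

lemma detail_orthogonal:
  assumes v: "v \<in> detail x k p" and "l \<le> k" and w: "w \<in> boxes x l"
  shows "inner v w = 0"
proof -
  have 0: "inner v (E k p x) = 0"
  proof (rule span_orthogonal_zero)
    show "v \<in> span ((\<lambda>q. E (Suc k) q x - (inner (E (Suc k) q x) (E k p x) / inner (E k p x) (E k p x)) *\<^sub>R E k p x) ` children p)"
      using v detail(5) span_base by blast
  qed (auto simp: inner_diff_left)
  obtain r where "w = E l r x" using w by (auto simp: boxes_def)
  moreover have "inner v (E l r x) = inner (E k p v) (E l r x)"
    by (simp only: E_detail[OF v])
  moreover have "inner (E k p v) (E l r x) = inner v (E k p (E l r x))"
    by (rule adjD[OF selfadj_E])
  ultimately show ?thesis using 0 E_E_refine[OF \<open>l \<le> k\<close>, of p r x] by auto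
qed

lemma detail_active: "v \<in> detail x k p \<Longrightarrow> p \<in> active k"
  unfolding active_def mem_Collect_eq by (rule exI[of _ v]) (use E_detail[of v x k p] detail(4)[of v x k p] in auto)

lemma haar_system:
  fixes x :: 'a and M \<epsilon> :: real
  assumes count: "\<And>k. real (card (active k)) \<le> M * 2 ^ k" and "\<epsilon> > 0"
  obtains \<Phi> :: "'a set" and lev :: "'a \<Rightarrow> nat" where
    "pairwise orthogonal \<Phi>" "\<And>v. v \<in> \<Phi> \<Longrightarrow> norm v = 1"
    "\<And>v. v \<in> \<Phi> \<Longrightarrow> v \<in> span (\<Union>k. boxes x k)" "\<And>k. boxes x k \<subseteq> span \<Phi>"
    "\<And>v. v \<in> \<Phi> \<Longrightarrow> \<exists>p. E (lev v) p v = v"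
    "\<And>F. finite F \<Longrightarrow> F \<subseteq> \<Phi> \<Longrightarrow> (\<Sum>v\<in>F. (1/4) ^ lev v) \<le> \<epsilon>"
proof -
  have "M \<ge> 0" using order_trans[OF of_nat_0_le_iff count[of 0]] by simp
  \<comment> \<open>A layer of level \<open>k\<close> has at most \<open>5 M 2^k\<close> vectors,
    each of weight \<open>4^-k\<close>, so the layers from \<open>k0\<close> on weigh at most
    \<open>10 M 2^-k0\<close> together. The added \<open>1\<close> keeps the denominator
    positive.\<close>
  obtain k0 :: nat where "(1/2) ^ k0 < \<epsilon> / (10 * M + 1)"
    using real_arch_pow_inv[of "\<epsilon> / (10 * M + 1)" "1/2"] \<open>\<epsilon> > 0\<close> \<open>M \<ge> 0\<close> by auto
  then have k0: "10 * M * (1/2) ^ k0 \<le> \<epsilon>"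
    using \<open>M \<ge> 0\<close> \<open>\<epsilon> > 0\<close> by (simp add: field_simps)
  \<comment> \<open>The normalised box vectors of level \<open>k0\<close> play the role of the
    constant functions in a Haar basis. Level \<open>k0\<close> carries them in addition to its
    details: at most \<open>1 + 4\<close> vectors per active box.\<close>
  define base where "base = (\<lambda>v. v /\<^sub>R norm v) ` (boxes x k0 - {0})"
  define layer where "layer k = (\<Union>p\<in>active k. detail x k p) \<union> (if k = k0 then base else {})" for k
  define \<Phi> where "\<Phi> = (\<Union>k\<in>{k0..}. layer k)"
  have boxes_active: "boxes x k0 - {0} \<subseteq> (\<lambda>p. E k0 p x) ` active k0"
    by (auto simp: boxes_def active_def)
  have base_boxes: "\<exists>p c. v = c *\<^sub>R E k0 p x \<and> E k0 p x \<noteq> 0" if "v \<in> base" for v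
    using that unfolding base_def boxes_def by blast
  have base_norm: "norm v = 1" if v: "v \<in> base" for v
  proof -
    obtain w where "v = w /\<^sub>R norm w" "w \<noteq> 0" using v unfolding base_def by blast
    then show ?thesis by simp
  qed
  have fin_base: "finite base" and card_base: "card base \<le> card (active k0)"
  proof -
    have f: "finite (boxes x k0 - {0})"
      using boxes_active finite_active finite_subset by blast
    then show "finite base" by (simp add: base_def)
    have "card base \<le> card (boxes x k0 - {0})" unfolding base_def using f by (rule card_image_le)
    also have "\<dots> \<le> card ((\<lambda>p. E k0 p x) ` active k0)"
      using boxes_active finite_active by (intro card_mono) auto
    also have "\<dots> \<le> card (active k0)" using finite_active by (rule card_image_le)
    finally show "card base \<le> card (active k0)" .
  qed
  have fin_layer: "finite (layer k)" for k
    unfolding layer_def using finite_active detail(1) fin_base by auto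
  have card_layer: "real (card (layer k)) \<le> 5 * M * 2 ^ k" for k
  proof -
    have "card (\<Union>p\<in>active k. detail x k p) \<le> (\<Sum>p\<in>active k. card (detail x k p))"
      by (rule card_UN_le[OF finite_active])
    also have "\<dots> \<le> (\<Sum>p\<in>active k. 4)" by (intro sum_mono detail(2))
    finally have "card (\<Union>p\<in>active k. detail x k p) \<le> 4 * card (active k)" by simp
    then have "card (layer k) \<le> 5 * card (active k)"
      unfolding layer_def using card_Un_le[of "\<Union>p\<in>active k. detail x k p" base] card_base by auto
    then have "real (card (layer k)) \<le> 5 * real (card (active k))" by linarith
    then show ?thesis using count[of k] by linarith
  qed
  have layer_E: "\<exists>p. E k p v = v" if "v \<in> layer k" for k v
  proof (cases "v \<in> base \<and> k = k0")
    case True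
    then obtain p c where "v = c *\<^sub>R E k0 p x" using base_boxes by blast
    then have "E k p v = v" using True by (simp add: E_E blinfun.scaleR_right)
    then show ?thesis ..
  next
    case False
    then obtain p where "v \<in> detail x k p" using \<open>v \<in> layer k\<close> by (auto simp: layer_def split: if_splits)
    then show ?thesis using E_detail by blast
  qed
  have layer_norm: "norm v = 1" if "v \<in> layer k" for k v
    using that detail(4) base_norm unfolding layer_def by (auto split: if_splits)
  have layer_span: "v \<in> span (boxes x (Suc k))" if "v \<in> layer k" for k v
    using that
  proof (cases "v \<in> base \<and> k = k0")
    case True
    then obtain p c where "v = c *\<^sub>R E k0 p x" using base_boxes by blast
    moreover have "E k0 p x \<in> span (boxes x (Suc k))"
      using True boxes_coarse[of k0 "Suc k0" x] by (auto simp: boxes_def)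
    ultimately show ?thesis by (simp add: span_scale)
  next
    case False
    then show ?thesis using that detail_span unfolding layer_def by (auto split: if_splits)
  qed
  \<comment> \<open>Details of level \<open>l\<close> are orthogonal to all box vectors of level
    \<open>Suc k \<le> l\<close>, and these span a space containing \<open>v\<close>.\<close>
  have orth_less: "inner v w = 0" if "v \<in> layer k" "w \<in> layer l" "k < l" "k0 \<le> k" for v w k l
  proof -
    have "l \<noteq> k0" using \<open>k < l\<close> \<open>k0 \<le> k\<close> by simp
    then obtain p where "w \<in> detail x l p" using \<open>w \<in> layer l\<close> by (auto simp: layer_def)
    then have "inner u w = 0" if "u \<in> boxes x (Suc k)" for u
      using detail_orthogonal[of w x l p "Suc k" u] that \<open>k < l\<close> by (simp add: inner_commute)
    then show ?thesis by (rule span_orthogonal_zero[OF layer_span[OF \<open>v \<in> layer k\<close>]])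
  qed
  have orth_eq: "inner v w = 0" if v: "v \<in> layer k" and w: "w \<in> layer k" and "v \<noteq> w" "k0 \<le> k" for v w k
  proof -
    have *: "inner v w = 0" if "v \<in> detail x k p" "w \<in> base" "k = k0" for v w p
    proof -
      obtain p' c where "w = c *\<^sub>R E k0 p' x" using base_boxes \<open>w \<in> base\<close> by blast
      then show ?thesis using detail_orthogonal[OF that(1), of k0 "E k0 p' x"] \<open>k = k0\<close> by (simp add: boxes_def)
    qed
    consider (1) p q where "v \<in> detail x k p" "w \<in> detail x k q"
      | (2) p where "v \<in> detail x k p" "w \<in> base" "k = k0"
      | (3) p where "v \<in> base" "w \<in> detail x k p" "k = k0"
      | (4) "v \<in> base" "w \<in> base" "k = k0"
      using v w unfolding layer_def by (auto split: if_splits)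
    then show ?thesis
    proof cases
      case 1
      show ?thesis
      proof (cases "p = q")
        case True
        then show ?thesis using 1 detail(3)[of x k p] \<open>v \<noteq> w\<close> by (auto simp: pairwise_def orthogonal_def)
      next
        case False
        have "inner v w = inner (E k p v) (E k q w)" by (simp only: E_detail[OF 1(1)] E_detail[OF 1(2)])
        also have "\<dots> = inner v (E k p (E k q w))" by (rule adjD[OF selfadj_E])
        finally show ?thesis using False by (simp add: E_E)
      qed
    next
      case 2
      then show ?thesis using * by blast
    next
      case 3
      then show ?thesis using *[of w p v] by (simp add: inner_commute)
    next
      case 4
      obtain p q where p: "v = E k0 p x /\<^sub>R norm (E k0 p x)" and q: "w = E k0 q x /\<^sub>R norm (E k0 q x)"
        using 4 by (auto simp: base_def boxes_def)
      then have "p \<noteq> q" using \<open>v \<noteq> w\<close> by blast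
      then have "inner (E k0 p x) (E k0 q x) = 0"
        unfolding adjD[OF selfadj_E] by (simp add: E_E)
      then show ?thesis by (simp add: p q)
    qed
  qed
  have uniq_lev: "k = l" if "v \<in> layer k" "v \<in> layer l" "k0 \<le> k" "k0 \<le> l" for v k l
  proof (rule ccontr)
    assume "k \<noteq> l"
    then have "inner v v = 0" using orth_less[of v k v l] orth_less[of v l v k] that by (meson linorder_neqE)
    then show False using layer_norm[OF that(1)] by simp
  qed
  define lev where "lev v = (SOME k. k0 \<le> k \<and> v \<in> layer k)" for v
  have lev: "k0 \<le> lev v" "v \<in> layer (lev v)" if "v \<in> \<Phi>" for v
  proof -
    have "\<exists>k. k0 \<le> k \<and> v \<in> layer k" using that by (auto simp: \<Phi>_def)
    from someI_ex[OF this] show "k0 \<le> lev v" "v \<in> layer (lev v)" unfolding lev_def by blast+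
  qed
  show thesis
  proof (rule that[of \<Phi> lev])
    show "pairwise orthogonal \<Phi>"
    proof (rule pairwiseI)
      fix v w assume "v \<in> \<Phi>" "w \<in> \<Phi>" "v \<noteq> w"
      then show "orthogonal v w" unfolding orthogonal_def
        using orth_eq[of v "lev v" w] orth_less[of v "lev v" w "lev w"] orth_less[of w "lev w" v "lev v"]
          lev[of v] lev[of w] inner_commute[of v w]
        by (cases "lev v" "lev w" rule: linorder_cases) auto
    qed
    show "norm v = 1" if "v \<in> \<Phi>" for v using layer_norm lev that by blast
    show "v \<in> span (\<Union>k. boxes x k)" if "v \<in> \<Phi>" for v
      using layer_span[OF lev(2)[OF that]] span_mono[of "boxes x (Suc (lev v))" "\<Union>k. boxes x k"] by blast
    show "\<exists>p. E (lev v) p v = v" if "v \<in> \<Phi>" for v using layer_E lev that by blast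
    \<comment> \<open>A box vector minus its projection onto the vector of its parent lies in the
      span of the details of the parent; the vector of the parent is in the span by
      induction.\<close>
    have fine: "boxes x (k0 + n) \<subseteq> span \<Phi>" for n
    proof (induction n)
      case 0
      show ?case
      proof
        fix v assume "v \<in> boxes x (k0 + 0)"
        then have "v = 0 \<or> v /\<^sub>R norm v \<in> \<Phi>"
          by (auto simp: \<Phi>_def layer_def base_def)
        then show "v \<in> span \<Phi>"
        proof
          assume "v /\<^sub>R norm v \<in> \<Phi>"
          then have "norm v *\<^sub>R (v /\<^sub>R norm v) \<in> span \<Phi>" by (intro span_scale span_base)
          then show ?thesis by (cases "v = 0") auto
        qed (simp add: span_zero)
      qed
    next
      case (Suc n)
      show ?case
      proof
        fix v assume "v \<in> boxes x (k0 + Suc n)"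
        then obtain q where v: "v = E (Suc (k0 + n)) q x" by (auto simp: boxes_def)
        define u where "u = E (k0 + n) (parent q) x"
        have "q \<in> children (parent q)" by (simp add: mem_children_iff)
        then have "v - (inner v u / inner u u) *\<^sub>R u \<in> span (detail x (k0 + n) (parent q))"
          unfolding detail(5) u_def v by (intro span_base imageI)
        moreover have "detail x (k0 + n) (parent q) \<subseteq> layer (k0 + n)"
          using detail_active[of _ x "k0 + n" "parent q"] unfolding layer_def by blast
        then have "detail x (k0 + n) (parent q) \<subseteq> \<Phi>"
          unfolding \<Phi>_def by force
        ultimately have "v - (inner v u / inner u u) *\<^sub>R u \<in> span \<Phi>" using span_mono by blast
        moreover have "u \<in> span \<Phi>" using Suc.IH by (auto simp: u_def boxes_def)
        ultimately have "(v - (inner v u / inner u u) *\<^sub>R u) + (inner v u / inner u u) *\<^sub>R u \<in> span \<Phi>"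
          by (intro span_add span_scale)
        then show "v \<in> span \<Phi>" by simp
      qed
    qed
    show "boxes x k \<subseteq> span \<Phi>" for k
    proof -
      have "boxes x k \<subseteq> span (boxes x (k0 + k))" by (rule boxes_coarse) simp
      also have "\<dots> \<subseteq> span \<Phi>" using fine by (intro span_minimal subspace_span)
      finally show ?thesis .
    qed
    show "(\<Sum>v\<in>F. (1/4) ^ lev v) \<le> \<epsilon>" if "finite F" "F \<subseteq> \<Phi>" for F
    proof -
      define n where "n = Max (insert k0 (lev ` F))"
      have "lev ` F \<subseteq> {k0..n}"
        using lev(1) that by (auto simp: n_def)
      have "(\<Sum>v\<in>F. (1/4::real) ^ lev v) = (\<Sum>k\<in>{k0..n}. \<Sum>v\<in>{v\<in>F. lev v = k}. (1/4) ^ lev v)"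
        by (rule sum.group[symmetric]) (use that \<open>lev ` F \<subseteq> _\<close> in auto)
      also have "\<dots> \<le> (\<Sum>k\<in>{k0..n}. 5 * M * (1/2) ^ k)"
      proof (rule sum_mono)
        fix k assume "k \<in> {k0..n}"
        have "{v\<in>F. lev v = k} \<subseteq> layer k" using lev(2) that by auto
        then have "real (card {v\<in>F. lev v = k}) \<le> 5 * M * 2 ^ k"
          using card_mono[OF fin_layer] card_layer[of k] by (meson of_nat_le_iff order_trans)
        then have "real (card {v\<in>F. lev v = k}) * (1/4) ^ k \<le> 5 * M * 2 ^ k * (1/4) ^ k"
          by (intro mult_right_mono) auto
        also have "\<dots> = 5 * M * (1/2) ^ k" by (simp add: power_mult_distrib[symmetric] mult.assoc)
        finally show "(\<Sum>v\<in>{v\<in>F. lev v = k}. (1/4) ^ lev v) \<le> 5 * M * (1/2) ^ k" by simp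
      qed
      also have "\<dots> = 5 * M * (\<Sum>k\<in>{k0..n}. (1/2) ^ k)" by (simp add: sum_distrib_left)
      also have "(\<Sum>k\<in>{k0..n}. (1/2::real) ^ k) \<le> 2 * (1/2) ^ k0"
        using sum_gp[of "1/2::real" k0 n] by (auto simp: field_simps)
      then have "5 * M * (\<Sum>k\<in>{k0..n}. (1/2) ^ k) \<le> 5 * M * (2 * (1/2) ^ k0)"
        using \<open>M \<ge> 0\<close> by (intro mult_left_mono) auto
      also have "\<dots> \<le> \<epsilon>" using k0 by simp
      finally show ?thesis .
    qed
  qed
qed

end

section \<open>Quaternionic square-summable sequences as a Hilbert space\<close>

lemma qmul_assoc: "qmul (qmul p q) r = qmul p (qmul q r)"
  by (simp add: qmul_def algebra_simps)

lemma qmul_add_left: "qmul (p + q) r = qmul p r + qmul q r"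
  and qmul_add_right: "qmul p (q + r) = qmul p q + qmul p r"
  and qmul_minus_right: "qmul p (- r) = - qmul p r"
  by (simp_all add: qmul_def algebra_simps)

lemma qmul_scaleR_left: "qmul (c *\<^sub>R p) q = c *\<^sub>R qmul p q"
  and qmul_scaleR_right: "qmul p (c *\<^sub>R q) = c *\<^sub>R qmul p q"
  by (simp_all add: qmul_def scaleR_conv_of_real algebra_simps)

lemma qmul_qreal_right: "qmul p (qreal c) = c *\<^sub>R p"
  and qmul_qreal_left: "qmul (qreal c) p = c *\<^sub>R p"
  by (simp_all add: qmul_def qreal_def scaleR_conv_of_real prod_eq_iff)

lemma qmul_zero: "qmul p 0 = 0" "qmul 0 p = 0"
  by (simp_all add: qmul_def zero_prod_def)

lemma qcnj_qmul: "qcnj (qmul p q) = qmul (qcnj q) (qcnj p)"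
  by (simp add: qmul_def qcnj_def)

lemma qcnj_qcnj [simp]: "qcnj (qcnj p) = p"
  by (simp add: qcnj_def)

lemma inner_qmul_right: "inner (qmul p q) r = inner p (qmul r (qcnj q))"
  by (simp add: qmul_def qcnj_def inner_prod_def inner_complex_def algebra_simps)

lemma inner_qmul_left: "inner (qmul p q) r = inner q (qmul (qcnj p) r)"
  by (simp add: qmul_def qcnj_def inner_prod_def inner_complex_def algebra_simps)

lemma qmul_qcnj: "qmul p (qcnj p) = qreal ((norm p)\<^sup>2)" "qmul (qcnj p) p = qreal ((norm p)\<^sup>2)"
  by (simp_all add: qmul_def qcnj_def qreal_def norm_prod_def prod_eq_iff complex_mult_cnj
      cmod_power2 complex_eq_iff algebra_simps)

lemma norm_qmul: "norm (qmul p q) = norm p * norm q"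
proof -
  have "(norm (qmul p q))\<^sup>2 = inner p (qmul p (qmul q (qcnj q)))"
    by (simp only: power2_norm_eq_inner inner_qmul_right qmul_assoc)
  also have "\<dots> = (norm p * norm q)\<^sup>2"
    by (simp add: qmul_qcnj qmul_qreal_right power2_norm_eq_inner[symmetric] power_mult_distrib)
  finally show ?thesis by (rule power2_eq_imp_eq) auto
qed

lemma norm_qcnj [simp]: "norm (qcnj p) = norm p"
  by (simp add: qcnj_def norm_prod_def)

lemma norm_qreal [simp]: "norm (qreal c) = \<bar>c\<bar>"
  by (simp add: qreal_def norm_prod_def)

lemma l2_scaleR: "x \<in> l2 \<Longrightarrow> (\<lambda>n. c *\<^sub>R x n) \<in> l2"
  by (simp add: l2_def power_mult_distrib summable_mult)

lemma l2_add:
  assumes "x \<in> l2" "y \<in> l2"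
  shows "(\<lambda>n. x n + y n) \<in> l2"
proof -
  have "norm ((norm (x n + y n))\<^sup>2) \<le> 2 * (norm (x n))\<^sup>2 + 2 * (norm (y n))\<^sup>2" for n
  proof -
    have "(norm (x n + y n))\<^sup>2 \<le> (norm (x n) + norm (y n))\<^sup>2"
      by (intro power_mono norm_triangle_ineq norm_ge_zero)
    also have "\<dots> \<le> 2 * (norm (x n))\<^sup>2 + 2 * (norm (y n))\<^sup>2"
      using zero_le_power2[of "norm (x n) - norm (y n)"] by (simp add: power2_eq_square algebra_simps)
    finally show ?thesis by simp
  qed
  moreover have "summable (\<lambda>n. 2 * (norm (x n))\<^sup>2 + 2 * (norm (y n))\<^sup>2)"
    using assms by (intro summable_add summable_mult) (auto simp: l2_def)
  ultimately show ?thesis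
    unfolding l2_def by (auto intro: summable_comparison_test')
qed

lemma l2_norm_bilinear_summable:
  assumes "x \<in> l2" "y \<in> l2" "\<And>n. norm (f n) \<le> norm (x n) * norm (y n)"
  shows "summable (\<lambda>n. norm (f n))"
proof (rule summable_comparison_test')
  show "summable (\<lambda>n. (norm (x n))\<^sup>2 + (norm (y n))\<^sup>2)"
    using assms by (intro summable_add) (auto simp: l2_def)
  show "norm (norm (f n)) \<le> (norm (x n))\<^sup>2 + (norm (y n))\<^sup>2" if "n \<ge> 0" for n
  proof -
    have "norm (x n) * norm (y n) \<le> (norm (x n))\<^sup>2 + (norm (y n))\<^sup>2"
      using sum_squares_bound[of "norm (x n)" "norm (y n)"]
        mult_nonneg_nonneg[OF norm_ge_zero[of "x n"] norm_ge_zero[of "y n"]] by linarith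
    then show ?thesis using assms(3)[of n] by simp
  qed
qed

lemma l2_inner_summable: "x \<in> l2 \<Longrightarrow> y \<in> l2 \<Longrightarrow> summable (\<lambda>n. inner (x n) (y n))"
  by (rule summable_norm_cancel, rule l2_norm_bilinear_summable[of x y]) (auto simp: Cauchy_Schwarz_ineq2)

lemma l2_linner_summable: "x \<in> l2 \<Longrightarrow> y \<in> l2 \<Longrightarrow> summable (\<lambda>n. qmul (qcnj (x n)) (y n))"
  by (rule summable_norm_cancel, rule l2_norm_bilinear_summable[of x y]) (auto simp: norm_qmul)

text \<open>The set \<open>l2\<close> becomes a type so that it can carry a real Hilbert space
  structure, whose \<open>inner\<close> is the real part of \<open>linner\<close>. Quaternionic
  scalars return later as the operators \<open>rmul q\<close>.\<close>

typedef qell2 = l2 morphisms seq Hq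
  by (rule exI[of _ "\<lambda>_. 0"]) (simp add: l2_def)

setup_lifting type_definition_qell2

lemmas seq_l2 [simp] = seq

lemma qell2_eqI: "(\<And>n. seq x n = seq y n) \<Longrightarrow> x = y"
  by (metis ext seq_inject)

instantiation qell2 :: real_vector
begin

lift_definition zero_qell2 :: qell2 is "\<lambda>_. 0"
  by (simp add: l2_def)

lift_definition plus_qell2 :: "qell2 \<Rightarrow> qell2 \<Rightarrow> qell2" is "\<lambda>x y n. x n + y n"
  by (rule l2_add)

lift_definition scaleR_qell2 :: "real \<Rightarrow> qell2 \<Rightarrow> qell2" is "\<lambda>c x n. c *\<^sub>R x n"
  by (rule l2_scaleR)

lift_definition uminus_qell2 :: "qell2 \<Rightarrow> qell2" is "\<lambda>x n. - x n"
  by (simp add: l2_def)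

definition minus_qell2 :: "qell2 \<Rightarrow> qell2 \<Rightarrow> qell2" where
  "minus_qell2 x y = x + - y"

instance
proof
  fix x y z :: qell2 and a b :: real
  note [simp] = plus_qell2.rep_eq scaleR_qell2.rep_eq uminus_qell2.rep_eq zero_qell2.rep_eq
  show "x + y + z = x + (y + z)" "x + y = y + x" "0 + x = x" "- x + x = 0"
    "a *\<^sub>R (x + y) = a *\<^sub>R x + a *\<^sub>R y" "(a + b) *\<^sub>R x = a *\<^sub>R x + b *\<^sub>R x" "a *\<^sub>R b *\<^sub>R x = (a * b) *\<^sub>R x" "1 *\<^sub>R x = x"
    by (auto intro!: qell2_eqI simp: algebra_simps)
  show "x - y = x + - y" by (rule minus_qell2_def)
qed

end

lemma seq_add [simp]: "seq (x + y) n = seq x n + seq y n"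
  and seq_scaleR [simp]: "seq (c *\<^sub>R x) n = c *\<^sub>R seq x n"
  and seq_zero [simp]: "seq 0 n = 0"
  and seq_uminus [simp]: "seq (- x) n = - seq x n"
  by (simp_all add: plus_qell2.rep_eq scaleR_qell2.rep_eq zero_qell2.rep_eq uminus_qell2.rep_eq)

lemma seq_diff [simp]: "seq (x - y) n = seq x n - seq y n"
  by (simp only: minus_qell2_def seq_add seq_uminus) simp

instantiation qell2 :: real_inner
begin

definition inner_qell2 :: "qell2 \<Rightarrow> qell2 \<Rightarrow> real" where
  "inner_qell2 x y = (\<Sum>n. inner (seq x n) (seq y n))"

definition norm_qell2 :: "qell2 \<Rightarrow> real" where
  "norm_qell2 x = sqrt (inner x x)"

definition dist_qell2 :: "qell2 \<Rightarrow> qell2 \<Rightarrow> real" where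
  "dist_qell2 x y = norm (x - y)"

definition sgn_qell2 :: "qell2 \<Rightarrow> qell2" where
  "sgn_qell2 x = x /\<^sub>R norm x"

definition uniformity_qell2 :: "(qell2 \<times> qell2) filter" where
  "uniformity_qell2 = (INF e\<in>{0<..}. principal {(x, y). dist x y < e})"

definition open_qell2 :: "qell2 set \<Rightarrow> bool" where
  "open_qell2 U \<longleftrightarrow> (\<forall>x\<in>U. \<forall>\<^sub>F (x', y) in uniformity. x' = x \<longrightarrow> y \<in> U)"

instance
proof
  fix x y z :: qell2 and a b :: real
  note s = l2_inner_summable[OF seq_l2 seq_l2]
  show "dist x y = norm (x - y)" by (rule dist_qell2_def)
  show "sgn x = x /\<^sub>R norm x" by (rule sgn_qell2_def)
  show "(uniformity :: (qell2 \<times> qell2) filter) = (INF e\<in>{0<..}. principal {(x, y). dist x y < e})"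
    by (rule uniformity_qell2_def)
  show "open U = (\<forall>x\<in>U. \<forall>\<^sub>F (x', y) in uniformity. x' = x \<longrightarrow> y \<in> U)" for U :: "qell2 set"
    by (rule open_qell2_def)
  show "inner x y = inner y x" by (simp add: inner_qell2_def inner_commute)
  show "inner (x + y) z = inner x z + inner y z"
    by (simp add: inner_qell2_def inner_add_left suminf_add[OF s s])
  show "inner (a *\<^sub>R x) y = a * inner x y"
    by (simp add: inner_qell2_def suminf_mult[OF s])
  show "0 \<le> inner x x" by (simp add: inner_qell2_def suminf_nonneg[OF s])
  show "(inner x x = 0) = (x = 0)"
  proof
    assume "inner x x = 0"
    then have "(\<Sum>n. inner (seq x n) (seq x n)) = 0"
      by (simp only: inner_qell2_def)
    then have "\<forall>n. inner (seq x n) (seq x n) = 0"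
      by (subst (asm) suminf_eq_zero_iff[OF s]) auto
    then show "x = 0" by (intro qell2_eqI) simp
  qed (simp add: inner_qell2_def)
  show "norm x = sqrt (inner x x)" by (rule norm_qell2_def)
qed

end

lemma seq_sum: "seq (sum f I) n = (\<Sum>i\<in>I. seq (f i) n)"
  by (induction I rule: infinite_finite_induct) auto

lemma norm_qell2_sums: "(\<lambda>n. (norm (seq x n))\<^sup>2) sums (norm x)\<^sup>2"
proof -
  have "(norm x)\<^sup>2 = (\<Sum>n. (norm (seq x n))\<^sup>2)"
    by (simp add: power2_norm_eq_inner inner_qell2_def)
  moreover have "summable (\<lambda>n. (norm (seq x n))\<^sup>2)"
    using seq_l2[of x] by (simp add: l2_def)
  ultimately show ?thesis by (simp add: summable_sums)
qed

lemma lnorm_seq: "lnorm (seq x) = norm x"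
  using norm_qell2_sums[of x] by (simp add: lnorm_def sums_iff)

lemma norm_seq_sum_le: "finite I \<Longrightarrow> (\<Sum>n\<in>I. (norm (seq x n))\<^sup>2) \<le> (norm x)\<^sup>2"
  using sum_le_suminf[of "\<lambda>n. (norm (seq x n))\<^sup>2" I] norm_qell2_sums[of x] by (simp add: sums_iff)

lemma norm_seq_le: "norm (seq x n) \<le> norm x"
  using norm_seq_sum_le[of "{n}" x] by (intro power2_le_imp_le[OF _ norm_ge_zero]) simp

lemma bounded_linear_seq: "bounded_linear (\<lambda>x. seq x n)"
  by (rule bounded_linear_intro[where K=1]) (auto simp: norm_seq_le)

text \<open>The limit is taken coordinatewise. The Cauchy bound on finite partial sums survives the
  limit and yields both membership in \<open>l2\<close> and norm convergence.\<close>

instance qell2 :: banach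
proof
  fix X :: "nat \<Rightarrow> qell2"
  assume X: "Cauchy X"
  have "Cauchy (\<lambda>i. seq (X i) n)" for n
    by (rule bounded_linear.Cauchy[OF bounded_linear_seq X])
  then have "\<exists>l. \<forall>n. (\<lambda>i. seq (X i) n) \<longlonglongrightarrow> l n"
    by (intro choice allI) (auto simp: Cauchy_convergent_iff convergent_def)
  then obtain l where l: "\<And>n. (\<lambda>i. seq (X i) n) \<longlonglongrightarrow> l n" by blast
  have tail: "\<exists>M. \<forall>i\<ge>M. summable (\<lambda>n. (norm (seq (X i) n - l n))\<^sup>2) \<and> (\<Sum>n. (norm (seq (X i) n - l n))\<^sup>2) \<le> e\<^sup>2"
    if "e > 0" for e
  proof -
    obtain M where M: "\<And>i j. i \<ge> M \<Longrightarrow> j \<ge> M \<Longrightarrow> norm (X i - X j) < e"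
      using CauchyD[OF X \<open>e > 0\<close>] by blast
    have part: "(\<Sum>n<k. (norm (seq (X i) n - l n))\<^sup>2) \<le> e\<^sup>2" if "i \<ge> M" for i k
    proof (rule LIMSEQ_le_const2)
      show "(\<lambda>j. \<Sum>n<k. (norm (seq (X i) n - seq (X j) n))\<^sup>2) \<longlonglongrightarrow> (\<Sum>n<k. (norm (seq (X i) n - l n))\<^sup>2)"
        by (intro tendsto_sum tendsto_power tendsto_norm tendsto_diff tendsto_const l)
      have "(\<Sum>n<k. (norm (seq (X i) n - seq (X j) n))\<^sup>2) \<le> e\<^sup>2" if "j \<ge> M" for j
      proof -
        have "(\<Sum>n<k. (norm (seq (X i) n - seq (X j) n))\<^sup>2) \<le> (norm (X i - X j))\<^sup>2"
          using norm_seq_sum_le[of "{..<k}" "X i - X j"] by simp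
        also have "\<dots> \<le> e\<^sup>2"
          using M[OF \<open>i \<ge> M\<close> that] by (intro power_mono) auto
        finally show ?thesis .
      qed
      then show "\<exists>N. \<forall>j\<ge>N. (\<Sum>n<k. (norm (seq (X i) n - seq (X j) n))\<^sup>2) \<le> e\<^sup>2" by blast
    qed
    then have "summable (\<lambda>n. (norm (seq (X i) n - l n))\<^sup>2)" if "i \<ge> M" for i
      using that by (intro summableI_nonneg_bounded[where x="e\<^sup>2"]) auto
    then show ?thesis using part by (intro exI[of _ M]) (auto intro: suminf_le_const)
  qed
  obtain M where "\<forall>i\<ge>M. summable (\<lambda>n. (norm (seq (X i) n - l n))\<^sup>2)"
    using tail[OF zero_less_one] by blast
  then have "(\<lambda>n. seq (X M) n - l n) \<in> l2" by (simp add: l2_def)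
  then have "(\<lambda>n. seq (X M) n + (- 1) *\<^sub>R (seq (X M) n - l n)) \<in> l2"
    by (intro l2_add l2_scaleR seq_l2)
  then have "l \<in> l2" by (simp add: algebra_simps)
  define L where "L = Hq l"
  have sL: "seq L = l" unfolding L_def by (rule Hq_inverse) fact
  have "X \<longlonglongrightarrow> L"
  proof (rule metric_LIMSEQ_I)
    fix e :: real assume "e > 0"
    then obtain M where M: "\<forall>i\<ge>M. (\<Sum>n. (norm (seq (X i) n - l n))\<^sup>2) \<le> (e/2)\<^sup>2"
      using tail[of "e/2"] by auto
    show "\<exists>M. \<forall>i\<ge>M. dist (X i) L < e"
    proof (intro exI allI impI)
      fix i assume "i \<ge> M"
      have "(norm (X i - L))\<^sup>2 \<le> (e/2)\<^sup>2"
      proof -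
        have "(norm (X i - L))\<^sup>2 = (\<Sum>n. (norm (seq (X i) n - l n))\<^sup>2)"
          using norm_qell2_sums[of "X i - L"] by (simp add: sums_iff sL)
        then show ?thesis using M \<open>i \<ge> M\<close> by simp
      qed
      then have "norm (X i - L) \<le> e/2" by (rule power2_le_imp_le) (use \<open>e > 0\<close> in simp)
      then show "dist (X i) L < e" using \<open>e > 0\<close> by (simp add: dist_norm)
    qed
  qed
  then show "convergent X" by (rule convergentI)
qed

lemma l2_vmul: "x \<in> l2 \<Longrightarrow> vmul x q \<in> l2"
  by (simp add: l2_def vmul_def norm_qmul power_mult_distrib summable_mult2)

lift_definition hmul :: "qell2 \<Rightarrow> quat \<Rightarrow> qell2" is vmul
  by (rule l2_vmul)

lemma seq_hmul [simp]: "seq (hmul x q) n = qmul (seq x n) q"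
  by (simp add: hmul.rep_eq vmul_def)

lemma hmul_hmul: "hmul (hmul x p) q = hmul x (qmul p q)"
  by (rule qell2_eqI) (simp add: qmul_assoc)

lemma hmul_qreal: "hmul x (qreal c) = c *\<^sub>R x"
  by (rule qell2_eqI) (simp add: qmul_qreal_right)

lemma hmul_zero [simp]: "hmul x 0 = 0"
  by (rule qell2_eqI) (simp add: qmul_zero)

lemma hmul_add: "hmul x (p + q) = hmul x p + hmul x q"
  by (rule qell2_eqI) (simp add: qmul_add_right)

lemma hmul_minus: "hmul x (- p) = - hmul x p"
  by (rule qell2_eqI) (simp add: qmul_minus_right)

lemma hmul_scaleR: "hmul x (c *\<^sub>R p) = c *\<^sub>R hmul x p"
  by (rule qell2_eqI) (simp add: qmul_scaleR_right)

lemma norm_hmul: "norm (hmul x q) = norm x * norm q"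
proof -
  have "(\<lambda>n. (norm (seq (hmul x q) n))\<^sup>2) sums ((norm x)\<^sup>2 * (norm q)\<^sup>2)"
    using sums_mult2[OF norm_qell2_sums[of x], of "(norm q)\<^sup>2"] by (simp add: norm_qmul power_mult_distrib)
  then have "(norm (hmul x q))\<^sup>2 = (norm x * norm q)\<^sup>2"
    unfolding power_mult_distrib by (rule sums_unique2[OF norm_qell2_sums])
  then show ?thesis by (rule power2_eq_imp_eq) auto
qed

definition rmul :: "quat \<Rightarrow> qell2 \<Rightarrow>\<^sub>L qell2" where
  "rmul q = Blinfun (\<lambda>x. hmul x q)"

lemma rmul_apply [simp]: "rmul q x = hmul x q"
proof -
  have "bounded_linear (\<lambda>x. hmul x q)"
    by (rule bounded_linear_intro[where K="norm q"])
      (auto intro!: qell2_eqI simp: qmul_add_left qmul_scaleR_left norm_hmul)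
  then show ?thesis by (simp add: rmul_def bounded_linear_Blinfun_apply)
qed

lemma inner_hmul: "inner (hmul x q) y = inner x (hmul y (qcnj q))"
  by (simp add: inner_qell2_def inner_qmul_right)

lemma adj_rmul: "adj (rmul q) (rmul (qcnj q))"
  by (simp add: adj_def inner_hmul)

definition hinner :: "qell2 \<Rightarrow> qell2 \<Rightarrow> quat" where
  "hinner x y = linner (seq x) (seq y)"

text \<open>The real inner products of \<open>y\<close> with all right multiples of \<open>x\<close>
  determine \<open>hinner x y\<close>, so quaternionic orthogonality and the algebra of
  \<open>hinner\<close> can be settled with \<open>inner\<close> alone.\<close>

lemma inner_hmul_hinner: "inner (hmul x q) y = inner q (hinner x y)"
proof -
  have "inner (hmul x q) y = (\<Sum>n. inner q (qmul (qcnj (seq x n)) (seq y n)))"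
    by (simp add: inner_qell2_def inner_qmul_left)
  also have "\<dots> = inner q (hinner x y)"
    unfolding hinner_def linner_def
    by (intro bounded_linear.suminf[OF bounded_linear_inner_right, symmetric] l2_linner_summable seq_l2)
  finally show ?thesis .
qed

lemma hinner_eq_zero_iff: "hinner x y = 0 \<longleftrightarrow> (\<forall>q. inner (hmul x q) y = 0)"
  unfolding inner_hmul_hinner using inner_eq_zero_iff[of "hinner x y"] by fastforce

lemma hinner_self: "hinner x x = qreal ((norm x)\<^sup>2)"
proof -
  have "bounded_linear qreal"
    by (rule bounded_linear_intro[where K=1]) (auto simp: qreal_def scaleR_conv_of_real)
  then have "(\<lambda>n. qreal ((norm (seq x n))\<^sup>2)) sums qreal ((norm x)\<^sup>2)"
    by (rule bounded_linear.sums) (rule norm_qell2_sums)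
  then show ?thesis
    by (simp add: hinner_def linner_def qmul_qcnj sums_iff)
qed

lemma inner_hmul_self: "inner (hmul x q) x = Re (fst q) * (norm x)\<^sup>2"
  unfolding inner_hmul_hinner hinner_self by (simp add: qreal_def inner_prod_def inner_complex_def)

lemma quat_inner_eqI: "(\<And>q::quat. inner q a = inner q b) \<Longrightarrow> a = b"
  using vector_eq_ldot by blast

lemma hinner_add_right: "hinner x (y + z) = hinner x y + hinner x z"
  by (rule quat_inner_eqI) (simp add: inner_add_right flip: inner_hmul_hinner)

lemma hinner_scaleR_right: "hinner x (c *\<^sub>R y) = c *\<^sub>R hinner x y"
  by (rule quat_inner_eqI) (simp flip: inner_hmul_hinner)

lemma hinner_hmul_right: "hinner x (hmul y q) = qmul (hinner x y) q"
proof (rule quat_inner_eqI)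
  fix p
  have "inner (hmul x p) (hmul y q) = inner (hmul x (qmul p (qcnj q))) y"
    by (simp only: inner_hmul hmul_hmul qcnj_qmul qcnj_qcnj) 
  then show "inner p (hinner x (hmul y q)) = inner p (qmul (hinner x y) q)"
    by (simp add: inner_hmul_hinner inner_qmul_right)
qed

section \<open>Quaternionic orthonormal families and Bessel's inequality\<close>

definition quat_orthonormal :: "qell2 set \<Rightarrow> bool" where
  "quat_orthonormal \<Phi> \<longleftrightarrow> (\<forall>v\<in>\<Phi>. norm v = 1) \<and> (\<forall>v\<in>\<Phi>. \<forall>w\<in>\<Phi>. v \<noteq> w \<longrightarrow> hinner v w = 0)"

lemma quat_orthonormal_combination:
  assumes "quat_orthonormal \<Phi>" "finite F" "F \<subseteq> \<Phi>"
  shows "(norm (\<Sum>v\<in>F. hmul v (c v)))\<^sup>2 = (\<Sum>v\<in>F. (norm (c v))\<^sup>2)"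
proof -
  have "inner (hmul v (c v)) (hmul w (c w)) = 0" if "v \<in> F" "w \<in> F" "v \<noteq> w" for v w
  proof -
    have "hinner v w = 0" using that assms by (auto simp: quat_orthonormal_def)
    then show ?thesis by (simp add: inner_hmul_hinner hinner_hmul_right qmul_zero)
  qed
  then have "(norm (\<Sum>v\<in>F. hmul v (c v)))\<^sup>2 = (\<Sum>v\<in>F. (norm (hmul v (c v)))\<^sup>2)"
    by (intro norm_sum_Pythagorean assms) (auto simp: pairwise_def orthogonal_def)
  also have "\<dots> = (\<Sum>v\<in>F. (norm (c v))\<^sup>2)"
    using assms by (intro sum.cong) (auto simp: norm_hmul quat_orthonormal_def)
  finally show ?thesis .
qed

lemma bessel_identity:
  assumes "quat_orthonormal \<Phi>" "finite F" "F \<subseteq> \<Phi>"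
  shows "(norm (x - (\<Sum>v\<in>F. hmul v (hinner v x))))\<^sup>2 = (norm x)\<^sup>2 - (\<Sum>v\<in>F. (norm (hinner v x))\<^sup>2)"
proof -
  define y where "y = (\<Sum>v\<in>F. hmul v (hinner v x))"
  have "inner y x = (\<Sum>v\<in>F. (norm (hinner v x))\<^sup>2)"
    by (simp add: y_def inner_sum_left inner_hmul_hinner power2_norm_eq_inner)
  moreover have "(norm y)\<^sup>2 = (\<Sum>v\<in>F. (norm (hinner v x))\<^sup>2)"
    unfolding y_def by (rule quat_orthonormal_combination[OF assms])
  moreover have "(norm (x - y))\<^sup>2 = (norm x)\<^sup>2 - 2 * inner y x + (norm y)\<^sup>2"
    by (simp add: power2_norm_eq_inner inner_diff_left inner_diff_right inner_commute)
  ultimately show ?thesis by (simp add: y_def)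
qed

lemma bessel_inequality:
  assumes "quat_orthonormal \<Phi>" "finite F" "F \<subseteq> \<Phi>"
  shows "(\<Sum>v\<in>F. (norm (hinner v x))\<^sup>2) \<le> (norm x)\<^sup>2"
  using bessel_identity[OF assms, of x] zero_le_power2[of "norm (x - (\<Sum>v\<in>F. hmul v (hinner v x)))"] by linarith

section \<open>Dyadic squares meeting a curve and the support of the resolution\<close>

text \<open>Closed squares, although the spectral projections belong to half-open ones: nested cells
  then have a common point by compactness.\<close>

definition cell :: "nat \<Rightarrow> int \<times> int \<Rightarrow> (real \<times> real) set" where
  "cell k p = {of_int (fst p) / 2 ^ k .. (of_int (fst p) + 1) / 2 ^ k} \<times> {of_int (snd p) / 2 ^ k .. (of_int (snd p) + 1) / 2 ^ k}"

lemma cell_children: "q \<in> children p \<Longrightarrow> cell (Suc k) q \<subseteq> cell k p"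
  by (cases p; cases q) (auto simp: cell_def children_def field_simps)

text \<open>Consecutive sample times contribute \<open>\<delta>\<close> each, and \<open>n\<close>
  of them form \<open>n - 1\<close> consecutive pairs. The end points \<open>0\<close> and
  \<open>1\<close> are added to obtain an admissible partition.\<close>

lemma sorted_list_chain_bound:
  fixes ts :: "real list" and d :: "real \<Rightarrow> real \<Rightarrow> real"
  assumes len: "\<And>(n::nat) t. t 0 = 0 \<Longrightarrow> t n = 1 \<Longrightarrow> (\<forall>i<n. t i \<le> t (Suc i)) \<Longrightarrow> (\<Sum>i<n. d (t i) (t (Suc i))) \<le> L"
    and d0: "\<And>s t. 0 \<le> d s t" and "0 \<le> \<delta>"
    and ts: "sorted ts" "distinct ts" "set ts \<subseteq> {0..1}"
    and sep: "\<And>s t. s \<in> set ts \<Longrightarrow> t \<in> set ts \<Longrightarrow> s \<noteq> t \<Longrightarrow> \<delta> \<le> d s t"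
  shows "(real (length ts) - 1) * \<delta> \<le> L"
proof -
  define us where "us = 0 # ts @ [1]"
  define n where "n = length ts"
  have "sorted us" using ts by (auto simp: us_def sorted_append)
  then have mono: "\<forall>i<Suc n. us ! i \<le> us ! Suc i"
    by (intro allI impI sorted_nth_mono) (auto simp: us_def n_def)
  have "us ! 0 = 0" "us ! Suc n = 1" by (simp_all add: us_def n_def nth_append)
  then have L: "(\<Sum>i<Suc n. d (us ! i) (us ! Suc i)) \<le> L"
    by (rule len) (rule mono)
  show ?thesis
  proof (cases "n = 0")
    case True
    have "0 \<le> d (us ! 0) (us ! Suc 0)" by (rule d0)
    then have "0 \<le> L" using L True by simp
    then show ?thesis using True \<open>0 \<le> \<delta>\<close> by (simp add: n_def)
  next
    case False
    have "(real n - 1) * \<delta> = (\<Sum>i\<in>{1..<n}. \<delta>)" using False by (simp add: of_nat_diff)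
    also have "\<dots> \<le> (\<Sum>i\<in>{1..<n}. d (us ! i) (us ! Suc i))"
    proof (rule sum_mono)
      fix i assume i: "i \<in> {1..<n}"
      then obtain j where j: "i = Suc j" by (cases i) auto
      then have "us ! i = ts ! j" "us ! Suc i = ts ! Suc j" using i by (simp_all add: us_def n_def nth_append)
      moreover have "ts ! j \<noteq> ts ! Suc j" using ts(2) i j by (simp add: n_def nth_eq_iff_index_eq)
      ultimately show "\<delta> \<le> d (us ! i) (us ! Suc i)" using sep i j by (simp add: n_def)
    qed
    also have "\<dots> \<le> (\<Sum>i<Suc n. d (us ! i) (us ! Suc i))"
      by (intro sum_mono2) (auto simp: d0)
    finally show ?thesis using L by (simp add: n_def)
  qed
qed

text \<open>Neighbouring squares touch, so squares are sorted into four classes by the parities of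
  their coordinates. Distinct squares of one class are at least \<open>2^-k\<close> apart in the max
  norm, so each class has at most \<open>L 2^k + 1\<close> members on the curve.\<close>

lemma cells_on_curve:
  fixes a b :: "real \<Rightarrow> real"
  assumes len: "\<And>(n::nat) t. t 0 = 0 \<Longrightarrow> t n = 1 \<Longrightarrow> (\<forall>i<n. t i \<le> t (Suc i)) \<Longrightarrow>
      (\<Sum>i<n. max \<bar>a (t i) - a (t (Suc i))\<bar> \<bar>b (t i) - b (t (Suc i))\<bar>) \<le> L"
    and "0 \<le> L"
  defines "C \<equiv> \<lambda>k. {p. \<exists>s\<in>{0..1}. (a s, b s) \<in> cell k p}"
  shows "finite (C k) \<and> real (card (C k)) \<le> 4 * (L * 2 ^ k + 1)"
proof -
  define d where "d s t = max \<bar>a s - a t\<bar> \<bar>b s - b t\<bar>" for s t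
  have parity: "real (card P) \<le> L * 2 ^ k + 1"
    if P: "P \<subseteq> C k" "finite P" "\<And>p. p \<in> P \<Longrightarrow> fst p mod 2 = x \<and> snd p mod 2 = y" for P x y
  proof -
    have "\<exists>\<tau>. \<forall>p\<in>P. \<tau> p \<in> {0..1} \<and> (a (\<tau> p), b (\<tau> p)) \<in> cell k p"
      using P(1) unfolding C_def by (intro bchoice) blast
    then obtain \<tau> where \<tau>: "\<And>p. p \<in> P \<Longrightarrow> \<tau> p \<in> {0..1}" "\<And>p. p \<in> P \<Longrightarrow> (a (\<tau> p), b (\<tau> p)) \<in> cell k p"
      by blast
    \<comment> \<open>Distinct indices of equal parity differ by at least two, which leaves a full
      interval of length \<open>2^-k\<close> between the two closed intervals.\<close>
    have gap: "1 / 2 ^ k \<le> \<bar>u - v\<bar>"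
      if "i mod 2 = j mod 2" "i \<noteq> j" "of_int i / 2 ^ k \<le> u" "u \<le> (of_int i + 1) / 2 ^ k"
        "of_int j / 2 ^ k \<le> v" "v \<le> (of_int j + 1) / 2 ^ k" for i j :: int and u v :: real
    proof -
      have "i + 2 \<le> j \<or> j + 2 \<le> i" using that(1,2) by presburger
      then have "real_of_int i + 2 \<le> j \<or> real_of_int j + 2 \<le> i" by linarith
      then have "1 \<le> \<bar>u * 2 ^ k - v * 2 ^ k\<bar>" using that(3-6) by (simp add: field_simps) linarith
      also have "\<dots> = \<bar>u - v\<bar> * 2 ^ k" by (simp add: abs_mult flip: left_diff_distrib)
      finally show ?thesis by (simp add: field_simps)
    qed
    have sep: "1 / 2 ^ k \<le> d (\<tau> p) (\<tau> q)" if "p \<in> P" "q \<in> P" "p \<noteq> q" for p q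
    proof -
      have "fst p \<noteq> fst q \<or> snd p \<noteq> snd q" using that by (simp add: prod_eq_iff)
      then show ?thesis
        using gap[of "fst p" "fst q" "a (\<tau> p)" "a (\<tau> q)"] gap[of "snd p" "snd q" "b (\<tau> p)" "b (\<tau> q)"]
          \<tau>(2)[OF that(1)] \<tau>(2)[OF that(2)] P(3)[OF that(1)] P(3)[OF that(2)]
        by (auto simp: d_def cell_def le_max_iff_disj)
    qed
    have "d s s = 0" for s by (simp add: d_def)
    then have "inj_on \<tau> P" using sep by (intro inj_onI) (metis divide_le_0_1_iff zero_less_numeral zero_less_power not_less)
    define ts where "ts = sorted_list_of_set (\<tau> ` P)"
    have ts: "sorted ts" "distinct ts" "set ts = \<tau> ` P" using P(2) by (simp_all add: ts_def)
    have "length ts = card P" using \<open>inj_on \<tau> P\<close> P(2) by (simp add: ts_def card_image)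
    moreover have "(real (length ts) - 1) * (1 / 2 ^ k) \<le> L"
    proof (rule sorted_list_chain_bound[where d=d])
      show "(\<Sum>i<n. d (t i) (t (Suc i))) \<le> L" if "t 0 = 0" "t n = 1" "\<forall>i<n. t i \<le> t (Suc i)" for n t
        using len[OF that] by (simp add: d_def)
      show "1 / 2 ^ k \<le> d s t" if "s \<in> set ts" "t \<in> set ts" "s \<noteq> t" for s t
        using that sep unfolding ts(3) by blast
      show "0 \<le> d s t" for s t by (auto simp: d_def le_max_iff_disj)
      show "set ts \<subseteq> {0..1}" unfolding ts(3) by (rule image_subsetI) (rule \<tau>(1))
    qed (use ts in auto)
    ultimately show ?thesis by (simp add: field_simps)
  qed
  have bound: "card P \<le> nat \<lfloor>4 * (L * 2 ^ k + 1)\<rfloor>" if P: "P \<subseteq> C k" "finite P" for P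
  proof -
    define Q where "Q x y = {p\<in>P. fst p mod 2 = x \<and> snd p mod 2 = y}" for x y :: int
    have "P = Q 0 0 \<union> Q 0 1 \<union> Q 1 0 \<union> Q 1 1" by (auto simp: Q_def)
    then have "card P = card (Q 0 0 \<union> Q 0 1 \<union> Q 1 0 \<union> Q 1 1)" by (rule arg_cong)
    then have "card P \<le> card (Q 0 0) + card (Q 0 1) + card (Q 1 0) + card (Q 1 1)"
      using card_Un_le[of "Q 0 0 \<union> Q 0 1 \<union> Q 1 0" "Q 1 1"] card_Un_le[of "Q 0 0 \<union> Q 0 1" "Q 1 0"]
        card_Un_le[of "Q 0 0" "Q 0 1"] by linarith
    then have "real (card P) \<le> real (card (Q 0 0)) + real (card (Q 0 1)) + real (card (Q 1 0)) + real (card (Q 1 1))"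
      by linarith
    moreover have card_Q: "real (card (Q x y)) \<le> L * 2 ^ k + 1" for x y
      by (rule parity[of _ x y]) (use P in \<open>auto simp: Q_def\<close>)
    have "real (card (Q 0 0)) + real (card (Q 0 1)) + real (card (Q 1 0)) + real (card (Q 1 1))
        \<le> (L * 2 ^ k + 1) + (L * 2 ^ k + 1) + (L * 2 ^ k + 1) + (L * 2 ^ k + 1)"
      by (intro add_mono card_Q)
    ultimately have "real (card P) \<le> 4 * (L * 2 ^ k + 1)" by simp
    then show ?thesis by (rule le_nat_floor)
  qed
  have "finite (C k) \<and> card (C k) \<le> nat \<lfloor>4 * (L * 2 ^ k + 1)\<rfloor>"
    by (rule finite_if_finite_subsets_card_bdd) (rule bound)
  moreover have "real (nat \<lfloor>4 * (L * 2 ^ k + 1)\<rfloor>) \<le> 4 * (L * 2 ^ k + 1)"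
    using \<open>0 \<le> L\<close> by (intro of_nat_floor) simp
  ultimately show ?thesis by linarith
qed

section \<open>Active squares contain joint approximate eigenvalues\<close>

context dyadic_family
begin

text \<open>Adjoint form of \<open>E_add_E\<close>: the projections are selfadjoint, so the ancestor
  rule survives exchanging the factors.\<close>

lemma E_E_coarse:
  assumes "k \<le> l"
  shows "E k p (E l q x) = E l q x \<or> E k p (E l q x) = 0"
proof -
  have *: "inner (E k p (E l q x)) y = inner x (E l q (E k p y))" for y
    by (simp only: adjD[OF selfadj_E])
  have E: "E l q (E k p y) = (if (parent ^^ (l - k)) q = p then E l q y else 0)" for y
    using E_add_E[of k "l - k" q p y] assms by simp
  show ?thesis
  proof (cases "(parent ^^ (l - k)) q = p")
    case True
    then have "inner (E k p (E l q x)) y = inner (E l q x) y" for y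
      using *[of y] E[of y] by (simp add: adjD[OF selfadj_E, symmetric])
    then have "E k p (E l q x) = E l q x" using vector_eq_rdot by blast
    then show ?thesis ..
  next
    case False
    then have "inner (E k p (E l q x)) y = 0" for y using *[of y] E[of y] by simp
    then have "E k p (E l q x) = 0" using inner_eq_zero_iff by blast
    then show ?thesis ..
  qed
qed

lemma active_child: "p \<in> active k \<Longrightarrow> \<exists>q\<in>children p. q \<in> active (Suc k)"
proof (rule ccontr)
  assume "p \<in> active k" and *: "\<not> (\<exists>q\<in>children p. q \<in> active (Suc k))"
  then obtain x where "E k p x \<noteq> 0" by (auto simp: active_def)
  moreover have "E k p x = (\<Sum>q\<in>children p. E (Suc k) q x)" by (rule E_children)
  moreover have "(\<Sum>q\<in>children p. E (Suc k) q x) = 0"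
    using * by (intro sum.neutral) (auto simp: active_def)
  ultimately show False by simp
qed

text \<open>An active box always has an active child, so a chain of nested active cells starts at
  \<open>p\<close>; \<open>z\<close> is a common point of the chain.\<close>

lemma active_cell_limit:
  assumes "p \<in> active k"
  obtains z where "z \<in> cell k p" "\<And>n. \<exists>q\<in>active (k + n). z \<in> cell (k + n) q"
proof -
  have "\<exists>f. \<forall>n. f n \<in> active (k + n) \<and> (n = 0 \<longrightarrow> f n = p) \<and> f (Suc n) \<in> children (f n)"
  proof -
    have "\<exists>f. \<forall>n. (f n \<in> active (k + n) \<and> (n = 0 \<longrightarrow> f n = p)) \<and> f (Suc n) \<in> children (f n)"
    proof (rule dependent_nat_choice)
      show "\<exists>q. q \<in> active (k + 0) \<and> (0 = (0::nat) \<longrightarrow> q = p)" using assms by (intro exI[of _ p]) simp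
      show "\<exists>r. (r \<in> active (k + Suc n) \<and> (Suc n = 0 \<longrightarrow> r = p)) \<and> r \<in> children q"
        if "q \<in> active (k + n) \<and> (n = 0 \<longrightarrow> q = p)" for q n
        using active_child[of q "k + n"] that by auto
    qed
    then show ?thesis by blast
  qed
  then obtain f where f: "\<And>n. f n \<in> active (k + n)" "f 0 = p" "\<And>n. f (Suc n) \<in> children (f n)"
    by blast
  have "(\<Inter>n. cell (k + n) (f n)) \<noteq> {}"
  proof (rule compact_nest)
    show "compact (cell (k + n) (f n))" for n unfolding cell_def by (intro compact_Times compact_Icc)
    show "cell (k + n) (f n) \<noteq> {}" for n by (auto simp: cell_def divide_right_mono)
    show "cell (k + n) (f n) \<subseteq> cell (k + j) (f j)" if "j \<le> n" for j n
      using that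
    proof (induction n rule: dec_induct)
      case (step n)
      then show ?case using cell_children[OF f(3)[of n], of "k + n"] by auto
    qed simp
  qed
  then obtain z where z: "\<And>n. z \<in> cell (k + n) (f n)" by blast
  show thesis
  proof (rule that[of z])
    show "z \<in> cell k p" using z[of 0] f(2) by simp
    show "\<exists>q\<in>active (k + n). z \<in> cell (k + n) q" for n using z f(1) by blast
  qed
qed

lemma approximate_eigenvector:
  fixes A B :: "'a \<Rightarrow>\<^sub>L 'a"
  assumes near: "\<And>k p x. E k p x = x \<Longrightarrow> norm (A x - (real_of_int (fst p) / 2 ^ k) *\<^sub>R x) \<le> norm x / 2 ^ k"
      "\<And>k p x. E k p x = x \<Longrightarrow> norm (B x - (real_of_int (snd p) / 2 ^ k) *\<^sub>R x) \<le> norm x / 2 ^ k"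
    and z: "\<And>n. \<exists>q\<in>active (k + n). z \<in> cell (k + n) q" and "e > 0"
  obtains x where "x \<noteq> 0" "norm (A x - fst z *\<^sub>R x) \<le> e * norm x" "norm (B x - snd z *\<^sub>R x) \<le> e * norm x"
proof -
  \<comment> \<open>Two errors of size \<open>2^-(k + n)\<close> add up: from the operator to the
    corner of the square, and from the corner to \<open>z\<close>.\<close>
  obtain n :: nat where n: "(1/2) ^ n < e / 2"
    using real_arch_pow_inv[of "e / 2" "1/2"] \<open>e > 0\<close> by auto
  obtain q where q: "q \<in> active (k + n)" "z \<in> cell (k + n) q" using z by blast
  then obtain y where "E (k + n) q y \<noteq> 0" by (auto simp: active_def)
  define x where "x = E (k + n) q y"
  have x: "x \<noteq> 0" "E (k + n) q x = x" using \<open>E (k + n) q y \<noteq> 0\<close> by (simp_all add: x_def E_E)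
  have small: "2 * (norm x / 2 ^ (k + n)) \<le> e * norm x"
  proof -
    have "(1/2::real) ^ (k + n) \<le> (1/2) ^ n" by (rule power_decreasing) auto
    then have "2 * (1/2) ^ (k + n) \<le> e" using n by linarith
    then have "2 * (1/2) ^ (k + n) * norm x \<le> e * norm x" by (rule mult_right_mono) simp
    then show ?thesis by (simp add: power_one_over)
  qed
  have aux: "norm (v - t *\<^sub>R x) \<le> e * norm x"
    if v: "norm (v - (of_int i / 2 ^ (k + n)) *\<^sub>R x) \<le> norm x / 2 ^ (k + n)"
      and t: "of_int i / 2 ^ (k + n) \<le> t" "t \<le> (of_int i + 1) / 2 ^ (k + n)" for v t and i :: int
  proof -
    have "v - t *\<^sub>R x = (v - (of_int i / 2 ^ (k + n)) *\<^sub>R x) - (t - of_int i / 2 ^ (k + n)) *\<^sub>R x"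
      by (simp add: scaleR_diff_left)
    then have "norm (v - t *\<^sub>R x) \<le> norm x / 2 ^ (k + n) + \<bar>t - of_int i / 2 ^ (k + n)\<bar> * norm x"
      using norm_triangle_ineq4[of "v - (of_int i / 2 ^ (k + n)) *\<^sub>R x" "(t - of_int i / 2 ^ (k + n)) *\<^sub>R x"] v
      unfolding norm_scaleR by (simp only:)
    moreover have "\<bar>t - of_int i / 2 ^ (k + n)\<bar> \<le> 1 / 2 ^ (k + n)"
      using t by (simp add: add_divide_distrib)
    then have "\<bar>t - of_int i / 2 ^ (k + n)\<bar> * norm x \<le> 1 / 2 ^ (k + n) * norm x" by (rule mult_right_mono) simp
    ultimately show ?thesis using small by simp
  qed
  show thesis
  proof (rule that[OF x(1)])
    show "norm (A x - fst z *\<^sub>R x) \<le> e * norm x"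
      using near(1)[OF x(2)] q(2) by (intro aux[where i="fst q"]) (auto simp: cell_def mem_Times_iff)
    show "norm (B x - snd z *\<^sub>R x) \<le> e * norm x"
      using near(2)[OF x(2)] q(2) by (intro aux[where i="snd q"]) (auto simp: cell_def mem_Times_iff)
  qed
qed

text \<open>The error in box \<open>p\<close> is at most \<open>norm (E l p w) / 2^l\<close>, and
  errors in different boxes are orthogonal, so by Pythagoras the number of boxes costs
  nothing.\<close>

lemma approximation_in_span:
  fixes B :: "'a \<Rightarrow>\<^sub>L 'a"
  assumes near: "\<And>k p x. E k p x = x \<Longrightarrow> norm (B x - (real_of_int (snd p) / 2 ^ k) *\<^sub>R x) \<le> norm x / 2 ^ k"
    and comm: "\<And>k p x. E k p (B x) = B (E k p x)"
  shows "norm (B w - (\<Sum>p\<in>active l. (real_of_int (snd p) / 2 ^ l) *\<^sub>R E l p w)) \<le> norm w / 2 ^ l"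
proof -
  define g where "g p = B (E l p w) - (real_of_int (snd p) / 2 ^ l) *\<^sub>R E l p w" for p
  have Eg: "E l p (g p) = g p" for p
    by (simp add: g_def blinfun.bilinear_simps comm E_E)
  have Ew: "E l p (E l p w) = E l p w" for p
    by (simp add: E_E)
  have orth: "inner v v' = 0" if "E l p v = v" "E l q v' = v'" "p \<noteq> q" for v v' p q
  proof -
    have "inner v v' = inner (E l p v) (E l q v')" using that by simp
    also have "\<dots> = inner v (E l p (E l q v'))" by (rule adjD[OF selfadj_E])
    also have "\<dots> = 0" using \<open>p \<noteq> q\<close> by (simp only: E_E) (simp add: inner_zero_right)
    finally show ?thesis .
  qed
  have "B w = (\<Sum>p\<in>active l. B (E l p w))"
    by (simp only: blinfun.sum_right[symmetric] sum_active)
  then have "B w - (\<Sum>p\<in>active l. (real_of_int (snd p) / 2 ^ l) *\<^sub>R E l p w) = (\<Sum>p\<in>active l. g p)"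
    by (simp add: g_def sum_subtractf)
  moreover have "(norm (\<Sum>p\<in>active l. g p))\<^sup>2 = (\<Sum>p\<in>active l. (norm (g p))\<^sup>2)"
    using orth[OF Eg Eg] by (intro norm_sum_Pythagorean finite_active) (auto simp: pairwise_def orthogonal_def)
  moreover have "\<dots> \<le> (\<Sum>p\<in>active l. (norm (E l p w) / 2 ^ l)\<^sup>2)"
    unfolding g_def by (intro sum_mono power_mono near norm_ge_zero) (simp add: E_E)
  moreover have "\<dots> = (\<Sum>p\<in>active l. (norm (E l p w))\<^sup>2) / (2 ^ l)\<^sup>2"
    by (simp add: power_divide sum_divide_distrib)
  moreover have "(norm (\<Sum>p\<in>active l. E l p w))\<^sup>2 = (\<Sum>p\<in>active l. (norm (E l p w))\<^sup>2)"
    using orth[OF Ew Ew] by (intro norm_sum_Pythagorean finite_active) (auto simp: pairwise_def orthogonal_def)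
  ultimately have "(norm (B w - (\<Sum>p\<in>active l. (real_of_int (snd p) / 2 ^ l) *\<^sub>R E l p w)))\<^sup>2 \<le> (norm w / 2 ^ l)\<^sup>2"
    by (simp add: sum_active power_divide)
  then show ?thesis by (rule power2_le_imp_le) simp
qed

end

section \<open>Decomposition into cyclic subspaces\<close>

lemma hmul_add_left: "hmul (x + y) q = hmul x q + hmul y q"
  and hmul_diff_left: "hmul (x - y) q = hmul x q - hmul y q"
  and hmul_minus_left: "hmul (- x) q = - hmul x q"
  and hmul_scaleR_left: "hmul (c *\<^sub>R x) q = c *\<^sub>R hmul x q"
  and hmul_zero_left: "hmul 0 q = 0"
  by (simp_all only: rmul_apply[symmetric] blinfun.bilinear_simps)

definition hbasis :: "nat \<Rightarrow> qell2" where
  "hbasis n = Hq (std_basis n)"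

lemma std_basis_l2: "std_basis n \<in> l2"
  unfolding l2_def mem_Collect_eq
  by (rule summable_finite[of "{n}"]) (auto simp: std_basis_def)

lemma seq_hbasis: "seq (hbasis n) = std_basis n"
  unfolding hbasis_def by (rule Hq_inverse[OF std_basis_l2])

lemma hinner_hbasis: "hinner v (hbasis n) = qcnj (seq v n)"
proof -
  have "linner (seq v) (std_basis n) = (\<Sum>i\<in>{n}. qmul (qcnj (seq v i)) (std_basis n i))"
    unfolding linner_def by (rule suminf_finite) (auto simp: std_basis_def qmul_zero)
  then show ?thesis by (simp add: hinner_def seq_hbasis std_basis_def qmul_qreal_right)
qed

lemma norm_hbasis: "norm (hbasis n) = 1"
proof -
  have "(norm (hbasis n))\<^sup>2 = (\<Sum>i\<in>{n}. (norm (seq (hbasis n) i))\<^sup>2)"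
    using norm_qell2_sums[of "hbasis n"] by (rule sums_unique2) (rule sums_finite; simp add: seq_hbasis std_basis_def)
  then have "(norm (hbasis n))\<^sup>2 = 1\<^sup>2" by (simp add: seq_hbasis std_basis_def)
  then show ?thesis by (rule power2_eq_imp_eq) auto
qed

lemma finite_quat_orthonormal_coordinate:
  assumes "quat_orthonormal \<Phi>" "finite F" "F \<subseteq> \<Phi>"
  shows "(\<Sum>v\<in>F. (norm (seq v n))\<^sup>2) \<le> 1"
  using bessel_inequality[OF assms, of "hbasis n"] by (simp add: hinner_hbasis norm_hbasis)

text \<open>Every unit vector has a nonzero coordinate, and by Bessel for \<open>hbasis n\<close> at
  most \<open>j + 1\<close> members have an \<open>n\<close>-th coordinate of squared norm at least
  \<open>1 / (j + 1)\<close>.\<close>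

lemma countable_quat_orthonormal:
  assumes "quat_orthonormal \<Phi>"
  shows "countable \<Phi>"
proof -
  define G where "G n j = {v\<in>\<Phi>. 1 \<le> real (Suc j) * (norm (seq v n))\<^sup>2}" for n j
  have "finite (G n j)" for n j
  proof -
    have "card P \<le> Suc j" if P: "P \<subseteq> G n j" "finite P" for P
    proof -
      have "real (card P) = (\<Sum>v\<in>P. 1)" by simp
      also have "\<dots> \<le> (\<Sum>v\<in>P. real (Suc j) * (norm (seq v n))\<^sup>2)"
        using P(1) by (intro sum_mono) (auto simp: G_def)
      also have "\<dots> = real (Suc j) * (\<Sum>v\<in>P. (norm (seq v n))\<^sup>2)" by (simp only: sum_distrib_left)
      also have "\<dots> \<le> real (Suc j) * 1"
        using P by (intro mult_left_mono finite_quat_orthonormal_coordinate[OF assms]) (auto simp: G_def)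
      finally show ?thesis by (simp only: mult_1_right of_nat_le_iff)
    qed
    then show ?thesis using finite_if_finite_subsets_card_bdd by blast
  qed
  moreover have "\<Phi> \<subseteq> (\<Union>n. \<Union>j. G n j)"
  proof
    fix v assume "v \<in> \<Phi>"
    then have "norm v = 1" using assms by (simp add: quat_orthonormal_def)
    then have "v \<noteq> 0" by auto
    then obtain n where "seq v n \<noteq> seq 0 n" using qell2_eqI by blast
    then have pos: "0 < (norm (seq v n))\<^sup>2" by simp
    obtain j :: nat where "1 / (norm (seq v n))\<^sup>2 < real j" using reals_Archimedean2 by blast
    then have "1 / (norm (seq v n))\<^sup>2 \<le> real (Suc j)" by simp
    then have "1 \<le> real (Suc j) * (norm (seq v n))\<^sup>2" using pos by (simp only: pos_divide_le_eq)
    then show "v \<in> (\<Union>n. \<Union>j. G n j)" using \<open>v \<in> \<Phi>\<close> by (auto simp: G_def simp del: of_nat_Suc)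
  qed
  ultimately show ?thesis
    by (meson countable_UN countable_finite countable_subset uncountable_def countableI_type)
qed

text \<open>\<open>A + S\<close> is the normal operator, with \<open>A\<close> selfadjoint, \<open>S\<close> skew, and \<open>B\<close> a square root of \<open>- S\<^sup>2\<close>;
  \<open>E\<close> is the joint spectral resolution of \<open>A\<close> and \<open>B\<close> over dyadic squares.\<close>

locale quat_dyadic_family = dyadic_family E
  for E :: "nat \<Rightarrow> int \<times> int \<Rightarrow> qell2 \<Rightarrow>\<^sub>L qell2" +
  fixes A S B :: "qell2 \<Rightarrow>\<^sub>L qell2" and m :: quat and M :: real
  assumes E_hmul: "E k p (hmul x q) = hmul (E k p x) q"
    and E_S: "E k p (S x) = S (E k p x)"
    and E_B: "E k p (B x) = B (E k p x)"
    and S_hmul: "S (hmul x q) = hmul (S x) q"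
    and B_hmul: "B (hmul x q) = hmul (B x) q"
    and S_skew: "inner (S x) y = - inner x (S y)"
    and selfadj_B: "inner (B x) y = inner x (B y)"
    and S_S: "S (S x) = - B (B x)"
    and S_B: "S (B x) = B (S x)"
    and A_near: "E k p x = x \<Longrightarrow> norm (A x - (real_of_int (fst p) / 2 ^ k) *\<^sub>R x) \<le> norm x / 2 ^ k"
    and B_near: "E k p x = x \<Longrightarrow> norm (B x - (real_of_int (snd p) / 2 ^ k) *\<^sub>R x) \<le> norm x / 2 ^ k"
    and m: "m \<in> Sph"
    and card_active: "real (card (active k)) \<le> M * 2 ^ k"
begin

lemma m_square: "qmul m m = - qreal 1"
proof -
  have "qcnj m = - m" "norm m = 1" using m by (auto simp: Sph_def)
  then have "- qmul m m = qreal 1" using qmul_qcnj(1)[of m] by (simp add: qmul_minus_right)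
  then show ?thesis by (metis minus_minus)
qed

text \<open>Vectors on which \<open>S\<close> acts as \<open>B\<close> followed by right multiplication with a fixed imaginary unit
  \<open>\<sigma> m\<close>; on their cyclic subspaces the operator is a complex normal operator.\<close>

definition aligned :: "real \<Rightarrow> qell2 \<Rightarrow> bool" where
  "aligned \<sigma> x \<longleftrightarrow> S x = \<sigma> *\<^sub>R hmul (B x) m"

definition good :: "qell2 \<Rightarrow> bool" where
  "good x \<longleftrightarrow> aligned 1 x \<or> aligned (- 1) x"

text \<open>A real span, not a right submodule: \<open>aligned\<close> is only a real linear
  condition, because \<open>m\<close> does not commute with all quaternions.\<close>

definition cyc :: "qell2 \<Rightarrow> qell2 set" where
  "cyc x = span (\<Union>k. boxes x k)"

text \<open>Orthogonality of the right submodules generated by the spectral pieces of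
  \<open>x\<close> and of \<open>y\<close>. Projecting one side suffices, since the projections are
  selfadjoint and any two boxes are nested or disjoint.\<close>

definition separated :: "qell2 \<Rightarrow> qell2 \<Rightarrow> bool" where
  "separated x y \<longleftrightarrow> (\<forall>k p q. inner (hmul x q) (E k p y) = 0)"

lemma separatedD: "separated x y \<Longrightarrow> inner (hmul x q) (E k p y) = 0"
  unfolding separated_def by blast

lemma inner_hmul_E: "inner (hmul (E k p x) q) y = inner (hmul x q) (E k p y)"
  by (simp only: E_hmul[symmetric] adjD[OF selfadj_E])

lemma separated_sym: "separated x y \<Longrightarrow> separated y x"
  unfolding separated_def
proof (intro allI)
  fix k p q
  assume *: "\<forall>k p q. inner (hmul x q) (E k p y) = 0"
  have "inner (hmul y q) (E k p x) = inner (hmul (E k p y) q) x"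
    by (simp only: inner_hmul_E)
  also have "\<dots> = inner (hmul x (qcnj q)) (E k p y)"
    by (subst inner_hmul) (rule inner_commute)
  also have "\<dots> = 0" using * by blast
  finally show "inner (hmul y q) (E k p x) = 0" .
qed

lemma separated_self: "separated x x \<Longrightarrow> x = 0"
proof -
  assume x: "separated x x"
  have "inner x x = inner (hmul x (qreal 1)) (\<Sum>p\<in>active 0. E 0 p x)"
    by (simp only: hmul_qreal sum_active scaleR_one)
  also have "\<dots> = 0" using x by (simp add: inner_sum_right separatedD)
  finally show "x = 0" by simp
qed

lemma E_E_cases:
  obtains "E k p (E l r x) = E k p x" | "E k p (E l r x) = E l r x" | "E k p (E l r x) = 0"
  using E_E_refine[of l k p r x] E_E_coarse[of k l p r x] by (cases k l rule: linorder_le_cases) blast+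

lemma cyc_orthogonal:
  assumes "separated x y" "v \<in> cyc x" "w \<in> cyc y"
  shows "hinner v w = 0"
proof -
  have 1: "inner (hmul v q) (E l r y) = 0" if "v \<in> cyc x" for v q l r
  proof -
    have "subspace {v. inner (hmul v q) (E l r y) = 0}"
      by (auto simp: subspace_def hmul_add_left hmul_scaleR_left hmul_zero_left inner_add_left)
    moreover have "(\<Union>k. boxes x k) \<subseteq> {v. inner (hmul v q) (E l r y) = 0}"
    proof (clarsimp simp: boxes_def)
      fix k a b
      show "inner (hmul (E k (a, b) x) q) (E l r y) = 0"
        unfolding inner_hmul_E
        by (rule E_E_cases[of k "(a, b)" l r y]) (use assms(1) in \<open>simp_all add: separatedD\<close>)
    qed
    ultimately show ?thesis using span_minimal that unfolding cyc_def by blast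
  qed
  have "inner (hmul v q) w = 0" for q
  proof -
    have "inner w (hmul v q) = 0"
    proof (rule span_orthogonal_zero)
      show "w \<in> span (\<Union>k. boxes y k)" using assms(3) by (simp add: cyc_def)
      show "inner s (hmul v q) = 0" if "s \<in> (\<Union>k. boxes y k)" for s
      proof -
        obtain k r where "s = E k r y" using \<open>s \<in> _\<close> by (auto simp: boxes_def)
        then show ?thesis using 1[OF assms(2), of q k r] by (simp only: inner_commute)
      qed
    qed
    then show ?thesis by (simp only: inner_commute)
  qed
  then show ?thesis by (simp add: hinner_eq_zero_iff)
qed

text \<open>With \<open>y = E k p x\<close>, the inner product of \<open>x q\<close> and
  \<open>E k p x\<close> equals that of \<open>y q\<close> and \<open>y\<close>, which sees only the
  real part of \<open>q\<close>. Hence \<open>hinner\<close> is real on \<open>cyc x\<close>, and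
  real orthogonality there is quaternionic orthogonality.\<close>

lemma inner_hmul_cyc:
  assumes "v \<in> cyc x" "w \<in> cyc x"
  shows "inner (hmul v q) w = Re (fst q) * inner v w"
proof -
  have box: "inner (hmul x q) (E k p x) = Re (fst q) * inner x (E k p x)" for k p
  proof -
    have EE: "E k p (E k p x) = E k p x" by (simp add: E_E)
    have "inner (hmul x q) (E k p x) = inner (hmul (E k p x) q) (E k p x)"
      by (simp only: inner_hmul_E EE)
    moreover have "inner x (E k p x) = inner (E k p x) (E k p x)"
      by (simp only: adjD[OF selfadj_E] EE)
    ultimately show ?thesis by (simp add: inner_hmul_self power2_norm_eq_inner)
  qed
  have 1: "inner (hmul v q) (E l r x) = Re (fst q) * inner v (E l r x)" if "v \<in> cyc x" for v l r
  proof -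
    have "subspace {v. inner (hmul v q) (E l r x) = Re (fst q) * inner v (E l r x)}"
      by (auto simp: subspace_def hmul_add_left hmul_scaleR_left hmul_zero_left inner_add_left distrib_left)
    moreover have "(\<Union>k. boxes x k) \<subseteq> {v. inner (hmul v q) (E l r x) = Re (fst q) * inner v (E l r x)}"
    proof (clarsimp simp: boxes_def)
      fix k a b
      show "inner (hmul (E k (a, b) x) q) (E l r x) = Re (fst q) * inner (E k (a, b) x) (E l r x)"
        unfolding inner_hmul_E adjD[OF selfadj_E]
        by (rule E_E_cases[of k "(a, b)" l r x]) (simp_all add: box)
    qed
    ultimately show ?thesis using span_minimal that unfolding cyc_def by blast
  qed
  have "subspace {w. inner (hmul v q) w = Re (fst q) * inner v w}"
    by (auto simp: subspace_def inner_add_right distrib_left)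
  moreover have "(\<Union>k. boxes x k) \<subseteq> {w. inner (hmul v q) w = Re (fst q) * inner v w}"
    using 1[OF assms(1)] by (auto simp: boxes_def)
  ultimately show ?thesis using span_minimal assms(2) unfolding cyc_def by blast
qed

lemma aligned_cyc:
  assumes "aligned \<sigma> x" "v \<in> cyc x"
  shows "aligned \<sigma> v"
proof -
  have "subspace {v. aligned \<sigma> v}"
    by (auto simp: subspace_def aligned_def blinfun.bilinear_simps hmul_add_left hmul_scaleR_left
        hmul_zero_left scaleR_add_right)
  moreover have "(\<Union>k. boxes x k) \<subseteq> {v. aligned \<sigma> v}"
  proof (clarsimp simp: boxes_def)
    fix k a b
    show "aligned \<sigma> (E k (a, b) x)"
      using assms(1) unfolding aligned_def E_S[symmetric] E_B[symmetric]
      by (simp add: blinfun.bilinear_simps E_hmul)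
  qed
  ultimately show ?thesis using span_minimal assms(2) unfolding cyc_def by blast
qed

text \<open>The approximate eigenvalue is \<open>a + \<sigma> b m\<close> with \<open>(a, b)\<close>
  the corner of the box; \<open>A\<close> and \<open>B\<close> each contribute an error of at most
  \<open>2^-k\<close>.\<close>

lemma aligned_error:
  assumes "aligned \<sigma> v" "\<bar>\<sigma>\<bar> = 1" "E k p v = v" "norm v = 1"
  shows "(norm (A v + S v - hmul v (qreal (of_int (fst p) / 2 ^ k) + (\<sigma> * of_int (snd p) / 2 ^ k) *\<^sub>R m)))\<^sup>2 \<le> 4 * (1/4) ^ k"
proof -
  define a where "a = real_of_int (fst p) / 2 ^ k"
  define b where "b = real_of_int (snd p) / 2 ^ k"
  have "norm m = 1" using m by (simp add: Sph_def)
  have eq: "A v + S v - hmul v (qreal a + (\<sigma> * b) *\<^sub>R m) = (A v - a *\<^sub>R v) + \<sigma> *\<^sub>R hmul (B v - b *\<^sub>R v) m"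
    using assms(1) by (simp add: aligned_def hmul_add hmul_qreal hmul_scaleR hmul_diff_left hmul_scaleR_left algebra_simps)
  have "norm (A v + S v - hmul v (qreal a + (\<sigma> * b) *\<^sub>R m)) \<le> norm (A v - a *\<^sub>R v) + norm (B v - b *\<^sub>R v)"
    unfolding eq using norm_triangle_ineq[of "A v - a *\<^sub>R v" "\<sigma> *\<^sub>R hmul (B v - b *\<^sub>R v) m"] assms(2) \<open>norm m = 1\<close>
    by (simp add: norm_hmul)
  also have "\<dots> \<le> 1 / 2 ^ k + 1 / 2 ^ k"
    using A_near[OF assms(3)] B_near[OF assms(3)] assms(4) by (intro add_mono) (simp_all add: a_def b_def)
  finally have "(norm (A v + S v - hmul v (qreal a + (\<sigma> * b) *\<^sub>R m)))\<^sup>2 \<le> (1 / 2 ^ k + 1 / 2 ^ k)\<^sup>2"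
    by (rule power_mono) simp
  also have "\<dots> = 4 * (1/4) ^ k"
    by (simp add: power2_eq_square power_one_over flip: power_mult_distrib)
  finally show ?thesis by (simp add: a_def b_def)
qed

text \<open>\<open>separated\<close> speaks of the projections only, but \<open>B w\<close> is a
  norm limit of combinations of the \<open>E l r w\<close>, so the orthogonality passes to
  it.\<close>

lemma separated_B:
  assumes "separated u x"
  shows "inner (hmul u q) (B (E k p x)) = 0"
proof -
  define w where "w = E k p x"
  have zero: "inner (hmul u q) (E l r w) = 0" for l r
    unfolding w_def by (rule E_E_cases[of l r k p x]) (use assms in \<open>simp_all add: separatedD\<close>)
  have "\<bar>inner (hmul u q) (B w)\<bar> \<le> norm (hmul u q) * norm w * (1/2) ^ l" for l
  proof -
    define s where "s = (\<Sum>r\<in>active l. (real_of_int (snd r) / 2 ^ l) *\<^sub>R E l r w)"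
    have "inner (hmul u q) s = 0" by (simp add: s_def inner_sum_right zero)
    then have "inner (hmul u q) (B w) = inner (hmul u q) (B w - s)" by (simp add: inner_diff_right)
    also have "\<bar>\<dots>\<bar> \<le> norm (hmul u q) * norm (B w - s)" by (rule Cauchy_Schwarz_ineq2)
    also have "\<dots> \<le> norm (hmul u q) * (norm w / 2 ^ l)"
      unfolding s_def by (intro mult_left_mono approximation_in_span B_near E_B norm_ge_zero)
    finally show ?thesis by (simp add: power_one_over)
  qed
  moreover have "(\<lambda>l. norm (hmul u q) * norm w * (1/2) ^ l) \<longlonglongrightarrow> norm (hmul u q) * norm w * 0"
    by (intro tendsto_mult tendsto_const LIMSEQ_realpow_zero) auto
  ultimately have "\<bar>inner (hmul u q) (B w)\<bar> \<le> 0"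
    by (intro LIMSEQ_le_const[of "\<lambda>l. norm (hmul u q) * norm w * (1/2) ^ l"]) auto
  then show ?thesis by (simp add: w_def)
qed

text \<open>If \<open>B u = 0\<close> then also \<open>S u = 0\<close> and \<open>u\<close> itself is good; otherwise one of \<open>B u \<mp> S u m\<close> works.\<close>

lemma separated_good:
  assumes "u \<noteq> 0" "\<And>x. x \<in> X \<Longrightarrow> separated u x" "\<And>x. x \<in> X \<Longrightarrow> good x"
  obtains y where "y \<noteq> 0" "good y" "\<And>x. x \<in> X \<Longrightarrow> separated y x"
proof (cases "B u = 0")
  case True
  have "inner (S u) (S u) = - inner u (S (S u))" by (rule S_skew)
  also have "\<dots> = 0" by (simp add: S_S True blinfun.bilinear_simps)
  finally have "S u = 0" by simp
  then have "good u" using True by (simp add: good_def aligned_def hmul_zero_left)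
  then show ?thesis using that assms by blast
next
  case False
  \<comment> \<open>Let \<open>J\<close> be right multiplication by \<open>m\<close>. Then
    \<open>S\<close> and \<open>B J\<close> commute and have the same square, so
    \<open>(S - \<tau> B J) (S + \<tau> B J) = 0\<close> for \<open>\<tau>\<close> equal to
    \<open>1\<close> or \<open>-1\<close>, and \<open>y \<tau>\<close> is
    \<open>S + \<tau> B J\<close> applied to \<open>- \<tau> u m\<close>.\<close>
  define y where "y \<tau> = B u - \<tau> *\<^sub>R hmul (S u) m" for \<tau> :: real
  have al: "aligned \<tau> (y \<tau>)" if "\<tau> * \<tau> = 1" for \<tau>
  proof -
    have "hmul (hmul (B (S u)) m) m = - B (S u)"
      by (simp add: hmul_hmul m_square hmul_minus hmul_qreal)
    then have "\<tau> *\<^sub>R hmul (B (y \<tau>)) m = \<tau> *\<^sub>R hmul (B (B u)) m + (\<tau> * \<tau>) *\<^sub>R B (S u)"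
      by (simp add: y_def blinfun.bilinear_simps B_hmul hmul_diff_left hmul_scaleR_left scaleR_diff_right scaleR_add_right)
    moreover have "S (y \<tau>) = B (S u) + \<tau> *\<^sub>R hmul (B (B u)) m"
      by (simp add: y_def blinfun.bilinear_simps S_B S_hmul S_S hmul_minus_left)
    ultimately show ?thesis by (simp add: aligned_def that)
  qed
  have sep: "separated (y \<tau>) x" if x: "x \<in> X" for \<tau> x
  proof -
    obtain \<sigma> where \<sigma>: "S x = \<sigma> *\<^sub>R hmul (B x) m" using assms(3)[OF x] unfolding good_def aligned_def by blast
    have "inner (hmul (y \<tau>) q) (E k p x) = 0" for k p q
    proof -
      have 1: "inner (hmul (B u) q) (E k p x) = 0"
      proof -
        have "inner (hmul (B u) q) (E k p x) = inner (hmul u q) (B (E k p x))"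
          by (simp only: B_hmul[symmetric] selfadj_B)
        then show ?thesis using separated_B[OF assms(2)[OF x]] by simp
      qed
      \<comment> \<open>\<open>S\<close> is moved to the other factor, where it acts as
        \<open>\<sigma> B\<close> followed by \<open>m\<close> because \<open>x\<close> is good;
        this reduces to \<open>separated_B\<close>.\<close>
      have 2: "inner (hmul (hmul (S u) m) q) (E k p x) = 0"
      proof -
        have "S (E k p x) = \<sigma> *\<^sub>R hmul (B (E k p x)) m"
          unfolding E_S[symmetric] E_B[symmetric] \<sigma> by (simp add: blinfun.bilinear_simps E_hmul)
        then have "inner (S (hmul u (qmul m q))) (E k p x) = - (\<sigma> * inner (hmul u (qmul m q)) (hmul (B (E k p x)) m))"
          unfolding S_skew by simp
        also have "inner (hmul u (qmul m q)) (hmul (B (E k p x)) m)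
            = inner (hmul u (qmul (qmul m q) (qcnj m))) (B (E k p x))"
          using inner_hmul[of "hmul u (qmul m q)" "qcnj m" "B (E k p x)"] by (simp add: hmul_hmul)
        also have "\<dots> = 0" by (rule separated_B[OF assms(2)[OF x]])
        finally show ?thesis by (simp add: S_hmul hmul_hmul)
      qed
      show ?thesis
        unfolding y_def hmul_diff_left hmul_scaleR_left inner_diff_left inner_scaleR_left 1 2 by simp
    qed
    then show ?thesis by (simp add: separated_def)
  qed
  have "y 1 + y (- 1) = 2 *\<^sub>R B u" by (simp add: y_def scaleR_2)
  then have "y 1 \<noteq> 0 \<or> y (- 1) \<noteq> 0" using False by auto
  moreover have "good (y 1)" "good (y (- 1))" using al[of 1] al[of "- 1"] by (simp_all add: good_def)
  ultimately show ?thesis using that sep by blast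
qed

text \<open>Zorn's lemma: by \<open>separated_good\<close>, a nonzero vector separated from a
  maximal family would produce a further member.\<close>

lemma maximal_separated_family:
  obtains X where "\<And>x. x \<in> X \<Longrightarrow> x \<noteq> 0" "\<And>x. x \<in> X \<Longrightarrow> good x"
    "\<And>x y. x \<in> X \<Longrightarrow> y \<in> X \<Longrightarrow> x \<noteq> y \<Longrightarrow> separated x y"
    "\<And>u. (\<And>x. x \<in> X \<Longrightarrow> separated u x) \<Longrightarrow> u = 0"
proof -
  define C where "C = {X. (\<forall>x\<in>X. x \<noteq> 0 \<and> good x) \<and> (\<forall>x\<in>X. \<forall>y\<in>X. x \<noteq> y \<longrightarrow> separated x y)}"
  have "\<exists>X\<in>C. \<forall>Y\<in>C. X \<subseteq> Y \<longrightarrow> Y = X"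
  proof (rule subset_Zorn')
    fix c assume "subset.chain C c"
    then have c: "c \<subseteq> C" "\<And>X Y. X \<in> c \<Longrightarrow> Y \<in> c \<Longrightarrow> X \<subseteq> Y \<or> Y \<subseteq> X"
      by (auto simp: subset_chain_def)
    show "\<Union>c \<in> C"
      unfolding C_def mem_Collect_eq
    proof (intro conjI ballI impI)
      fix x assume "x \<in> \<Union>c"
      then show "x \<noteq> 0" "good x" using c(1) unfolding C_def by blast+
    next
      fix x y assume "x \<in> \<Union>c" "y \<in> \<Union>c" "x \<noteq> y"
      then obtain X Y where "X \<in> c" "Y \<in> c" "x \<in> X" "y \<in> Y" by blast
      then obtain Z where "Z \<in> c" "x \<in> Z" "y \<in> Z" using c(2)[of X Y] by blast
      then show "separated x y" using c(1) \<open>x \<noteq> y\<close> unfolding C_def by blast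
    qed
  qed
  then obtain X where X: "X \<in> C" "\<And>Y. Y \<in> C \<Longrightarrow> X \<subseteq> Y \<Longrightarrow> Y = X" by blast
  show thesis
  proof (rule that[of X])
    show "x \<noteq> 0" "good x" if "x \<in> X" for x using X(1) that unfolding C_def by blast+
    show "separated x y" if "x \<in> X" "y \<in> X" "x \<noteq> y" for x y using X(1) that unfolding C_def by blast
    show "u = 0" if u: "\<And>x. x \<in> X \<Longrightarrow> separated u x" for u
    proof (rule ccontr)
      assume "u \<noteq> 0"
      then obtain y where y: "y \<noteq> 0" "good y" "\<And>x. x \<in> X \<Longrightarrow> separated y x"
        using separated_good[of u X] u X(1) unfolding C_def by blast
      then have "insert y X \<in> C"
        using X(1) separated_sym unfolding C_def by blast
      then have "y \<in> X" using X(2) by blast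
      then show False using y separated_self by blast
    qed
  qed
qed

text \<open>Normalised members form a quaternionic orthonormal set. Countability is what allows the
  total error to be distributed as a geometric series.\<close>

lemma countable_separated:
  assumes "\<And>x. x \<in> X \<Longrightarrow> x \<noteq> 0" "\<And>x y. x \<in> X \<Longrightarrow> y \<in> X \<Longrightarrow> x \<noteq> y \<Longrightarrow> separated x y"
  shows "countable X"
proof -
  define f where "f x = x /\<^sub>R norm x" for x :: qell2
  have self: "x \<in> cyc x" for x
  proof -
    have "(\<Sum>p\<in>active 0. E 0 p x) \<in> cyc x"
      unfolding cyc_def by (intro span_sum span_base) (auto simp: boxes_def)
    then show ?thesis by (simp only: sum_active)
  qed
  have orth: "hinner (f x) (f y) = 0" if "x \<in> X" "y \<in> X" "x \<noteq> y" for x y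
  proof (rule cyc_orthogonal)
    show "separated x y" using assms(2) that .
    show "f x \<in> cyc x" "f y \<in> cyc y"
      using self unfolding f_def cyc_def by (intro span_scale; blast)+
  qed
  have norm1: "norm (f x) = 1" if "x \<in> X" for x using assms(1)[OF that] by (simp add: f_def)
  have "inj_on f X"
  proof (rule inj_onI, rule ccontr)
    fix x y assume "x \<in> X" "y \<in> X" "f x = f y" "x \<noteq> y"
    then have "hinner (f x) (f x) = 0" using orth[of x y] by simp
    then show False using norm1[OF \<open>x \<in> X\<close>] by (simp add: hinner_self qreal_def zero_prod_def)
  qed
  have "quat_orthonormal (f ` X)"
    unfolding quat_orthonormal_def using orth norm1 by auto
  then have "countable (f ` X)" by (rule countable_quat_orthonormal)
  then show ?thesis using \<open>inj_on f X\<close> countable_image_inj_on by blast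
qed

end

section \<open>Approximate eigenbases and Hilbert--Schmidt perturbations\<close>

lemma sum_half_powers_le:
  assumes "finite I" "inj_on f I"
  shows "(\<Sum>i\<in>I. (1/2::real) ^ Suc (f i)) \<le> 1"
proof -
  have "(\<Sum>i\<in>I. (1/2::real) ^ Suc (f i)) = (\<Sum>n\<in>f ` I. (1/2) ^ Suc n)"
    by (simp only: sum.reindex[OF assms(2)] o_def)
  also have "\<dots> \<le> 1"
    using sum_le_suminf[OF sums_summable[OF power_half_series], of "f ` I"] assms(1)
      sums_unique[OF power_half_series] by simp
  finally show ?thesis .
qed

context quat_dyadic_family
begin

lemma good_family:
  assumes "good x" "\<epsilon> > 0"
  obtains \<Phi> :: "qell2 set" and err :: "qell2 \<Rightarrow> real" where
    "quat_orthonormal \<Phi>" "\<Phi> \<subseteq> cyc x" "\<And>k. boxes x k \<subseteq> span \<Phi>"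
    "\<And>v. v \<in> \<Phi> \<Longrightarrow> \<exists>q. (norm (A v + S v - hmul v q))\<^sup>2 \<le> err v"
    "\<And>F. finite F \<Longrightarrow> F \<subseteq> \<Phi> \<Longrightarrow> sum err F \<le> \<epsilon>"
proof -
  \<comment> \<open>A vector of level \<open>k\<close> costs \<open>4 (1/4)^k\<close> by
    \<open>aligned_error\<close>, so the Haar weights may use a quarter of the budget.\<close>
  have "\<epsilon> / 4 > 0" using assms by simp
  from card_active this obtain \<Phi> :: "qell2 set" and lev :: "qell2 \<Rightarrow> nat" where \<Phi>:
    "pairwise orthogonal \<Phi>" "\<And>v. v \<in> \<Phi> \<Longrightarrow> norm v = 1"
    "\<And>v. v \<in> \<Phi> \<Longrightarrow> v \<in> span (\<Union>k. boxes x k)" "\<And>k. boxes x k \<subseteq> span \<Phi>"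
    "\<And>v. v \<in> \<Phi> \<Longrightarrow> \<exists>p. E (lev v) p v = v"
    "\<And>F. finite F \<Longrightarrow> F \<subseteq> \<Phi> \<Longrightarrow> (\<Sum>v\<in>F. (1/4) ^ lev v) \<le> \<epsilon> / 4"
    by (erule haar_system)
  obtain \<sigma> :: real where \<sigma>: "aligned \<sigma> x" "\<bar>\<sigma>\<bar> = 1"
    using assms(1) unfolding good_def by force
  have cyc: "\<Phi> \<subseteq> cyc x" using \<Phi>(3) by (auto simp: cyc_def)
  show thesis
  proof (rule that[of \<Phi> "\<lambda>v. 4 * (1/4) ^ lev v"])
    have "hinner v w = 0" if "v \<in> \<Phi>" "w \<in> \<Phi>" "v \<noteq> w" for v w
    proof -
      have "inner v w = 0" using \<Phi>(1) that by (simp add: pairwise_def orthogonal_def)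
      then have "inner (hmul v q) w = 0" for q
        using inner_hmul_cyc[of v x w q] cyc that by auto
      then show ?thesis by (simp add: hinner_eq_zero_iff)
    qed
    then show "quat_orthonormal \<Phi>" using \<Phi>(2) unfolding quat_orthonormal_def by blast
    show "\<Phi> \<subseteq> cyc x" by (rule cyc)
    show "boxes x k \<subseteq> span \<Phi>" for k by (rule \<Phi>(4))
    show "\<exists>q. (norm (A v + S v - hmul v q))\<^sup>2 \<le> 4 * (1/4) ^ lev v" if "v \<in> \<Phi>" for v
    proof -
      obtain p where "E (lev v) p v = v" using \<Phi>(5) \<open>v \<in> \<Phi>\<close> by blast
      then show ?thesis
        using aligned_error[OF aligned_cyc[OF \<sigma>(1)] \<sigma>(2) _ \<Phi>(2)[OF \<open>v \<in> \<Phi>\<close>]] cyc \<open>v \<in> \<Phi>\<close> by blast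
    qed
    show "(\<Sum>v\<in>F. 4 * (1/4) ^ lev v) \<le> \<epsilon>" if "finite F" "F \<subseteq> \<Phi>" for F
      using \<Phi>(6)[OF that] by (simp add: sum_distrib_left[symmetric])
  qed
qed

theorem approximate_eigenbasis:
  assumes "\<epsilon> > 0"
  obtains \<Phi> :: "qell2 set" and \<mu> :: "qell2 \<Rightarrow> quat" where
    "quat_orthonormal \<Phi>" "\<And>u. (\<And>v. v \<in> \<Phi> \<Longrightarrow> hinner v u = 0) \<Longrightarrow> u = 0"
    "\<And>F. finite F \<Longrightarrow> F \<subseteq> \<Phi> \<Longrightarrow> (\<Sum>v\<in>F. (norm (A v + S v - hmul v (\<mu> v)))\<^sup>2) \<le> \<epsilon>"
proof -
  obtain X where X: "\<And>x. x \<in> X \<Longrightarrow> x \<noteq> 0" "\<And>x. x \<in> X \<Longrightarrow> good x"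
    "\<And>x y. x \<in> X \<Longrightarrow> y \<in> X \<Longrightarrow> x \<noteq> y \<Longrightarrow> separated x y"
    "\<And>u. (\<And>x. x \<in> X \<Longrightarrow> separated u x) \<Longrightarrow> u = 0"
    by (erule maximal_separated_family)
  have "countable X" using X(1,3) by (rule countable_separated)
  define w where "w x = \<epsilon> * (1/2) ^ Suc (to_nat_on X x)" for x
  have w0: "w x > 0" for x using assms by (simp add: w_def)
  define H where "H x \<Phi> err \<longleftrightarrow> quat_orthonormal \<Phi> \<and> \<Phi> \<subseteq> cyc x \<and> (\<forall>k. boxes x k \<subseteq> span \<Phi>) \<and>
    (\<forall>v\<in>\<Phi>. \<exists>q. (norm (A v + S v - hmul v q))\<^sup>2 \<le> err v) \<and>
    (\<forall>F. finite F \<longrightarrow> F \<subseteq> \<Phi> \<longrightarrow> sum err F \<le> w x)"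
    for x and \<Phi> :: "qell2 set" and err :: "qell2 \<Rightarrow> real"
  have "\<exists>P. H x (fst P) (snd P)" if "x \<in> X" for x
  proof -
    obtain \<Phi> :: "qell2 set" and err :: "qell2 \<Rightarrow> real" where
      "quat_orthonormal \<Phi>" "\<Phi> \<subseteq> cyc x" "\<And>k. boxes x k \<subseteq> span \<Phi>"
      "\<And>v. v \<in> \<Phi> \<Longrightarrow> \<exists>q. (norm (A v + S v - hmul v q))\<^sup>2 \<le> err v"
      "\<And>F. finite F \<Longrightarrow> F \<subseteq> \<Phi> \<Longrightarrow> sum err F \<le> w x"
      by (erule good_family[OF X(2)[OF \<open>x \<in> X\<close>] w0])
    then have "H x \<Phi> err" unfolding H_def by blast
    then show ?thesis by (intro exI[of _ "(\<Phi>, err)"]) simp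
  qed
  then have "\<exists>P. \<forall>x\<in>X. H x (fst (P x)) (snd (P x))" by (intro bchoice) blast
  then obtain P where P: "\<And>x. x \<in> X \<Longrightarrow> H x (fst (P x)) (snd (P x))" by blast
  define f where "f x = fst (P x)" for x
  define err where "err x = snd (P x)" for x
  have f: "quat_orthonormal (f x)" "f x \<subseteq> cyc x" "boxes x k \<subseteq> span (f x)"
    "v \<in> f x \<Longrightarrow> \<exists>q. (norm (A v + S v - hmul v q))\<^sup>2 \<le> err x v"
    "finite F \<Longrightarrow> F \<subseteq> f x \<Longrightarrow> sum (err x) F \<le> w x" if "x \<in> X" for x v k F
    using P[OF that] unfolding H_def f_def err_def by blast+
  define \<Phi> where "\<Phi> = (\<Union>x\<in>X. f x)"
  define owner where "owner v = (SOME x. x \<in> X \<and> v \<in> f x)" for v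
  have owner: "owner v \<in> X" "v \<in> f (owner v)" if "v \<in> \<Phi>" for v
  proof -
    have "\<exists>x. x \<in> X \<and> v \<in> f x" using that by (auto simp: \<Phi>_def)
    from someI_ex[OF this] show "owner v \<in> X" "v \<in> f (owner v)" unfolding owner_def by blast+
  qed
  have "\<exists>\<mu>. \<forall>v\<in>\<Phi>. (norm (A v + S v - hmul v (\<mu> v)))\<^sup>2 \<le> err (owner v) v"
    using f(4) owner by (intro bchoice) blast
  then obtain \<mu> where \<mu>: "\<And>v. v \<in> \<Phi> \<Longrightarrow> (norm (A v + S v - hmul v (\<mu> v)))\<^sup>2 \<le> err (owner v) v" by blast
  show thesis
  proof (rule that[of \<Phi> \<mu>])
    show "quat_orthonormal \<Phi>"
      unfolding quat_orthonormal_def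
    proof (intro conjI ballI impI)
      show "norm v = 1" if "v \<in> \<Phi>" for v
        using that f(1) unfolding \<Phi>_def quat_orthonormal_def by blast
      fix v v' assume "v \<in> \<Phi>" "v' \<in> \<Phi>" "v \<noteq> v'"
      then obtain x y where xy: "x \<in> X" "y \<in> X" "v \<in> f x" "v' \<in> f y" by (auto simp: \<Phi>_def)
      show "hinner v v' = 0"
      proof (cases "x = y")
        case True
        then show ?thesis using f(1)[OF xy(1)] xy \<open>v \<noteq> v'\<close> unfolding quat_orthonormal_def by blast
      next
        case False
        then show ?thesis
          using cyc_orthogonal[OF X(3)[OF xy(1,2)]] f(2)[OF xy(1)] f(2)[OF xy(2)] xy by blast
      qed
    qed
    \<comment> \<open>No closures are needed: each \<open>E k p x\<close> lies in the algebraic span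
      of \<open>f x\<close>, so orthogonality to \<open>f x\<close> already makes \<open>u\<close>
      separated from \<open>x\<close>.\<close>
    show "u = 0" if u: "\<And>v. v \<in> \<Phi> \<Longrightarrow> hinner v u = 0" for u
    proof (rule X(4))
      fix x assume x: "x \<in> X"
      have "inner (hmul x q) (E k p u) = 0" for k p q
      proof -
        have "E k p x \<in> span (f x)" using f(3)[OF x, of k] by (auto simp: boxes_def)
        then have "inner (E k p x) (hmul u (qcnj q)) = 0"
        proof (rule span_orthogonal_zero)
          show "inner s (hmul u (qcnj q)) = 0" if "s \<in> f x" for s
          proof -
            have "hinner s u = 0" using u x that by (auto simp: \<Phi>_def)
            then show ?thesis unfolding inner_hmul[symmetric] hinner_eq_zero_iff by blast
          qed
        qed
        then show ?thesis unfolding inner_hmul_E[symmetric] by (subst inner_hmul)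
      qed
      then have "separated x u" unfolding separated_def by blast
      then show "separated u x" by (rule separated_sym)
    qed
    show "(\<Sum>v\<in>F. (norm (A v + S v - hmul v (\<mu> v)))\<^sup>2) \<le> \<epsilon>" if F: "finite F" "F \<subseteq> \<Phi>" for F
    proof -
      have "(\<Sum>v\<in>F. (norm (A v + S v - hmul v (\<mu> v)))\<^sup>2) \<le> (\<Sum>v\<in>F. err (owner v) v)"
        using \<mu> F by (intro sum_mono) blast
      also have "\<dots> = (\<Sum>x\<in>owner ` F. \<Sum>v\<in>{v\<in>F. owner v = x}. err (owner v) v)"
        by (rule sum.image_gen[OF F(1)])
      also have "\<dots> = (\<Sum>x\<in>owner ` F. sum (err x) {v\<in>F. owner v = x})"
        by (intro sum.cong refl) auto
      also have "\<dots> \<le> (\<Sum>x\<in>owner ` F. w x)"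
      proof (rule sum_mono)
        fix x assume "x \<in> owner ` F"
        then have "x \<in> X" using owner F(2) by blast
        moreover have "{v\<in>F. owner v = x} \<subseteq> f x" using owner F(2) by blast
        ultimately show "sum (err x) {v\<in>F. owner v = x} \<le> w x" using F(1) by (intro f(5)) auto
      qed
      also have "\<dots> = \<epsilon> * (\<Sum>x\<in>owner ` F. (1/2) ^ Suc (to_nat_on X x))"
        by (simp only: w_def sum_distrib_left)
      also have "\<dots> \<le> \<epsilon> * 1"
      proof (intro mult_left_mono sum_half_powers_le)
        have "owner ` F \<subseteq> X" using owner F(2) by blast
        then show "inj_on (to_nat_on X) (owner ` F)"
          using inj_on_to_nat_on[OF \<open>countable X\<close>] inj_on_subset by blast
      qed (use F assms in auto)
      finally show ?thesis by simp
    qed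
  qed
qed

end

section \<open>Hilbert-Schmidt operators with prescribed values on an orthonormal family\<close>

lemma qcnj_sum: "qcnj (sum f I) = (\<Sum>i\<in>I. qcnj (f i))"
proof -
  have "qcnj (a + b) = qcnj a + qcnj b" "qcnj 0 = 0" for a b
    by (simp_all add: qcnj_def zero_prod_def)
  then show ?thesis
    by (induction I rule: infinite_finite_induct) simp_all
qed

lemma hinner_diff_right: "hinner x (y - z) = hinner x y - hinner x z"
  by (rule quat_inner_eqI) (simp add: inner_diff_right flip: inner_hmul_hinner)

lemma hinner_zero_right: "hinner x 0 = 0"
  using hinner_scaleR_right[of x 0 0] by simp

lemma hinner_sum_right: "hinner x (sum f I) = (\<Sum>i\<in>I. hinner x (f i))"
  by (induction I rule: infinite_finite_induct) (simp_all add: hinner_add_right hinner_zero_right)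

text \<open>\<open>orthonormal_basis\<close> is indexed by all naturals. If the family were finite,
  Parseval would make the squared \<open>n\<close>-th coordinates sum to one for every
  \<open>n\<close>; over \<open>card + 1\<close> coordinates this exceeds the total squared norm
  \<open>card\<close>.\<close>

lemma total_quat_orthonormal_infinite:
  assumes \<Phi>: "quat_orthonormal \<Phi>" and total: "\<And>u. (\<And>v. v \<in> \<Phi> \<Longrightarrow> hinner v u = 0) \<Longrightarrow> u = 0"
  shows "infinite \<Phi>"
proof
  assume fin: "finite \<Phi>"
  have one: "(\<Sum>v\<in>\<Phi>. (norm (seq v n))\<^sup>2) = 1" for n
  proof -
    define r where "r = hbasis n - (\<Sum>w\<in>\<Phi>. hmul w (hinner w (hbasis n)))"
    have "hinner v r = 0" if v: "v \<in> \<Phi>" for v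
    proof -
      have "(\<Sum>w\<in>\<Phi>. hinner v (hmul w (hinner w (hbasis n)))) = (\<Sum>w\<in>\<Phi>. if w = v then hinner v (hbasis n) else 0)"
        using \<Phi> v by (intro sum.cong)
          (auto simp: quat_orthonormal_def hinner_hmul_right hinner_self qmul_qreal_left qmul_zero)
      also have "\<dots> = hinner v (hbasis n)" using fin v by simp
      finally show ?thesis by (simp add: r_def hinner_diff_right hinner_sum_right)
    qed
    then have "r = 0" by (rule total)
    moreover have "(norm r)\<^sup>2 = (norm (hbasis n))\<^sup>2 - (\<Sum>v\<in>\<Phi>. (norm (hinner v (hbasis n)))\<^sup>2)"
      unfolding r_def by (rule bessel_identity[OF \<Phi> fin order_refl])
    ultimately show ?thesis by (simp add: hinner_hbasis norm_hbasis)
  qed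
  have "real (Suc (card \<Phi>)) = (\<Sum>n<Suc (card \<Phi>). \<Sum>v\<in>\<Phi>. (norm (seq v n))\<^sup>2)"
    by (simp only: one sum_constant card_lessThan mult_1_right)
  also have "\<dots> = (\<Sum>v\<in>\<Phi>. \<Sum>n<Suc (card \<Phi>). (norm (seq v n))\<^sup>2)" by (rule sum.swap)
  also have "\<dots> \<le> (\<Sum>v\<in>\<Phi>. (norm v)\<^sup>2)" by (intro sum_mono norm_seq_sum_le) simp
  also have "\<dots> = (\<Sum>v\<in>\<Phi>. 1)" using \<Phi> by (intro sum.cong) (auto simp: quat_orthonormal_def)
  finally show False by simp
qed

lemma hilbert_schmidt_extension:
  fixes \<phi> k :: "nat \<Rightarrow> qell2"
  assumes orth: "\<And>r s. hinner (\<phi> r) (\<phi> s) = (if r = s then qreal 1 else 0)"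
    and k: "\<And>n. (\<Sum>r<n. (norm (k r))\<^sup>2) \<le> \<epsilon>"
  obtains T :: "qell2 \<Rightarrow>\<^sub>L qell2" where "\<And>s. T (\<phi> s) = k s" "\<And>x q. T (hmul x q) = hmul (T x) q"
    "\<And>I. finite I \<Longrightarrow> (\<Sum>i\<in>I. (norm (T (hbasis i)))\<^sup>2) \<le> \<epsilon>"
proof -
  have norm1: "norm (\<phi> r) = 1" for r
  proof -
    have "qreal ((norm (\<phi> r))\<^sup>2) = qreal 1" using orth[of r r] by (simp add: hinner_self)
    then have "(norm (\<phi> r))\<^sup>2 = 1\<^sup>2" by (simp add: qreal_def del: of_real_power)
    then show ?thesis by (rule power2_eq_imp_eq) auto
  qed
  have inj: "inj \<phi>"
  proof (rule injI, rule ccontr)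
    fix r s assume "\<phi> r = \<phi> s" "r \<noteq> s"
    then have "hinner (\<phi> r) (\<phi> r) = 0" using orth[of r s] by simp
    then show False by (simp add: hinner_self norm1 qreal_def zero_prod_def)
  qed
  have on: "quat_orthonormal (range \<phi>)"
    unfolding quat_orthonormal_def using norm1 orth by auto
  have sub: "\<phi> ` {..<n} \<subseteq> range \<phi>" for n by blast
  have bessel: "(\<Sum>r<n. (norm (hinner (\<phi> r) x))\<^sup>2) \<le> (norm x)\<^sup>2" for n x
    using bessel_inequality[OF on _ sub, of n x] inj by (simp add: sum.reindex inj_on_subset)
  have comb: "(norm (\<Sum>r<n. hmul (\<phi> r) (c r)))\<^sup>2 = (\<Sum>r<n. (norm (c r))\<^sup>2)" for n c
    using quat_orthonormal_combination[OF on _ sub, of n "\<lambda>v. c (inv \<phi> v)"] inj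
    by (simp add: sum.reindex inj_on_subset)
  define g where "g x r = hmul (k r) (hinner (\<phi> r) x)" for x r
  \<comment> \<open>Weighted arithmetic-geometric mean inequality: \<open>c = 1\<close> will give
    summability, and \<open>c = norm x\<close> a bound linear in \<open>norm x\<close>.\<close>
  have gle: "norm (g x r) \<le> c * (norm (k r))\<^sup>2 + (norm (hinner (\<phi> r) x))\<^sup>2 / c" if "c > 0" for x r c
  proof -
    define a b where "a = norm (k r)" and "b = norm (hinner (\<phi> r) x)"
    have "0 \<le> a * b" by (simp add: a_def b_def)
    have "0 \<le> (c * a - b)\<^sup>2" by simp
    then have "2 * c * (a * b) \<le> c * (c * a\<^sup>2) + b\<^sup>2" by (simp add: power2_eq_square algebra_simps)
    moreover have "c * (a * b) \<le> 2 * c * (a * b)" using \<open>0 \<le> a * b\<close> \<open>c > 0\<close> by simp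
    ultimately have "c * (a * b) \<le> c * (c * a\<^sup>2) + b\<^sup>2" by linarith
    then have "c * (a * b) \<le> c * (c * a\<^sup>2 + b\<^sup>2 / c)" using \<open>c > 0\<close> by (simp add: distrib_left)
    then have "a * b \<le> c * a\<^sup>2 + b\<^sup>2 / c" using \<open>c > 0\<close> by (simp only: mult_le_cancel_left_pos)
    then show ?thesis by (simp add: g_def norm_hmul a_def b_def)
  qed
  have part: "(\<Sum>r<n. norm (g x r)) \<le> c * \<epsilon> + (norm x)\<^sup>2 / c" if "c > 0" for x n c
  proof -
    have "(\<Sum>r<n. norm (g x r)) \<le> (\<Sum>r<n. c * (norm (k r))\<^sup>2 + (norm (hinner (\<phi> r) x))\<^sup>2 / c)"
      by (intro sum_mono gle that)
    also have "\<dots> = c * (\<Sum>r<n. (norm (k r))\<^sup>2) + (\<Sum>r<n. (norm (hinner (\<phi> r) x))\<^sup>2) / c"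
      by (simp add: sum.distrib sum_distrib_left sum_divide_distrib)
    also have "\<dots> \<le> c * \<epsilon> + (norm x)\<^sup>2 / c"
      using that k[of n] bessel[where n=n and x=x] by (intro add_mono mult_left_mono divide_right_mono) auto
    finally show ?thesis .
  qed
  have abs: "summable (\<lambda>r. norm (g x r))" for x
    by (rule summableI_nonneg_bounded[OF norm_ge_zero part[of 1]]) simp
  then have sm: "summable (g x)" for x by (rule summable_norm_cancel)
  define f where "f x = suminf (g x)" for x
  have bl: "bounded_linear f"
  proof (rule bounded_linear_intro[where K="\<epsilon> + 1"])
    show "f (x + y) = f x + f y" for x y
    proof -
      have "g (x + y) = (\<lambda>r. g x r + g y r)" by (simp add: g_def hinner_add_right hmul_add fun_eq_iff)
      then show ?thesis unfolding f_def using suminf_add[OF sm sm, of x y] by simp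
    qed
    show "f (c *\<^sub>R x) = c *\<^sub>R f x" for c x
    proof -
      have "g (c *\<^sub>R x) = (\<lambda>r. c *\<^sub>R g x r)" by (simp add: g_def hinner_scaleR_right hmul_scaleR fun_eq_iff)
      then show ?thesis unfolding f_def using suminf_scaleR_right[OF sm, of c x] by simp
    qed
    show "norm (f x) \<le> norm x * (\<epsilon> + 1)" for x
    proof (cases "x = 0")
      case True
      then have "g x = (\<lambda>r. 0)" by (simp add: g_def hinner_zero_right fun_eq_iff)
      then show ?thesis using True by (simp add: f_def)
    next
      case False
      then have "norm x > 0" by simp
      have "norm (f x) \<le> (\<Sum>r. norm (g x r))" unfolding f_def by (rule summable_norm[OF abs])
      also have "\<dots> \<le> norm x * \<epsilon> + (norm x)\<^sup>2 / norm x"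
        by (rule suminf_le_const[OF abs part[OF \<open>norm x > 0\<close>]])
      also have "\<dots> = norm x * (\<epsilon> + 1)" using False by (simp add: power2_eq_square algebra_simps)
      finally show ?thesis .
    qed
  qed
  define T where "T = Blinfun f"
  have T: "T x = suminf (g x)" for x using bl by (simp add: T_def bounded_linear_Blinfun_apply f_def)
  show thesis
  proof (rule that[of T])
    show "T (\<phi> s) = k s" for s
    proof -
      have "suminf (g (\<phi> s)) = (\<Sum>r\<in>{s}. g (\<phi> s) r)"
        by (rule suminf_finite) (auto simp: g_def orth)
      then show ?thesis by (simp add: T g_def orth hmul_qreal)
    qed
    show "T (hmul x q) = hmul (T x) q" for x q
    proof -
      have "g (hmul x q) = (\<lambda>r. rmul q (g x r))" by (simp add: g_def hinner_hmul_right hmul_hmul fun_eq_iff)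
      then have "T (hmul x q) = (\<Sum>r. rmul q (g x r))" by (simp only: T)
      also have "\<dots> = rmul q (suminf (g x))"
        by (rule bounded_linear.suminf[OF blinfun.bounded_linear_right sm, symmetric])
      finally show ?thesis by (simp add: T)
    qed
    show "(\<Sum>i\<in>I. (norm (T (hbasis i)))\<^sup>2) \<le> \<epsilon>" if I: "finite I" for I
    proof (rule LIMSEQ_le_const2)
      show "(\<lambda>R. \<Sum>i\<in>I. (norm (\<Sum>r<R. g (hbasis i) r))\<^sup>2) \<longlonglongrightarrow> (\<Sum>i\<in>I. (norm (T (hbasis i)))\<^sup>2)"
        unfolding T by (intro tendsto_sum tendsto_power tendsto_norm summable_LIMSEQ sm)
      have "(\<Sum>i\<in>I. (norm (\<Sum>r<R. g (hbasis i) r))\<^sup>2) \<le> \<epsilon>" for R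
      proof -
        have le: "(\<Sum>i\<in>I. (norm (seq (\<Sum>r<R. g (hbasis i) r) n))\<^sup>2) \<le> (\<Sum>r<R. (norm (seq (k r) n))\<^sup>2)" for n
        proof -
          \<comment> \<open>For fixed \<open>n\<close> the \<open>n\<close>-th coordinates of the
            images of all \<open>hbasis i\<close> are the conjugated coordinates of this one vector.
            This transposition is the basis independence of the Hilbert-Schmidt sum, in the
            direction required here.\<close>
          define y where "y = (\<Sum>r<R. hmul (\<phi> r) (qcnj (seq (k r) n)))"
          have "seq (\<Sum>r<R. g (hbasis i) r) n = qcnj (seq y i)" for i
            by (simp add: y_def g_def seq_sum hinner_hbasis qcnj_sum qcnj_qmul)
          then have "(\<Sum>i\<in>I. (norm (seq (\<Sum>r<R. g (hbasis i) r) n))\<^sup>2) \<le> (norm y)\<^sup>2"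
            using norm_seq_sum_le[OF I, of y] by simp
          then show ?thesis by (simp add: y_def comb)
        qed
        have "(\<lambda>n. \<Sum>i\<in>I. (norm (seq (\<Sum>r<R. g (hbasis i) r) n))\<^sup>2) sums (\<Sum>i\<in>I. (norm (\<Sum>r<R. g (hbasis i) r))\<^sup>2)"
          by (intro sums_sum norm_qell2_sums)
        moreover have "(\<lambda>n. \<Sum>r<R. (norm (seq (k r) n))\<^sup>2) sums (\<Sum>r<R. (norm (k r))\<^sup>2)"
          by (intro sums_sum norm_qell2_sums)
        ultimately have "(\<Sum>i\<in>I. (norm (\<Sum>r<R. g (hbasis i) r))\<^sup>2) \<le> (\<Sum>r<R. (norm (k r))\<^sup>2)"
          by (rule sums_le[OF le])
        then show ?thesis using k[of R] by linarith
      qed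
      then show "\<exists>N. \<forall>R\<ge>N. (\<Sum>i\<in>I. (norm (\<Sum>r<R. g (hbasis i) r))\<^sup>2) \<le> \<epsilon>" by blast
    qed
  qed
qed

section \<open>Normal operators and the spherical spectrum\<close>

text \<open>\<open>- S^2\<close> is positive; after rescaling \<open>S\<close> to \<open>s\<close>,
  its root comes from \<open>selfadj_sqrt\<close> with \<open>C = 1 + s^2\<close>. The last
  conclusion lets \<open>B\<close> commute with \<open>A\<close>, \<open>S\<close> and right
  multiplications.\<close>

lemma skew_modulus:
  fixes S :: "'a::{real_inner,banach} \<Rightarrow>\<^sub>L 'a"
  assumes S: "\<And>x y. inner (S x) y = - inner x (S y)"
  obtains B where "selfadj B" "\<And>x. blinfun_apply B (B x) = - S (S x)" "\<And>R. commutes R S \<Longrightarrow> commutes R B"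
proof -
  define c where "c = inverse (norm S + 1)"
  have c0: "c > 0" unfolding c_def by (simp add: add_nonneg_pos)
  define s where "s = c *\<^sub>R S"
  have ns: "norm s \<le> 1" unfolding s_def c_def by (simp add: field_simps add_pos_nonneg)
  have sx: "s x = c *\<^sub>R S x" for x by (simp add: s_def blinfun.bilinear_simps)
  have skew: "inner (s x) y = - inner x (s y)" for x y by (simp add: sx S)
  define C where "C = id_blinfun + (s o\<^sub>L s)"
  have Cx: "C x = x + s (s x)" for x by (simp add: C_def blinfun.bilinear_simps)
  have aC: "selfadj C"
    unfolding adj_def Cx inner_add_left inner_add_right skew by simp
  have nC: "norm C \<le> 1"
  proof (rule norm_blinfun_bound)
    fix x
    have "norm (s (s x)) \<le> norm (s x)"
      using norm_blinfun[of s "s x"] mult_right_mono[OF ns, of "norm (s x)"] by simp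
    then have "(norm (s (s x)))\<^sup>2 \<le> (norm (s x))\<^sup>2" by (rule power_mono) simp
    moreover have "(norm (C x))\<^sup>2 = (norm x)\<^sup>2 - 2 * (norm (s x))\<^sup>2 + (norm (s (s x)))\<^sup>2"
    proof -
      have "inner x (s (s x)) = - (norm (s x))\<^sup>2"
        unfolding power2_norm_eq_inner skew by simp
      then show ?thesis
        by (simp add: Cx power2_norm_eq_inner inner_add_left inner_add_right inner_commute)
    qed
    ultimately have "(norm (C x))\<^sup>2 \<le> (norm x)\<^sup>2" using zero_le_power2[of "norm (s x)"] by linarith
    then have "norm (C x) \<le> norm x" by (rule power2_le_imp_le) simp
    then show "norm (C x) \<le> 1 * norm x" by simp
  qed simp
  obtain R where R: "selfadj R" "\<And>x. inner (R x) x \<ge> 0" "\<And>x. R (R x) = x - C x"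
    "\<And>T. commutes T C \<Longrightarrow> commutes T R"
    by (erule selfadj_sqrt[OF aC nC])
  show thesis
  proof (rule that[of "(1/c) *\<^sub>R R"])
    show "selfadj ((1/c) *\<^sub>R R)" using R(1) by (simp add: adj_def blinfun.bilinear_simps)
    show "blinfun_apply ((1/c) *\<^sub>R R) (((1/c) *\<^sub>R R) x) = - S (S x)" for x
      using c0 by (simp add: blinfun.bilinear_simps R(3) Cx sx)
    show "commutes Q ((1/c) *\<^sub>R R)" if "commutes Q S" for Q
    proof -
      have "commutes Q C" using that by (simp add: commutes_def Cx sx blinfun.bilinear_simps)
      then have "commutes Q R" by (rule R(4))
      then show ?thesis by (simp add: commutes_def blinfun.bilinear_simps)
    qed
  qed
qed

section \<open>Passing between operators on sequences and bounded maps of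
  \<open>qell2\<close>\<close>

lemma seq_Hq: "x \<in> l2 \<Longrightarrow> seq (Hq x) = x"
  by (rule Hq_inverse)

lemma Hq_vadd: "x \<in> l2 \<Longrightarrow> y \<in> l2 \<Longrightarrow> Hq (vadd x y) = Hq x + Hq y"
  by (rule qell2_eqI) (simp add: vadd_def seq_Hq l2_add)

lemma Hq_vmul: "x \<in> l2 \<Longrightarrow> Hq (vmul x q) = hmul (Hq x) q"
  by (rule qell2_eqI) (simp add: seq_Hq l2_vmul, simp add: vmul_def)

lemma seq_vadd: "seq (x + y) = vadd (seq x) (seq y)"
  by (rule ext) (simp add: vadd_def)

lemma seq_vmul: "seq (hmul x q) = vmul (seq x) q"
  by (rule ext) (simp add: vmul_def)

lemma bounded_op_blinfun:
  fixes T :: "qell2 \<Rightarrow>\<^sub>L qell2"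
  assumes "\<And>x q. T (hmul x q) = hmul (T x) q"
  shows "bounded_op (\<lambda>x. seq (T (Hq x)))"
  unfolding bounded_op_def right_linear_def
proof (intro conjI ballI allI exI)
  fix x y q assume x: "x \<in> l2"
  show "seq (T (Hq x)) \<in> l2" by simp
  show "seq (T (Hq (vmul x q))) = vmul (seq (T (Hq x))) q"
    by (simp only: Hq_vmul[OF x] assms seq_vmul)
  show "lnorm (seq (T (Hq x))) \<le> norm T * lnorm x"
    using norm_blinfun[of T "Hq x"] lnorm_seq[of "Hq x"] by (simp add: lnorm_seq seq_Hq[OF x])
  show "seq (T (Hq (vadd x y))) = vadd (seq (T (Hq x))) (seq (T (Hq y)))" if "y \<in> l2"
    by (simp only: Hq_vadd[OF x that] blinfun.add_right seq_vadd)
qed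

lemma bounded_op_blinfunE:
  assumes "bounded_op N"
  obtains T :: "qell2 \<Rightarrow>\<^sub>L qell2" where "\<And>x. seq (T x) = N (seq x)" "\<And>x q. T (hmul x q) = hmul (T x) q"
proof -
  obtain C where N: "\<And>x. x \<in> l2 \<Longrightarrow> N x \<in> l2" "\<And>x y. x \<in> l2 \<Longrightarrow> y \<in> l2 \<Longrightarrow> N (vadd x y) = vadd (N x) (N y)"
    "\<And>x q. x \<in> l2 \<Longrightarrow> N (vmul x q) = vmul (N x) q" and C: "\<And>x. x \<in> l2 \<Longrightarrow> lnorm (N x) \<le> C * lnorm x"
    using assms unfolding bounded_op_def right_linear_def by blast
  define f where "f x = Hq (N (seq x))" for x
  have sf: "seq (f x) = N (seq x)" for x unfolding f_def by (rule seq_Hq[OF N(1)[OF seq_l2]])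
  have add: "f (x + y) = f x + f y" for x y
    unfolding f_def seq_vadd N(2)[OF seq_l2 seq_l2] by (rule Hq_vadd; intro N(1) seq_l2)
  have mul: "f (hmul x q) = hmul (f x) q" for x q
    unfolding f_def seq_vmul N(3)[OF seq_l2] by (rule Hq_vmul; intro N(1) seq_l2)
  have "bounded_linear f"
  proof (rule bounded_linear_intro[where K=C])
    show "f (c *\<^sub>R x) = c *\<^sub>R f x" for c x using mul[of x "qreal c"] by (simp only: hmul_qreal)
    show "norm (f x) \<le> norm x * C" for x
      using C[OF seq_l2[of x]] by (simp add: lnorm_seq mult.commute flip: sf)
  qed (rule add)
  then have "blinfun_apply (Blinfun f) = f" by (rule bounded_linear_Blinfun_apply)
  then show thesis using that[of "Blinfun f"] sf mul by simp
qed

lemma normal_opE: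
  assumes "normal_op N"
  obtains T T' :: "qell2 \<Rightarrow>\<^sub>L qell2" where "\<And>x. seq (T x) = N (seq x)" "\<And>x q. T (hmul x q) = hmul (T x) q"
    "\<And>x q. T' (hmul x q) = hmul (T' x) q" "adj T T'" "commutes T T'"
proof -
  obtain S where N: "bounded_op N" and S: "bounded_op S"
    and adj: "\<And>x y. x \<in> l2 \<Longrightarrow> y \<in> l2 \<Longrightarrow> linner (N x) y = linner x (S y)"
    and comm: "\<And>x. x \<in> l2 \<Longrightarrow> N (S x) = S (N x)"
    using assms unfolding normal_op_def is_adjoint_def by blast
  obtain T :: "qell2 \<Rightarrow>\<^sub>L qell2" where T: "\<And>x. seq (T x) = N (seq x)" "\<And>x q. T (hmul x q) = hmul (T x) q"
    by (erule bounded_op_blinfunE[OF N])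
  obtain T' :: "qell2 \<Rightarrow>\<^sub>L qell2" where T': "\<And>x. seq (T' x) = S (seq x)" "\<And>x q. T' (hmul x q) = hmul (T' x) q"
    by (erule bounded_op_blinfunE[OF S])
  show thesis
  proof (rule that[of T T'])
    show "adj T T'"
      unfolding adj_def
    proof (intro allI)
      fix x y
      have "hinner (T x) y = hinner x (T' y)" unfolding hinner_def T T' by (rule adj) simp_all
      then show "inner (T x) y = inner x (T' y)"
        using inner_hmul_hinner[of "T x" "qreal 1" y] inner_hmul_hinner[of x "qreal 1" "T' y"]
        by (simp add: hmul_qreal)
    qed
    show "commutes T T'"
      unfolding commutes_def
    proof
      fix x
      have "seq (T (T' x)) = seq (T' (T x))" by (simp only: T T' comm[OF seq_l2])
      then show "T (T' x) = T' (T x)" by (simp only: seq_inject)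
    qed
  qed (rule T T')+
qed

text \<open>Expanding \<open>T = A + S\<close> with \<open>S^2 = - B^2\<close> gives
  \<open>(A - a)^2 - (B + b) (B - b) + 2 S (A - a)\<close>. Every term has a factor
  \<open>A - a\<close> or \<open>B - b\<close>, so \<open>Delta\<close> is small on joint
  approximate eigenvectors.\<close>

lemma Delta_seq:
  fixes A S B T :: "qell2 \<Rightarrow>\<^sub>L qell2"
  assumes T: "\<And>x. seq (T x) = N (seq x)" and TAS: "\<And>x. T x = A x + S x"
    and AS: "\<And>x. A (S x) = S (A x)" and SB: "\<And>x. S (S x) = - B (B x)" and m: "m \<in> Sph"
  shows "Delta N (qreal a + b *\<^sub>R m) (seq x) = seq (A (A x - a *\<^sub>R x) - a *\<^sub>R (A x - a *\<^sub>R x)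
    - (B (B x - b *\<^sub>R x) + b *\<^sub>R (B x - b *\<^sub>R x)) + 2 *\<^sub>R S (A x - a *\<^sub>R x))"
proof
  fix n
  have m': "qcnj m = - m" "norm m = 1" using m by (auto simp: Sph_def)
  have 1: "(qreal a + b *\<^sub>R m) + qcnj (qreal a + b *\<^sub>R m) = qreal (2 * a)"
  proof -
    have "qcnj (qreal a + b *\<^sub>R m) = qreal a + b *\<^sub>R qcnj m"
      by (simp add: qcnj_def qreal_def prod_eq_iff scaleR_conv_of_real)
    then show ?thesis by (simp add: m') (simp add: qreal_def)
  qed
  have 2: "(norm (qreal a + b *\<^sub>R m))\<^sup>2 = a\<^sup>2 + b\<^sup>2"
  proof -
    have "Re (fst m) = 0" using arg_cong[OF m'(1), of "\<lambda>q. Re (fst q)"] by (simp add: qcnj_def)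
    then have "inner (qreal a) m = 0" by (simp add: qreal_def inner_prod_def inner_complex_def)
    then have "(norm (qreal a + b *\<^sub>R m))\<^sup>2 = (norm (qreal a))\<^sup>2 + (norm (b *\<^sub>R m))\<^sup>2"
      by (intro norm_add_Pythagorean) (simp add: orthogonal_def)
    then show ?thesis by (simp add: m')
  qed
  have "Delta N (qreal a + b *\<^sub>R m) (seq x) n = seq (T (T x) - (2 * a) *\<^sub>R T x + (a\<^sup>2 + b\<^sup>2) *\<^sub>R x) n"
    unfolding Delta_def 1 2 qmul_qreal_right by (simp add: T)
  also have "T (T x) - (2 * a) *\<^sub>R T x + (a\<^sup>2 + b\<^sup>2) *\<^sub>R x
    = A (A x - a *\<^sub>R x) - a *\<^sub>R (A x - a *\<^sub>R x)
      - (B (B x - b *\<^sub>R x) + b *\<^sub>R (B x - b *\<^sub>R x)) + 2 *\<^sub>R S (A x - a *\<^sub>R x)"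
    by (simp add: TAS blinfun.bilinear_simps AS SB scaleR_add_left scaleR_diff_left scaleR_add_right
        scaleR_diff_right scaleR_2 power2_eq_square algebra_simps, simp flip: scaleR_add_left)
  finally show "Delta N (qreal a + b *\<^sub>R m) (seq x) n = seq \<dots> n" .
qed

text \<open>The bounded inverse clause of \<open>rho_S\<close> would give
  \<open>norm x \<le> \<bar>C\<bar> W e norm x\<close>, where \<open>W\<close> collects the norms
  and scalars in \<open>Delta_seq\<close>; \<open>e\<close> is chosen so that
  \<open>\<bar>C\<bar> W e < 1\<close>.\<close>

lemma sigma_S_approximate_eigenvector:
  fixes A S B T :: "qell2 \<Rightarrow>\<^sub>L qell2"
  assumes T: "\<And>x. seq (T x) = N (seq x)" and TAS: "\<And>x. T x = A x + S x"
    and AS: "\<And>x. A (S x) = S (A x)" and SB: "\<And>x. S (S x) = - B (B x)" and m: "m \<in> Sph"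
    and approx: "\<And>e. e > 0 \<Longrightarrow> \<exists>x. x \<noteq> 0 \<and> norm (A x - a *\<^sub>R x) \<le> e * norm x \<and> norm (B x - b *\<^sub>R x) \<le> e * norm x"
  shows "qreal a + b *\<^sub>R m \<in> sigma_S N"
proof (rule ccontr)
  assume "qreal a + b *\<^sub>R m \<notin> sigma_S N"
  then obtain C where C: "\<And>x. x \<in> l2 \<Longrightarrow> lnorm x \<le> C * lnorm (Delta N (qreal a + b *\<^sub>R m) x)"
    unfolding sigma_S_def rho_S_def by blast
  define W where "W = norm A + \<bar>a\<bar> + norm B + \<bar>b\<bar> + 2 * norm S"
  have W: "W \<ge> 0" by (simp add: W_def)
  define w where "w = \<bar>C\<bar> * W"
  have w: "0 \<le> w" using W by (simp add: w_def)
  define e where "e = 1 / (2 * (w + 1))"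
  have e: "e > 0" using w by (simp add: e_def)
  have "w * e < 1" using w by (simp add: e_def)
  then have Ce: "\<bar>C\<bar> * W * e < 1" by (simp only: w_def)
  obtain x where x: "x \<noteq> 0" "norm (A x - a *\<^sub>R x) \<le> e * norm x" "norm (B x - b *\<^sub>R x) \<le> e * norm x"
    using approx[OF e] by blast
  define u v where "u = A x - a *\<^sub>R x" and "v = B x - b *\<^sub>R x"
  define d where "d = e * norm x"
  have d: "d \<ge> 0" using e by (simp add: d_def)
  have ud: "norm u \<le> d" and vd: "norm v \<le> d" using x by (simp_all add: u_def v_def d_def)
  have bnd: "norm (Q y) \<le> norm Q * d" if "norm y \<le> d" for Q :: "qell2 \<Rightarrow>\<^sub>L qell2" and y
    using norm_blinfun[of Q y] mult_left_mono[OF that norm_ge_zero[of Q]] by linarith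
  have scl: "norm (c *\<^sub>R y) \<le> \<bar>c\<bar> * d" if "norm y \<le> d" for c and y :: qell2
    using that by (simp add: mult_left_mono)
  have S2: "norm (2 *\<^sub>R S u) \<le> 2 * (norm S * d)" using bnd[OF ud, of S] by simp
  have "norm (A u - a *\<^sub>R u - (B v + b *\<^sub>R v) + 2 *\<^sub>R S u)
      \<le> (norm A * d + \<bar>a\<bar> * d) + (norm B * d + \<bar>b\<bar> * d) + 2 * (norm S * d)"
    by (intro order_trans[OF norm_triangle_ineq] order_trans[OF norm_triangle_ineq4] add_mono bnd scl S2 ud vd)
  also have "\<dots> = W * d" by (simp add: W_def algebra_simps)
  finally have "lnorm (Delta N (qreal a + b *\<^sub>R m) (seq x)) \<le> W * d"
    unfolding Delta_seq[OF T TAS AS SB m] lnorm_seq u_def v_def .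
  moreover define \<delta> where "\<delta> = lnorm (Delta N (qreal a + b *\<^sub>R m) (seq x))"
  ultimately have \<delta>: "\<delta> \<le> W * d" by simp
  have "0 \<le> \<delta>" unfolding \<delta>_def Delta_seq[OF T TAS AS SB m] lnorm_seq by simp
  have "norm x \<le> C * \<delta>" using C[OF seq_l2[of x]] by (simp only: lnorm_seq \<delta>_def)
  also have "\<dots> \<le> \<bar>C\<bar> * \<delta>" using \<open>0 \<le> \<delta>\<close> by (intro mult_right_mono) auto
  also have "\<dots> \<le> \<bar>C\<bar> * (W * d)" using \<delta> by (intro mult_left_mono) auto
  also have "\<dots> = (\<bar>C\<bar> * W * e) * norm x" by (simp add: d_def)
  also have "\<dots> < 1 * norm x" using Ce x(1) by (intro mult_strict_right_mono) simp_all
  finally show False by simp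
qed

text \<open>The real part and the pairing with the unit vector \<open>m\<close> are the coordinates
  on \<open>Cm m\<close>. Neither increases distances, so their sums in the max norm are bounded by
  chord sums of the curve.\<close>

lemma finite_length_curve_projections:
  assumes \<gamma>: "finite_length_curve \<gamma>" and m: "m \<in> Sph"
  obtains L where "0 \<le> L"
    "\<And>(n::nat) t. t 0 = 0 \<Longrightarrow> t n = 1 \<Longrightarrow> (\<forall>i<n. t i \<le> t (Suc i)) \<Longrightarrow>
      (\<Sum>i<n. max \<bar>Re (fst (\<gamma> (t i))) - Re (fst (\<gamma> (t (Suc i))))\<bar> \<bar>inner m (\<gamma> (t i)) - inner m (\<gamma> (t (Suc i)))\<bar>) \<le> L"
proof -
  obtain L where L: "\<And>(n::nat) t. t 0 = 0 \<Longrightarrow> t n = 1 \<Longrightarrow> (\<forall>i<n. t i \<le> t (Suc i)) \<Longrightarrow>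
      (\<Sum>i<n. dist (\<gamma> (t i)) (\<gamma> (t (Suc i)))) \<le> L"
    using \<gamma> unfolding finite_length_curve_def by blast
  have "norm m = 1" using m by (simp add: Sph_def)
  have le: "max \<bar>Re (fst p) - Re (fst q)\<bar> \<bar>inner m p - inner m q\<bar> \<le> dist p q" for p q :: quat
  proof -
    have "\<bar>Re (fst p) - Re (fst q)\<bar> \<le> norm (fst (p - q))"
      using abs_Re_le_cmod[of "fst (p - q)"] by simp
    also have "\<dots> \<le> norm (p - q)" using norm_fst_le[of "fst (p - q)" "snd (p - q)"] by (simp only: prod.collapse)
    finally have "\<bar>Re (fst p) - Re (fst q)\<bar> \<le> dist p q" by (simp add: dist_norm)
    moreover have "\<bar>inner m (p - q)\<bar> \<le> norm m * norm (p - q)" by (rule Cauchy_Schwarz_ineq2)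
    then have "\<bar>inner m p - inner m q\<bar> \<le> dist p q" by (simp add: inner_diff_right dist_norm \<open>norm m = 1\<close>)
    ultimately show ?thesis by simp
  qed
  show thesis
  proof (rule that[of L])
    have "(\<Sum>i<1. dist (\<gamma> (real i)) (\<gamma> (real (Suc i)))) \<le> L" by (rule L) auto
    then have "dist (\<gamma> 0) (\<gamma> 1) \<le> L" by simp
    then show "0 \<le> L" by (rule order_trans[OF zero_le_dist])
    show "(\<Sum>i<n. max \<bar>Re (fst (\<gamma> (t i))) - Re (fst (\<gamma> (t (Suc i))))\<bar> \<bar>inner m (\<gamma> (t i)) - inner m (\<gamma> (t (Suc i)))\<bar>) \<le> L"
      if "t 0 = 0" "t n = 1" "\<forall>i<n. t i \<le> t (Suc i)" for n :: nat and t
      by (rule order_trans[OF sum_mono L[OF that]]) (rule le)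
  qed
qed

lemma Sph_coordinates:
  assumes "m \<in> Sph"
  shows "Re (fst (qreal a + b *\<^sub>R m)) = a" "inner m (qreal a + b *\<^sub>R m) = b"
proof -
  have m: "qcnj m = - m" "norm m = 1" using assms by (auto simp: Sph_def)
  have 0: "Re (fst m) = 0" using arg_cong[OF m(1), of "\<lambda>q. Re (fst q)"] by (simp add: qcnj_def)
  show "Re (fst (qreal a + b *\<^sub>R m)) = a" by (simp add: qreal_def 0)
  have "inner m m = 1" using m(2) by (simp add: norm_eq_1)
  then show "inner m (qreal a + b *\<^sub>R m) = b"
    by (simp add: inner_add_right qreal_def inner_prod_def[of m "(_, _)"] inner_complex_def 0)
qed

theorem theorem3p5:
  fixes N :: qop and m :: quat and K :: "quat set"
  assumes "normal_op N"
    and "m \<in> Sph"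
    and "compact K" and "K \<subseteq> Cm_plus m"
    and "\<exists>\<gamma>. finite_length_curve \<gamma> \<and> path_image \<gamma> \<subseteq> Cm m \<and> K \<subseteq> path_image \<gamma>"
    and "sigma_S N = Omega m K"
  shows "\<forall>\<epsilon>>0. \<exists>D K'. bounded_op D \<and> diagonal_op D \<and> bounded_op K' \<and> hilbert_schmidt K'
            \<and> hs_norm K' < \<epsilon> \<and> (\<forall>x\<in>l2. N x = vadd (D x) (K' x))"
proof (intro allI impI)
  fix \<epsilon> :: real assume "\<epsilon> > 0"
  obtain T T' :: "qell2 \<Rightarrow>\<^sub>L qell2" where T: "\<And>x. seq (T x) = N (seq x)" "\<And>x q. T (hmul x q) = hmul (T x) q"
    "\<And>x q. T' (hmul x q) = hmul (T' x) q" "adj T T'" "commutes T T'"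
    by (erule normal_opE[OF assms(1)])
  define A where "A = (1/2) *\<^sub>R (T + T')"
  define S where "S = (1/2) *\<^sub>R (T - T')"
  have Ax: "A x = (1/2) *\<^sub>R (T x + T' x)" for x by (simp add: A_def blinfun.bilinear_simps)
  have Sx: "S x = (1/2) *\<^sub>R (T x - T' x)" for x by (simp add: S_def blinfun.bilinear_simps)
  have T'T: "inner (T' x) y = inner x (T y)" for x y
    using adjD[OF T(4), of y x] by (simp only: inner_commute)
  have aA: "selfadj A"
    unfolding adj_def Ax by (simp add: inner_add_left inner_add_right adjD[OF T(4)] T'T)
  have skS: "inner (S x) y = - inner x (S y)" for x y
  proof -
    have "inner (T x - T' x) y = - inner x (T y - T' y)"
      by (simp add: inner_diff_left inner_diff_right adjD[OF T(4)] T'T)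
    then show ?thesis by (simp only: Sx inner_scaleR_left inner_scaleR_right)
  qed
  have aS: "adj S (- S)"
    by (simp add: adj_def skS blinfun.bilinear_simps)
  have TT': "T' (T x) = T (T' x)" for x using commutesD[OF T(5)] by simp
  have AS: "A (S x) = S (A x)" for x
    by (simp add: Ax Sx blinfun.bilinear_simps TT' algebra_simps)
  have TAS: "T x = A x + S x" for x
    by (simp add: Ax Sx scaleR_add_right scaleR_diff_right flip: scaleR_add_left)
  have A_hmul: "A (hmul x q) = hmul (A x) q" and S_hmul: "S (hmul x q) = hmul (S x) q" for x q
    by (simp_all add: Ax Sx T hmul_scaleR_left hmul_add_left hmul_diff_left)
  obtain B where B: "selfadj B" "\<And>x. blinfun_apply B (B x) = - S (S x)" "\<And>R. commutes R S \<Longrightarrow> commutes R B"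
    by (erule skew_modulus[OF skS])
  have SB: "S (S x) = - B (B x)" for x by (simp add: B(2))
  have AB: "commutes A B" using AS by (intro B(3)) (simp add: commutes_def)
  have SB': "commutes S B" by (intro B(3)) (simp add: commutes_def)
  have RB: "commutes (rmul q) B" for q by (intro B(3)) (simp add: commutes_def S_hmul)
  obtain E where E: "dyadic_family E"
    "\<And>k p R R'. adj R R' \<Longrightarrow> commutes R A \<Longrightarrow> commutes R B \<Longrightarrow> commutes R (E k p)"
    "\<And>k p x. E k p x = x \<Longrightarrow> norm (A x - (real_of_int (fst p) / 2 ^ k) *\<^sub>R x) \<le> norm x / 2 ^ k"
    "\<And>k p x. E k p x = x \<Longrightarrow> norm (B x - (real_of_int (snd p) / 2 ^ k) *\<^sub>R x) \<le> norm x / 2 ^ k"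
    by (erule joint_spectral_dyadic[OF aA B(1) AB])
  interpret dyadic_family E by (rule E(1))
  obtain \<gamma> where \<gamma>: "finite_length_curve \<gamma>" "path_image \<gamma> \<subseteq> Cm m" "K \<subseteq> path_image \<gamma>"
    using assms(5) by blast
  obtain L where L: "0 \<le> L"
    "\<And>(n::nat) t. t 0 = 0 \<Longrightarrow> t n = 1 \<Longrightarrow> (\<forall>i<n. t i \<le> t (Suc i)) \<Longrightarrow>
      (\<Sum>i<n. max \<bar>Re (fst (\<gamma> (t i))) - Re (fst (\<gamma> (t (Suc i))))\<bar> \<bar>inner m (\<gamma> (t i)) - inner m (\<gamma> (t (Suc i)))\<bar>) \<le> L"
    by (erule finite_length_curve_projections[OF \<gamma>(1) assms(2)])
  define a where "a s = Re (fst (\<gamma> s))" for s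
  define b where "b s = inner m (\<gamma> s)" for s
  \<comment> \<open>Circularization determines the second coordinate only up to sign, so a square
    may meet the curve (\<open>c = 1\<close>) or its mirror image (\<open>c = - 1\<close>).\<close>
  define C where "C c k = {p. \<exists>s\<in>{0..1}. (a s, c * b s) \<in> cell k p}" for c :: real and k
  have C: "finite (C c k) \<and> real (card (C c k)) \<le> 4 * (L * 2 ^ k + 1)" if "\<bar>c\<bar> = 1" for c k
    unfolding C_def
  proof (rule cells_on_curve[OF _ L(1)])
    fix n :: nat and t :: "nat \<Rightarrow> real" assume t: "t 0 = 0" "t n = 1" "\<forall>i<n. t i \<le> t (Suc i)"
    have "\<bar>c * x - c * y\<bar> = \<bar>x - y\<bar>" for x y using that by (simp add: abs_mult flip: right_diff_distrib)
    then show "(\<Sum>i<n. max \<bar>a (t i) - a (t (Suc i))\<bar> \<bar>c * b (t i) - c * b (t (Suc i))\<bar>) \<le> L"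
      using L(2)[OF t] by (simp add: a_def b_def)
  qed
  have active: "active k \<subseteq> C 1 k \<union> C (- 1) k" for k
  proof
    fix p assume "p \<in> active k"
    then obtain z where z: "z \<in> cell k p" "\<And>n. \<exists>q\<in>active (k + n). z \<in> cell (k + n) q"
      by (erule active_cell_limit)
    have "qreal (fst z) + snd z *\<^sub>R m \<in> sigma_S N"
    proof (rule sigma_S_approximate_eigenvector[OF T(1) TAS AS SB assms(2)])
      fix e :: real assume "e > 0"
      then obtain x where "x \<noteq> 0" "norm (A x - fst z *\<^sub>R x) \<le> e * norm x" "norm (B x - snd z *\<^sub>R x) \<le> e * norm x"
        using approximate_eigenvector[OF E(3,4) z(2)] by blast
      then show "\<exists>x. x \<noteq> 0 \<and> norm (A x - fst z *\<^sub>R x) \<le> e * norm x \<and> norm (B x - snd z *\<^sub>R x) \<le> e * norm x"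
        by blast
    qed
    then obtain \<alpha> \<beta> j where j: "qreal (fst z) + snd z *\<^sub>R m = qreal \<alpha> + \<beta> *\<^sub>R j" "qreal \<alpha> + \<beta> *\<^sub>R m \<in> K" "j \<in> Sph"
      unfolding assms(6) Omega_def by blast
    \<comment> \<open>Real parts identify \<open>\<alpha>\<close>; comparing norms of the imaginary
      parts then gives \<open>\<bar>\<beta>\<bar>\<close>, whatever the unit \<open>j\<close>
      is.\<close>
    have \<alpha>: "fst z = \<alpha>"
      using arg_cong[OF j(1), of "\<lambda>q. Re (fst q)"] by (simp only: Sph_coordinates[OF assms(2)] Sph_coordinates[OF j(3)])
    then have "norm (snd z *\<^sub>R m) = norm (\<beta> *\<^sub>R j)" using j(1) by simp
    then have \<beta>: "\<bar>snd z\<bar> = \<bar>\<beta>\<bar>" using assms(2) j(3) by (simp add: Sph_def)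
    obtain s where s: "s \<in> {0..1}" "\<gamma> s = qreal \<alpha> + \<beta> *\<^sub>R m"
      using j(2) \<gamma>(3) unfolding path_image_def by force
    then have "a s = fst z" "b s = \<beta>" unfolding a_def b_def by (simp_all only: Sph_coordinates[OF assms(2)] \<alpha>)
    then have "(a s, 1 * b s) = z \<or> (a s, - 1 * b s) = z"
      using \<beta> by (auto simp: prod_eq_iff abs_eq_iff)
    then show "p \<in> C 1 k \<union> C (- 1) k" using z(1) s(1) unfolding C_def by blast
  qed
  \<comment> \<open>At most \<open>4 (L 2^k + 1)\<close> squares each for the curve and its mirror
    image, together with \<open>1 \<le> 2^k\<close>.\<close>
  have card: "real (card (active k)) \<le> 8 * (L + 1) * 2 ^ k" for k
  proof -
    have "card (active k) \<le> card (C 1 k) + card (C (- 1) k)"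
      using card_mono[OF _ active[of k]] C[of 1 k] C[of "- 1" k] card_Un_le[of "C 1 k" "C (- 1) k"] by simp
    then have "real (card (active k)) \<le> real (card (C 1 k)) + real (card (C (- 1) k))" by linarith
    also have "\<dots> \<le> 4 * (L * 2 ^ k + 1) + 4 * (L * 2 ^ k + 1)"
      using C[of 1 k] C[of "- 1" k] by (intro add_mono) auto
    also have "\<dots> \<le> 8 * (L + 1) * 2 ^ k" by (simp add: algebra_simps)
    finally show ?thesis .
  qed
  interpret quat_dyadic_family E A S B m "8 * (L + 1)"
  proof
    have RA: "commutes (rmul q) A" for q by (simp add: commutes_def A_hmul)
    show "E k p (hmul x q) = hmul (E k p x) q" for k p x q
      using E(2)[OF adj_rmul RA RB, of q k p] by (simp add: commutes_def)
    \<comment> \<open>An operator commutes with \<open>E\<close> once it has an adjoint and commutes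
      with both \<open>A\<close> and \<open>B\<close>; for \<open>S\<close> the adjoint is
      \<open>- S\<close>.\<close>
    have SA: "commutes S A" using AS by (simp add: commutes_def)
    show "E k p (S x) = S (E k p x)" for k p x
      using E(2)[OF aS SA SB', of k p] by (simp add: commutes_def)
    have BB: "commutes B B" by (simp add: commutes_def)
    show "E k p (B x) = B (E k p x)" for k p x
      using E(2)[OF B(1) commutes_sym[OF AB] BB, of k p] by (simp add: commutes_def)
    show "S (hmul x q) = hmul (S x) q" for x q by (rule S_hmul)
    show "B (hmul x q) = hmul (B x) q" for x q using RB[of q] by (simp add: commutes_def)
    show "inner (S x) y = - inner x (S y)" for x y by (rule skS)
    show "inner (B x) y = inner x (B y)" for x y by (rule adjD[OF B(1)])
    show "S (S x) = - B (B x)" for x by (rule SB)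
    show "S (B x) = B (S x)" for x using SB' by (simp add: commutes_def)
    show "real (card (active k)) \<le> 8 * (L + 1) * 2 ^ k" for k by (rule card)
    show "norm (A x - (real_of_int (fst p) / 2 ^ k) *\<^sub>R x) \<le> norm x / 2 ^ k" if "E k p x = x" for k p x
      using that by (rule E(3))
    show "norm (B x - (real_of_int (snd p) / 2 ^ k) *\<^sub>R x) \<le> norm x / 2 ^ k" if "E k p x = x" for k p x
      using that by (rule E(4))
    show "m \<in> Sph" by (rule assms(2))
  qed
  \<comment> \<open>Half of \<open>\<epsilon>\<close> is used because limits of partial sums give
    only a weak inequality, while \<open>hs_norm K' < \<epsilon>\<close> is strict.\<close>
  obtain \<Phi> :: "qell2 set" and \<mu> :: "qell2 \<Rightarrow> quat" where \<Phi>: "quat_orthonormal \<Phi>" "\<And>u. (\<And>v. v \<in> \<Phi> \<Longrightarrow> hinner v u = 0) \<Longrightarrow> u = 0"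
    "\<And>F. finite F \<Longrightarrow> F \<subseteq> \<Phi> \<Longrightarrow> (\<Sum>v\<in>F. (norm (A v + S v - hmul v (\<mu> v)))\<^sup>2) \<le> \<epsilon> / 2"
    by (erule approximate_eigenbasis[OF half_gt_zero[OF \<open>\<epsilon> > 0\<close>]])
  have "infinite \<Phi>" using \<Phi>(1,2) by (rule total_quat_orthonormal_infinite)
  then have bij: "bij_betw (from_nat_into \<Phi>) UNIV \<Phi>"
    using countable_quat_orthonormal[OF \<Phi>(1)] by (rule bij_betw_from_nat_into[rotated])
  define \<phi> where "\<phi> = from_nat_into \<Phi>"
  have \<phi>: "\<phi> r \<in> \<Phi>" "inj \<phi>" "range \<phi> = \<Phi>" for r using bij by (auto simp: \<phi>_def bij_betw_def)
  have orth: "hinner (\<phi> r) (\<phi> s) = (if r = s then qreal 1 else 0)" for r s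
    using \<Phi>(1) \<phi>(1)[of r] \<phi>(1)[of s] injD[OF \<phi>(2), of r s] by (auto simp: quat_orthonormal_def hinner_self)
  \<comment> \<open>The error of the approximate eigenvector \<open>\<phi> r\<close>. Subtracting an
    operator \<open>Q\<close> with these values leaves \<open>T - Q\<close> exactly diagonal in the
    basis \<open>\<phi>\<close>.\<close>
  define k where "k r = T (\<phi> r) - hmul (\<phi> r) (\<mu> (\<phi> r))" for r
  have "(\<Sum>r<n. (norm (k r))\<^sup>2) \<le> \<epsilon> / 2" for n
  proof -
    have "(\<Sum>r<n. (norm (k r))\<^sup>2) = (\<Sum>v\<in>\<phi> ` {..<n}. (norm (A v + S v - hmul v (\<mu> v)))\<^sup>2)"
      using \<phi>(2) by (simp add: sum.reindex inj_on_subset k_def TAS)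
    also have "\<dots> \<le> \<epsilon> / 2" using \<phi>(1) by (intro \<Phi>(3)) auto
    finally show ?thesis .
  qed
  then obtain Q :: "qell2 \<Rightarrow>\<^sub>L qell2" where Q: "\<And>s. Q (\<phi> s) = k s" "\<And>x q. Q (hmul x q) = hmul (Q x) q"
    "\<And>I. finite I \<Longrightarrow> (\<Sum>i\<in>I. (norm (Q (hbasis i)))\<^sup>2) \<le> \<epsilon> / 2"
    by (erule hilbert_schmidt_extension[OF orth])
  define D where "D x = seq ((T - Q) (Hq x))" for x
  define K' where "K' x = seq (Q (Hq x))" for x
  have "bounded_op D"
    unfolding D_def by (rule bounded_op_blinfun) (simp add: blinfun.bilinear_simps T(2) Q(2) hmul_diff_left)
  moreover have "diagonal_op D"
    unfolding diagonal_op_def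
  proof (intro exI conjI allI)
    show "orthonormal_basis (\<lambda>r. seq (\<phi> r))"
      unfolding orthonormal_basis_def
    proof (intro conjI allI ballI impI)
      show "linner (seq (\<phi> r)) (seq (\<phi> s)) = (if r = s then qreal 1 else 0)" for r s
        using orth[of r s] by (simp only: hinner_def)
      fix x assume "x \<in> l2" "\<forall>r. linner (seq (\<phi> r)) x = 0"
      then have "hinner v (Hq x) = 0" if "v \<in> \<Phi>" for v
        using that unfolding \<phi>(3)[symmetric] hinner_def by (auto simp: seq_Hq)
      then have "Hq x = 0" by (rule \<Phi>(2))
      then show "x = (\<lambda>n. 0)" using seq_Hq[OF \<open>x \<in> l2\<close>] by (metis seq_zero ext)
    qed simp
    show "D (seq (\<phi> r)) = vmul (seq (\<phi> r)) (\<mu> (\<phi> r))" for r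
      by (simp add: D_def seq_inverse blinfun.bilinear_simps Q(1) k_def seq_vmul)
  qed
  moreover have "bounded_op K'"
    unfolding K'_def by (rule bounded_op_blinfun) (rule Q(2))
  moreover have K'_std: "lnorm (K' (std_basis r)) = norm (Q (hbasis r))" for r
    by (simp add: K'_def lnorm_seq hbasis_def)
  have "summable (\<lambda>r. (lnorm (K' (std_basis r)))\<^sup>2)"
    unfolding K'_std by (rule summableI_nonneg_bounded[OF _ Q(3)]) auto
  moreover from this have "(\<Sum>r. (lnorm (K' (std_basis r)))\<^sup>2) \<le> \<epsilon> / 2"
    unfolding K'_std by (rule suminf_le_const) (rule Q(3); simp)
  moreover have "N x = vadd (D x) (K' x)" if "x \<in> l2" for x
  proof -
    have "vadd (D x) (K' x) = seq (T (Hq x))"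
      by (simp add: D_def K'_def blinfun.bilinear_simps flip: seq_vadd)
    then show ?thesis by (simp add: T(1) seq_Hq[OF that])
  qed
  ultimately show "\<exists>D K'. bounded_op D \<and> diagonal_op D \<and> bounded_op K' \<and> hilbert_schmidt K'
            \<and> hs_norm K' < \<epsilon> \<and> (\<forall>x\<in>l2. N x = vadd (D x) (K' x))"
    unfolding hilbert_schmidt_def hs_norm_def using \<open>\<epsilon> > 0\<close>
    by (intro exI[of _ D] exI[of _ K'] conjI ballI) auto
qed

end
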